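(* Let $\theta\in(\underline\theta,\bar\theta)$. For any $V\in\mathbb R$ and $t>0$, $$\mathbf{Var}(J^{(V)}(t))=\mathbf{Var}(\omega_0)\cdot\widehat{\mathbf E}\bigl(\bigl|Q(t)-[Vt]\bigr|\bigr),$$ where the variance on the left is for the process started from the stationary distribution $\underline\mu_\theta$, $\mathbf{Var}(\omega_0)$ is the variance of $\mu_\theta$, and $\widehat{\mathbf E}$ is the expectation for the process started from $\underline{\widehat\mu}_\theta$ together with a second class particle started at the origin, with position $Q(t)$ at time $t$.
   Context: **Model.** Let $-\infty\le\omega^{\min}\le 0$ and $1\le\omega^{\max}\le\infty$ be (possibly infinite valued) integers, $I=\{z\in\mathbb Z:\omega^{\min}-1<z<\omega^{\max}+1\}$, $\Omega=I^{\mathbb Z}$, with elements $\underline\omega=(\omega_i)_{i\in\mathbb Z}$. Integer heights $h_i$ ($i\in\mathbb Z$) satisfy $\omega_i=h_{i-1}-h_i$. The dynamics: for each $i\in\mathbb Z$, at rate $p(\omega_i,\omega_{i+1})$ a brick is added, $(\omega_i,\omega_{i+1})\to(\omega_i-1,\omega_{i+1}+1)$, $h_i\to h_i+1$; at rate $q(\omega_i,\omega_{i+1})$ a brick is removed, $(\omega_i,\omega_{i+1})\to(\omega_i+1,\omega_{i+1}-1)$, $h_i\to h_i-1$. Conditionally on $\underline\omega(t)$ these moves are independent. The process is Markov with formal generator, on cylinder functions $\varphi$ (functions of finitely many coordinates), $$(L\varphi)(\underline\omega)=\sum_{i}p(\omega_i,\omega_{i+1})[\varphi(\dots,\omega_i-1,\omega_{i+1}+1,\dots)-\varphi(\underline\omega)]+\sum_i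 q(\omega_i,\omega_{i+1})[\varphi(\dots,\omega_i+1,\omega_{i+1}-1,\dots)-\varphi(\underline\omega)].$$ **Standing assumptions on $p,q:I\times I\to[0,\infty)$.** (1) $p(\omega^{\min},\cdot)\equiv p(\cdot,\omega^{\max})\equiv q(\omega^{\max},\cdot)\equiv q(\cdot,\omega^{\min})\equiv0$ whenever the corresponding $\omega^{\min}$ or $\omega^{\max}$ is finite. Either $p$ and $q$ are both non-zero in all other cases, or one of them is identically zero (and the other is non-zero in all other cases). (2) (Attractivity) $p(z+1,y)\ge p(z,y)$, $p(y,z+1)\le p(y,z)$, $q(z+1,y)\le q(z,y)$, $q(y,z+1)\ge q(y,z)$ for $y,z,z+1\in I$. (3) For all $x,y,z\in I$: $p(x,y)+p(y,z)+p(z,x)+q(x,y)+q(y,z)+q(z,x)=p(x,z)+p(z,y)+p(y,x)+q(x,z)+q(z,y)+q(y,x)$. (4) There are symmetric functions $s_p,s_q$ and a function $f$, with $f(\omega^{\min})=0$ if $\omega^{\min}$ is finite, such that $p(y,z)=s_p(y,z+1)f(y)$ and $q(y,z)=s_q(y+1,z)f(z)$ for $y,z\in I$. ($f$ is then non-decreasing on $I$.) (5) All moments of the rates $p(\omega_0,\omega_1),q(\omega_0,\omega_1)$ are finite under the distributions $\underline\mu_\theta$ below. (6) The dynamics exists on a set $\widetilde\Omega\subset\Omega$ of tempered configurations (configurations obeying some growth restrictions) of full $\underline\mu_\theta$-measure, with the usual properties of the semigroup and the generator acting on nice functions. **Stationary measures.** For $z\in I$: $f(z)!=\prod_{y=1}^zf(y)$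 if $z>0$, $f(0)!=1$, $f(z)!=1/\prod_{y=z+1}^0f(y)$ if $z<0$. Let $\bar\theta=\lim_{z\to\infty}\log f(z)$ if $\omega^{\max}=\infty$, $\bar\theta=\infty$ otherwise; $\underline\theta=\lim_{z\to\infty}\log f(-z)$ if $\omega^{\min}=-\infty$, $\underline\theta=-\infty$ otherwise. Assume $\underline\theta<\bar\theta$. For $\theta\in(\underline\theta,\bar\theta)$ let $Z(\theta)=\sum_{z\in I}e^{\theta z}/f(z)!<\infty$, $\mu_\theta(z)=\frac1{Z(\theta)}\frac{e^{\theta z}}{f(z)!}$ for $z\in I$ and $\mu_\theta(z)=0$ for $z\notin I$. $\underline\mu_\theta$ is the product distribution on $\Omega$ with all marginals $\mu_\theta$; it is stationary for the process. **Basic coupling and second class particle.** Two copies $\underline\eta(\cdot)\le\underline\zeta(\cdot)$ (coordinatewise) of the process are coupled as follows. For each $i$ write "up" for the move $(\cdot_i,\cdot_{i+1})\to(\cdot_i-1,\cdot_{i+1}+1)$ and "down" for $(\cdot_i,\cdot_{i+1})\to(\cdot_i+1,\cdot_{i+1}-1)$. The rates are: only $\underline\zeta$ up: $p(\zeta_i,\zeta_{i+1})-p(\eta_i,\zeta_{i+1})$; only $\underline\eta$ up: $p(\eta_i,\eta_{i+1})-p(\eta_i,\zeta_{i+1})$; both up: $p(\eta_i,\zeta_{i+1})$; only $\underline\zeta$ down: $q(\zeta_i,\zeta_{i+1})-q(\zeta_i,\eta_{i+1})$; only $\underline\eta$ down: $q(\eta_i,\eta_{i+1})-q(\zeta_i,\eta_{i+1})$;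 both down: $q(\zeta_i,\eta_{i+1})$. This preserves $\underline\eta\le\underline\zeta$ and the total discrepancy. Let $\underline\delta_i$ be the configuration that is $1$ at site $i$ and $0$ elsewhere. If $\omega_0(0)<\omega^{\max}$, start the coupled pair $(\underline\omega,\underline\omega^+)$ (as $(\underline\eta,\underline\zeta)$) with $\underline\omega^+(0)=\underline\omega(0)+\underline\delta_0$; then $\underline\omega^+(t)=\underline\omega(t)+\underline\delta_{Q(t)}$ for all $t\ge0$, which defines $Q(t)$, the position of the second class particle. **Modified initial distribution.** Let $g(z)=z-\sum_{y\in I}y\,\mu_\theta(y)$. $\underline{\widehat\mu}_\theta$ is the product measure with marginal $\mu_\theta$ at every site except the origin, where $$\underline{\widehat\mu}_\theta\{\underline\omega:\omega_0=y\}=\frac1{\mathbf{Var}(\omega_0)}\sum_{z=y+1}^{\omega^{\max}}g(z)\mu_\theta(z)\qquad(y\in I),$$ with $\mathbf{Var}(\omega_0)$ the variance under $\mu_\theta$ and empty sums equal to zero (so $\omega_0<\omega^{\max}$ almost surely under $\underline{\widehat\mu}_\theta$). $\widehat{\mathbf E}$ is the expectation for the process with $\underline\omega(0)\sim\underline{\widehat\mu}_\theta$. **Notation.** $[x]=\lfloor x\rfloor$ for $x\ge0$, $[x]=\lceil x\rceil$ for $x<0$. $J^{(V)}(t)=h_{[Vt]}(t)-h_0(0)$. *)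

theory Defs
  imports "HOL-Probability.Probability"
begin

type_synonym config = "int \<Rightarrow> int"

definition config_space :: "config measure" where
  "config_space = (\<Pi>\<^sub>M i\<in>UNIV. count_space UNIV)"

definition incr :: "config \<Rightarrow> config" where
  "incr h = (\<lambda>i. h (i - 1) - h i)"

text \<open>The heights with increments \<open>\<omega>\<close> and height zero at the origin. Currents only involve
  height differences, so all processes are started with this normalisation.\<close>

definition heights :: "config \<Rightarrow> config" where
  "heights \<omega> i = (if 0 \<le> i then - (\<Sum>j\<in>{1..i}. \<omega> j) else (\<Sum>j\<in>{i+1..0}. \<omega> j))"

definition bump :: "config \<Rightarrow> int \<Rightarrow> int \<Rightarrow> config" where
  "bump h i c = h(i := h i + c)"

lemma incr_heights: "incr (heights \<omega>) = \<omega>"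
proof
  fix i
  show "incr (heights \<omega>) i = \<omega> i"
  proof (cases "1 \<le> i")
    case True
    then have "{1..i} = insert i {1..i-1}" by auto
    with True show ?thesis by (simp add: incr_def heights_def)
  next
    case False
    then have "{i..0} = insert i {i+1..0}" by auto
    with False show ?thesis by (auto simp: incr_def heights_def)
  qed
qed

lemma heights_0: "heights \<omega> 0 = 0"
  by (simp add: heights_def)

text \<open>The effect of adding (\<open>c = 1\<close>) or removing (\<open>c = -1\<close>) a brick on the increments.\<close>

definition move :: "config \<Rightarrow> int \<Rightarrow> int \<Rightarrow> config" where
  "move \<eta> i c = \<eta>(i := \<eta> i - c, i + 1 := \<eta> (i + 1) + c)"

lemma incr_bump: "incr (bump h i c) = move (incr h) i c"
  by (auto simp: incr_def bump_def move_def fun_eq_iff)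

definition state_set :: "ereal \<Rightarrow> ereal \<Rightarrow> int set" where
  "state_set wmin wmax =
     {z. wmin - 1 < ereal (of_int z) \<and> ereal (of_int z) < wmax + 1}"

text \<open>Since \<open>f\<close> and \<open>s\<^sub>p\<close>, \<open>s\<^sub>q\<close> may be multiplied by \<open>-1\<close> simultaneously, the sign of \<open>f\<close> has to
  be normalised; \<open>log f\<close> below only makes sense for the non-negative choice. Positivity of \<open>f\<close>
  above \<open>wmin\<close> and monotonicity of \<open>f\<close> then follow from the other conditions.
  The values of \<open>p\<close>, \<open>q\<close>, \<open>f\<close> off \<open>I\<close> are irrelevant.\<close>

locale deposition_rates =
  fixes wmin wmax :: ereal
    and p q :: "int \<Rightarrow> int \<Rightarrow> real"
    and f :: "int \<Rightarrow> real"
  fixes I :: "int set"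
  defines "I \<equiv> state_set wmin wmax"
  assumes wmin_integer: "wmin = -\<infinity> \<or> (\<exists>a::int. wmin = ereal (of_int a))"
    and wmax_integer: "wmax = \<infinity> \<or> (\<exists>b::int. wmax = ereal (of_int b))"
    and wmin_le: "wmin \<le> 0"
    and wmax_ge: "1 \<le> wmax"
    and rates_nonneg: "\<And>y z. y \<in> I \<Longrightarrow> z \<in> I \<Longrightarrow> 0 \<le> p y z \<and> 0 \<le> q y z"
    and p_boundary: "\<And>y z. y \<in> I \<Longrightarrow> z \<in> I \<Longrightarrow>
          ereal (of_int y) = wmin \<or> ereal (of_int z) = wmax \<Longrightarrow> p y z = 0"
    and q_boundary: "\<And>y z. y \<in> I \<Longrightarrow> z \<in> I \<Longrightarrow>
          ereal (of_int y) = wmax \<or> ereal (of_int z) = wmin \<Longrightarrow> q y z = 0"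
    and nondegenerate:
      "let p_nonzero = (\<forall>y\<in>I. \<forall>z\<in>I.
             ereal (of_int y) \<noteq> wmin \<and> ereal (of_int z) \<noteq> wmax \<longrightarrow> p y z \<noteq> 0);
           q_nonzero = (\<forall>y\<in>I. \<forall>z\<in>I.
             ereal (of_int y) \<noteq> wmax \<and> ereal (of_int z) \<noteq> wmin \<longrightarrow> q y z \<noteq> 0);
           p_zero = (\<forall>y\<in>I. \<forall>z\<in>I. p y z = 0);
           q_zero = (\<forall>y\<in>I. \<forall>z\<in>I. q y z = 0)
       in (p_nonzero \<and> q_nonzero) \<or> (p_zero \<and> q_nonzero) \<or> (q_zero \<and> p_nonzero)"
    and attractive: "\<And>y z. y \<in> I \<Longrightarrow> z \<in> I \<Longrightarrow> z + 1 \<in> I \<Longrightarrow>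
          p z y \<le> p (z + 1) y \<and> p y (z + 1) \<le> p y z \<and>
          q (z + 1) y \<le> q z y \<and> q y z \<le> q y (z + 1)"
    and cyclic: "\<And>x y z. x \<in> I \<Longrightarrow> y \<in> I \<Longrightarrow> z \<in> I \<Longrightarrow>
          p x y + p y z + p z x + q x y + q y z + q z x =
          p x z + p z y + p y x + q x z + q z y + q y x"
    and f_nonneg: "\<And>z. z \<in> I \<Longrightarrow> 0 \<le> f z"
    and f_boundary: "\<And>a. wmin = ereal (of_int a) \<Longrightarrow> f a = 0"
    and factorization: "\<exists>sp sq :: int \<Rightarrow> int \<Rightarrow> real.
          (\<forall>x y. sp x y = sp y x) \<and> (\<forall>x y. sq x y = sq y x) \<and>
          (\<forall>y\<in>I. \<forall>z\<in>I. p y z = sp y (z + 1) * f y \<and> q y z = sq (y + 1) z * f z)"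

definition ffact :: "(int \<Rightarrow> real) \<Rightarrow> int \<Rightarrow> real" where
  "ffact f z = (if 0 < z then (\<Prod>y\<in>{1..z}. f y)
                else if z = 0 then 1
                else 1 / (\<Prod>y\<in>{z+1..0}. f y))"

definition theta_upper :: "ereal \<Rightarrow> (int \<Rightarrow> real) \<Rightarrow> ereal" where
  "theta_upper wmax f = (if wmax = \<infinity> then lim (\<lambda>n. ereal (ln (f (int n)))) else \<infinity>)"

definition theta_lower :: "ereal \<Rightarrow> (int \<Rightarrow> real) \<Rightarrow> ereal" where
  "theta_lower wmin f = (if wmin = -\<infinity> then lim (\<lambda>n. ereal (ln (f (- int n)))) else -\<infinity>)"

definition partition_fun :: "int set \<Rightarrow> (int \<Rightarrow> real) \<Rightarrow> real \<Rightarrow> real" where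
  "partition_fun I f \<theta> = (\<Sum>\<^sub>\<infinity>z\<in>I. exp (\<theta> * of_int z) / ffact f z)"

definition site_mass :: "int set \<Rightarrow> (int \<Rightarrow> real) \<Rightarrow> real \<Rightarrow> int \<Rightarrow> real" where
  "site_mass I f \<theta> z =
     (if z \<in> I then 1 / partition_fun I f \<theta> * (exp (\<theta> * of_int z) / ffact f z) else 0)"

definition site_measure :: "int set \<Rightarrow> (int \<Rightarrow> real) \<Rightarrow> real \<Rightarrow> int measure" where
  "site_measure I f \<theta> = density (count_space UNIV) (\<lambda>z. ennreal (site_mass I f \<theta> z))"

definition site_var :: "int set \<Rightarrow> (int \<Rightarrow> real) \<Rightarrow> real \<Rightarrow> real" where
  "site_var I f \<theta> = prob_space.variance (site_measure I f \<theta>) real_of_int"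

definition product_measure :: "int set \<Rightarrow> (int \<Rightarrow> real) \<Rightarrow> real \<Rightarrow> config measure" where
  "product_measure I f \<theta> = (\<Pi>\<^sub>M i\<in>UNIV. site_measure I f \<theta>)"

definition centred :: "int set \<Rightarrow> (int \<Rightarrow> real) \<Rightarrow> real \<Rightarrow> int \<Rightarrow> real" where
  "centred I f \<theta> z = of_int z - (\<Sum>\<^sub>\<infinity>y\<in>I. of_int y * site_mass I f \<theta> y)"

definition origin_mass :: "int set \<Rightarrow> (int \<Rightarrow> real) \<Rightarrow> real \<Rightarrow> int \<Rightarrow> real" where
  "origin_mass I f \<theta> y =
     (if y \<in> I
      then 1 / site_var I f \<theta> * (\<Sum>\<^sub>\<infinity>z\<in>{z \<in> I. y < z}. centred I f \<theta> z * site_mass I f \<theta> z)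
      else 0)"

definition origin_measure :: "int set \<Rightarrow> (int \<Rightarrow> real) \<Rightarrow> real \<Rightarrow> int measure" where
  "origin_measure I f \<theta> = density (count_space UNIV) (\<lambda>y. ennreal (origin_mass I f \<theta> y))"

definition modified_product_measure :: "int set \<Rightarrow> (int \<Rightarrow> real) \<Rightarrow> real \<Rightarrow> config measure" where
  "modified_product_measure I f \<theta> =
     (\<Pi>\<^sub>M i\<in>UNIV. if i = 0 then origin_measure I f \<theta> else site_measure I f \<theta>)"

text \<open>For cylinder functions only finitely many summands below are non-zero.\<close>

definition cylinder :: "(config \<Rightarrow> real) set" where
  "cylinder = {\<phi>. \<exists>A. finite A \<and> (\<forall>h h'. (\<forall>i\<in>A. h i = h' i) \<longrightarrow> \<phi> h = \<phi> h')}"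

definition cylinder2 :: "(config \<times> config \<Rightarrow> real) set" where
  "cylinder2 = {\<phi>. \<exists>A. finite A \<and>
     (\<forall>g h g' h'. (\<forall>i\<in>A. g i = g' i \<and> h i = h' i) \<longrightarrow> \<phi> (g, h) = \<phi> (g', h'))}"

definition generator ::
  "(int \<Rightarrow> int \<Rightarrow> real) \<Rightarrow> (int \<Rightarrow> int \<Rightarrow> real) \<Rightarrow> (config \<Rightarrow> real) \<Rightarrow> config \<Rightarrow> real" where
  "generator p q \<phi> \<omega> =
     (\<Sum>\<^sub>\<infinity>i\<in>UNIV. p (\<omega> i) (\<omega> (i + 1)) *
        (\<phi> (move \<omega> i 1) - \<phi> \<omega>)) +
     (\<Sum>\<^sub>\<infinity>i\<in>UNIV. q (\<omega> i) (\<omega> (i + 1)) *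
        (\<phi> (move \<omega> i (-1)) - \<phi> \<omega>))"

text \<open>The process is modelled through its heights, whose increments form the particle
  configuration: the height at \<open>i\<close> changes precisely when \<open>(\<omega>\<^sub>i, \<omega>\<^sub>i\<^sub>+\<^sub>1)\<close> does.\<close>

definition height_generator ::
  "(int \<Rightarrow> int \<Rightarrow> real) \<Rightarrow> (int \<Rightarrow> int \<Rightarrow> real) \<Rightarrow> (config \<Rightarrow> real) \<Rightarrow> config \<Rightarrow> real" where
  "height_generator p q \<phi> h = (let \<omega> = incr h in
     (\<Sum>\<^sub>\<infinity>i\<in>UNIV. p (\<omega> i) (\<omega> (i + 1)) * (\<phi> (bump h i 1) - \<phi> h)) +
     (\<Sum>\<^sub>\<infinity>i\<in>UNIV. q (\<omega> i) (\<omega> (i + 1)) * (\<phi> (bump h i (-1)) - \<phi> h)))"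

lemma height_generator_incr:
  "height_generator p q (\<lambda>h. \<phi> (incr h)) h = generator p q \<phi> (incr h)"
  by (simp add: height_generator_def generator_def incr_bump Let_def)

text \<open>The basic coupling of \<open>\<eta> = incr g\<close> and \<open>\<zeta> = incr h\<close>.\<close>

definition coupling_generator ::
  "(int \<Rightarrow> int \<Rightarrow> real) \<Rightarrow> (int \<Rightarrow> int \<Rightarrow> real) \<Rightarrow>
   (config \<times> config \<Rightarrow> real) \<Rightarrow> config \<times> config \<Rightarrow> real" where
  "coupling_generator p q \<phi> = (\<lambda>(g, h). let \<eta> = incr g; \<zeta> = incr h in
     (\<Sum>\<^sub>\<infinity>i\<in>UNIV.
        (p (\<zeta> i) (\<zeta> (i + 1)) - p (\<eta> i) (\<zeta> (i + 1))) * (\<phi> (g, bump h i 1) - \<phi> (g, h)) +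
        (p (\<eta> i) (\<eta> (i + 1)) - p (\<eta> i) (\<zeta> (i + 1))) * (\<phi> (bump g i 1, h) - \<phi> (g, h)) +
        p (\<eta> i) (\<zeta> (i + 1)) * (\<phi> (bump g i 1, bump h i 1) - \<phi> (g, h))) +
     (\<Sum>\<^sub>\<infinity>i\<in>UNIV.
        (q (\<zeta> i) (\<zeta> (i + 1)) - q (\<zeta> i) (\<eta> (i + 1))) * (\<phi> (g, bump h i (-1)) - \<phi> (g, h)) +
        (q (\<eta> i) (\<eta> (i + 1)) - q (\<zeta> i) (\<eta> (i + 1))) * (\<phi> (bump g i (-1), h) - \<phi> (g, h)) +
        q (\<zeta> i) (\<eta> (i + 1)) * (\<phi> (bump g i (-1), bump h i (-1)) - \<phi> (g, h))))"

definition history :: "'s measure \<Rightarrow> 'a measure \<Rightarrow> (real \<Rightarrow> 'a \<Rightarrow> 's) \<Rightarrow> real \<Rightarrow> 'a set set" where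
  "history S F X s =
     sigma_sets (space F) {X u -` B \<inter> space F | u B. 0 \<le> u \<and> u \<le> s \<and> B \<in> sets S}"

definition path_law :: "'s measure \<Rightarrow> 'a measure \<Rightarrow> (real \<Rightarrow> 'a \<Rightarrow> 's) \<Rightarrow> (real \<Rightarrow> 's) measure" where
  "path_law S M X = distr M (\<Pi>\<^sub>M t\<in>{0..}. S) (\<lambda>w. \<lambda>t\<in>{0..}. X t w)"

text \<open>\<open>X\<close> is a Markov process on the state space \<open>E \<subseteq> space S\<close> with laws \<open>P x\<close> on the sample
  space \<open>F\<close>. Off \<open>E\<close> the kernel \<open>P\<close> is arbitrary; it is total only so that \<open>bind\<close> applies.
  The functions in \<open>D\<close> are the test functions of the formal generator \<open>L\<close>, and \<open>dynkin\<close> is the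
  identity \<open>S(t)\<phi> - \<phi> = \<integral>\<^sub>0\<^sup>t S(s) L\<phi> ds\<close> for the semigroup \<open>S(t)\<phi>(x) = E\<^sub>x \<phi>(X\<^sub>t)\<close>.\<close>

locale formal_markov_process =
  fixes S :: "'s measure" and E :: "'s set" and F :: "'a measure"
    and P :: "'s \<Rightarrow> 'a measure" and X :: "real \<Rightarrow> 'a \<Rightarrow> 's"
    and D :: "('s \<Rightarrow> real) set" and L :: "('s \<Rightarrow> real) \<Rightarrow> 's \<Rightarrow> real"
  assumes state_space: "E \<in> sets S"
    and kernel: "P \<in> measurable S (prob_algebra F)"
    and random_variable: "\<And>t. 0 \<le> t \<Longrightarrow> X t \<in> measurable F S"
    and right_continuous: "\<And>w \<phi> t. w \<in> space F \<Longrightarrow> \<phi> \<in> D \<Longrightarrow> 0 \<le> t \<Longrightarrow>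
          continuous (at_right t) (\<lambda>s. \<phi> (X s w))"
    and left_limits: "\<And>w \<phi> t. w \<in> space F \<Longrightarrow> \<phi> \<in> D \<Longrightarrow> 0 < t \<Longrightarrow>
          \<exists>l. ((\<lambda>s. \<phi> (X s w)) \<longlongrightarrow> l) (at_left t)"
    and initial: "\<And>x. x \<in> E \<Longrightarrow> AE w in P x. X 0 w = x"
    and remains: "\<And>x t. x \<in> E \<Longrightarrow> 0 \<le> t \<Longrightarrow> AE w in P x. X t w \<in> E"
    and markov: "\<And>x s t A B. x \<in> E \<Longrightarrow> 0 \<le> s \<Longrightarrow> 0 \<le> t \<Longrightarrow>
          A \<in> history S F X s \<Longrightarrow> B \<in> sets S \<Longrightarrow>
          measure (P x) {w \<in> A. X (s + t) w \<in> B} =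
          (LINT w:A|P x. measure (P (X s w)) {v \<in> space F. X t v \<in> B})"
    and generator_integrable: "\<And>x \<phi> t. x \<in> E \<Longrightarrow> \<phi> \<in> D \<Longrightarrow> bounded (range \<phi>) \<Longrightarrow> 0 \<le> t \<Longrightarrow>
          integrable (restrict_space lborel {0..t} \<Otimes>\<^sub>M P x) (\<lambda>(s, w). L \<phi> (X s w))"
    and dynkin: "\<And>x \<phi> t. x \<in> E \<Longrightarrow> \<phi> \<in> D \<Longrightarrow> bounded (range \<phi>) \<Longrightarrow> 0 \<le> t \<Longrightarrow>
          (LINT w|P x. \<phi> (X t w)) - \<phi> x = (LINT s:{0..t}|lborel. (LINT w|P x. L \<phi> (X s w)))"

definition started :: "(config \<Rightarrow> 'a measure) \<Rightarrow> config measure \<Rightarrow> 'a measure" where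
  "started P \<mu> = distr \<mu> config_space heights \<bind> P"

text \<open>\<open>T\<close> is the set of tempered configurations. The rates depend neither on the site nor on the
  absolute height; \<open>homogeneous\<close> says that the infinite-volume dynamics built from them has the
  same invariance, which the formal generator alone would not enforce if it did not determine
  the process uniquely.\<close>

locale deposition_process =
  deposition_rates wmin wmax p q f I +
  proc: formal_markov_process config_space "{h. incr h \<in> T}" F P H cylinder "height_generator p q"
  for wmin wmax p q f I
    and T :: "config set" and F :: "'a measure"
    and P :: "config \<Rightarrow> 'a measure" and H :: "real \<Rightarrow> 'a \<Rightarrow> config" +
  assumes theta_range: "theta_lower wmin f < theta_upper wmax f"
    and moments: "\<And>\<theta> k. theta_lower wmin f < ereal \<theta> \<Longrightarrow> ereal \<theta> < theta_upper wmax f \<Longrightarrow>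
          integrable (product_measure I f \<theta>) (\<lambda>\<omega>. p (\<omega> 0) (\<omega> 1) ^ k) \<and>
          integrable (product_measure I f \<theta>) (\<lambda>\<omega>. q (\<omega> 0) (\<omega> 1) ^ k)"
    and tempered_subset: "\<And>\<omega> i. \<omega> \<in> T \<Longrightarrow> \<omega> i \<in> I"
    and tempered_shift: "\<And>\<omega> k. \<omega> \<in> T \<Longrightarrow> (\<lambda>i. \<omega> (i + k)) \<in> T"
    and tempered_full: "\<And>\<theta>. theta_lower wmin f < ereal \<theta> \<Longrightarrow> ereal \<theta> < theta_upper wmax f \<Longrightarrow>
          AE \<omega> in product_measure I f \<theta>. \<omega> \<in> T"
    and homogeneous: "\<And>h k c. incr h \<in> T \<Longrightarrow>
          path_law config_space (P (\<lambda>i. h (i + k) + c)) H =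
          path_law config_space (P h) (\<lambda>t w i. H t w (i + k) + c)"
    and stationary: "\<And>\<theta> t. theta_lower wmin f < ereal \<theta> \<Longrightarrow> ereal \<theta> < theta_upper wmax f \<Longrightarrow>
          0 \<le> t \<Longrightarrow>
          distr (started P (product_measure I f \<theta>)) config_space (\<lambda>w. incr (H t w)) =
          product_measure I f \<theta>"

text \<open>\<open>G\<close> and \<open>K\<close> are the heights of the lower and of the upper copy under the coupling.
  The coupling rates preserve the order and the total discrepancy formally; in infinite volume
  this is part of the meaning of the dynamics, and \<open>single_discrepancy\<close> is exactly what makes
  the position of the second class particle well defined.\<close>

locale basic_coupling =
  deposition_process wmin wmax p q f I T F P H +
  coup: formal_markov_process "config_space \<Otimes>\<^sub>M config_space"
    "{(g, h). incr g \<in> T \<and> incr h \<in> T \<and> (\<forall>i. incr g i \<le> incr h i)}"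
    F2 P2 "\<lambda>t w. (G t w, K t w)" cylinder2 "coupling_generator p q"
  for wmin wmax p q f I T and F :: "'a measure" and P H
    and F2 :: "'b measure" and P2 :: "config \<times> config \<Rightarrow> 'b measure"
    and G K :: "real \<Rightarrow> 'b \<Rightarrow> config" +
  assumes copies: "\<And>g h. incr g \<in> T \<Longrightarrow> incr h \<in> T \<Longrightarrow> \<forall>i. incr g i \<le> incr h i \<Longrightarrow>
          path_law config_space (P2 (g, h)) G = path_law config_space (P g) H \<and>
          path_law config_space (P2 (g, h)) K = path_law config_space (P h) H"
    and single_discrepancy: "\<And>g h j. incr g \<in> T \<Longrightarrow> incr h \<in> T \<Longrightarrow>
          incr h = bump (incr g) j 1 \<Longrightarrow>
          AE w in P2 (g, h). \<forall>t\<ge>0. \<exists>i. incr (K t w) = bump (incr (G t w)) i 1"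

definition started_pair :: "(config \<times> config \<Rightarrow> 'b measure) \<Rightarrow> config measure \<Rightarrow> 'b measure" where
  "started_pair P2 \<mu> =
     distr \<mu> (config_space \<Otimes>\<^sub>M config_space) (\<lambda>\<omega>. (heights \<omega>, heights (bump \<omega> 0 1))) \<bind> P2"

definition second_class :: "(real \<Rightarrow> 'b \<Rightarrow> config) \<Rightarrow> (real \<Rightarrow> 'b \<Rightarrow> config) \<Rightarrow> real \<Rightarrow> 'b \<Rightarrow> int" where
  "second_class G K t w = (THE i. incr (K t w) = bump (incr (G t w)) i 1)"

definition towards_zero :: "real \<Rightarrow> int" where
  "towards_zero x = (if 0 \<le> x then \<lfloor>x\<rfloor> else \<lceil>x\<rceil>)"

definition current :: "(real \<Rightarrow> 'a \<Rightarrow> config) \<Rightarrow> real \<Rightarrow> real \<Rightarrow> 'a \<Rightarrow> int" where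
  "current H V t w = H t w (towards_zero (V * t)) - H 0 w 0"

end

theory Submission
  imports Defs "HOL-Real_Asymp.Real_Asymp"
begin

text \<open>With \<open>m = [V t]\<close> let \<open>J\<^sub>n = h\<^sub>m\<^sub>+\<^sub>n(t) - h\<^sub>n(0)\<close>, so that \<open>J\<^sub>0\<close> is the current in question, let
  \<open>\<sigma>\<^sup>2\<close> be the site variance and \<open>Q\<close> the position of the second class particle at time \<open>t\<close>. Three
  facts are combined.

  The two-point function is the law of the second class particle:
  \<open>Cov(\<omega>\<^sub>j(t), \<omega>\<^sub>0(0)) = \<sigma>\<^sup>2 P(Q = j)\<close> under the modified start. Conditioning on
  \<open>\<omega>\<^sub>0(0) = z\<close> writes the covariance as \<open>\<Sum>\<^sub>z g(z) \<mu>(z) b(z)\<close>, where \<open>b(z)\<close> is the conditional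
  expectation of \<open>\<omega>\<^sub>j(t)\<close>. Summation by parts (\<open>summation_by_parts\<close>) turns it into a sum of
  \<open>b(y+1) - b(y)\<close> against the tails of \<open>g \<mu>\<close>. These tails are \<open>\<sigma>\<^sup>2\<close> times the modified law at the
  origin, and by the basic coupling \<open>b(y+1) - b(y)\<close> is the probability of \<open>Q = j\<close> given
  \<open>\<omega>\<^sub>0(0) = y\<close> (\<open>discrepancy_expectation\<close>, \<open>two_point\<close>).

  By conservation, \<open>J\<^sub>0 - J\<^sub>n\<close> is the number of particles in \<open>{m+1..m+n}\<close> at time \<open>t\<close> minus the number
  in \<open>{1..n}\<close> at time \<open>0\<close>. Its variance is a sum of two-point functions, and translation invariance
  yields \<open>Var(J\<^sub>0) - Cov(J\<^sub>0, J\<^sub>n) = \<sigma>\<^sup>2 E(min(n, |Q - m|))\<close> (\<open>flux_difference_variance\<close>).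

  Finally \<open>Cov(J\<^sub>0, J\<^sub>n)\<close> tends to zero. It decreases in \<open>n\<close> by the previous identity, so it is enough
  that the averages of \<open>J\<^sub>0, ..., J\<^sub>N\<^sub>-\<^sub>1\<close> have vanishing variance. The main part of their sum is the
  number \<open>S\<close> of bricks added over a block of \<open>N\<close> sites. By Dynkin's formula the derivative of
  \<open>Var(S)\<close> is twice the covariance of \<open>S\<close> with the total drift of the block plus the mean
  activity. The drift at time \<open>s\<close> is a sum of finite-range functions of a product measure, so the
  derivative is at most \<open>Var(S) + O(N)\<close>, and Gronwall's inequality gives \<open>Var(S) = O(N)\<close>
  (\<open>displacement_variance_linear\<close>). Monotone convergence in \<open>n\<close> then yields the claim.

  Dynkin's formula is given for bounded cylinder functions and deterministic starts. It is first
  integrated over the stationary start (\<open>dynkin_stationary\<close>) and then extended to functions of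
  quadratic growth by truncation (\<open>dynkin_quadratic\<close>); the necessary second moment comes from
  another application of Gronwall's inequality, uniform in the truncation level.\<close>

section \<open>Positivity and summability of the weights\<close>

context deposition_rates begin

lemma mem_state_space_iff: "z \<in> I \<longleftrightarrow> wmin \<le> ereal (of_int z) \<and> ereal (of_int z) \<le> wmax"
proof -
  have "wmin - 1 < ereal (of_int z) \<longleftrightarrow> wmin \<le> ereal (of_int z)"
    using wmin_integer by (auto simp: one_ereal_def)
  moreover have "ereal (of_int z) < wmax + 1 \<longleftrightarrow> ereal (of_int z) \<le> wmax"
    using wmax_integer by (auto simp: one_ereal_def)
  ultimately show ?thesis by (simp add: I_def state_set_def)
qed

lemma I_convex: "x \<in> I \<Longrightarrow> z \<in> I \<Longrightarrow> x \<le> y \<Longrightarrow> y \<le> z \<Longrightarrow> y \<in> I"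
  unfolding mem_state_space_iff
  by (auto intro: order_trans[of wmin "ereal (of_int x)"] order_trans[of _ "ereal (of_int z)" wmax])

lemma zero_in_I: "0 \<in> I" and one_in_I: "1 \<in> I"
proof -
  have "wmin \<le> ereal 0" "ereal 1 \<le> wmax" using wmin_le wmax_ge by (auto simp: zero_ereal_def one_ereal_def)
  then show "0 \<in> I" "1 \<in> I" unfolding mem_state_space_iff
    using order_trans[of "ereal 0" "ereal 1" wmax] order_trans[of wmin "ereal 0" "ereal 1"] by auto
qed

lemma above_wmin: "w \<in> I \<Longrightarrow> w < z \<Longrightarrow> ereal (of_int z) \<noteq> wmin"
  and below_wmax: "w \<in> I \<Longrightarrow> z < w \<Longrightarrow> ereal (of_int z) \<noteq> wmax"
  unfolding mem_state_space_iff by auto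

text \<open>If \<open>f\<close> vanished at \<open>z\<close>, then so would \<open>p z 0\<close> and \<open>q 0 z\<close>, one of which nondegeneracy keeps
  positive: \<open>0\<close> always lies strictly below \<open>wmax\<close>.\<close>

lemma f_pos:
  assumes z: "z \<in> I" and ne: "ereal (of_int z) \<noteq> wmin"
  shows "0 < f z"
proof -
  obtain sp sq where F: "\<And>y z. y \<in> I \<Longrightarrow> z \<in> I \<Longrightarrow> p y z = sp y (z + 1) * f y \<and> q y z = sq (y + 1) z * f z"
    using factorization by blast
  have 0: "ereal (of_int 0) \<noteq> wmax" using wmax_ge by (auto simp: zero_ereal_def[symmetric])
  have "p z 0 \<noteq> 0 \<or> q 0 z \<noteq> 0"
    using nondegenerate z zero_in_I ne 0 unfolding Let_def by blast
  then have "f z \<noteq> 0" using F[OF z zero_in_I] F[OF zero_in_I z] by auto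
  with f_nonneg[OF z] show ?thesis by simp
qed

text \<open>By symmetry of the first factor, \<open>p (z+1) (z-1)\<close> and \<open>p z z\<close> share the same factor
  \<open>s\<^sub>p z (z+1)\<close>, so that attractivity of \<open>p\<close> passes to \<open>f\<close>; if \<open>p\<close> vanishes, the same
  comparison works with \<open>q\<close>.\<close>

lemma f_mono_Suc:
  assumes z: "z \<in> I" and z1: "z + 1 \<in> I"
  shows "f z \<le> f (z + 1)"
proof (cases "ereal (of_int z) = wmin")
  case True
  then have "f z = 0" using f_boundary by metis
  then show ?thesis using f_nonneg[OF z1] by simp
next
  case ne: False
  obtain sp sq where sp: "\<And>x y. sp x y = sp y x" and sq: "\<And>x y. sq x y = sq y x"
    and F: "\<And>y z. y \<in> I \<Longrightarrow> z \<in> I \<Longrightarrow> p y z = sp y (z + 1) * f y \<and> q y z = sq (y + 1) z * f z"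
    using factorization by blast
  have zm: "z - 1 \<in> I"
  proof -
    have "wmin \<le> ereal (of_int (z - 1))"
      using wmin_integer z ne unfolding mem_state_space_iff by auto
    moreover have "ereal (of_int (z - 1)) \<le> ereal (of_int z)" by simp
    ultimately show ?thesis using z unfolding mem_state_space_iff by (meson order_trans)
  qed
  have ne1: "ereal (of_int (z + 1)) \<noteq> wmin"
    by (rule above_wmin[OF z]) simp
  have nm: "ereal (of_int (z - 1)) \<noteq> wmax"
    by (rule below_wmax[OF z]) simp
  have pz: "p (z + 1) (z - 1) = sp z (z + 1) * f (z + 1)" "p z z = sp z (z + 1) * f z"
    using F[OF z1 zm] F[OF z z] sp by auto
  have qz: "q (z - 1) (z + 1) = sq z (z + 1) * f (z + 1)" "q z z = sq z (z + 1) * f z"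
    using F[OF zm z1] F[OF z z] sq by auto
  have "p z z \<le> p (z + 1) (z - 1)"
    using attractive[OF zm z z1] attractive[of z "z - 1"] z zm by fastforce
  moreover have "q z z \<le> q (z - 1) (z + 1)"
    using attractive[OF zm z z1] attractive[of z "z - 1"] z zm by fastforce
  moreover have "p (z + 1) (z - 1) \<noteq> 0 \<or> q (z - 1) (z + 1) \<noteq> 0"
    using nondegenerate zm z1 ne1 nm unfolding Let_def by blast
  moreover have "0 \<le> p (z + 1) (z - 1)" "0 \<le> q (z - 1) (z + 1)" using rates_nonneg zm z1 by auto
  moreover have "0 < f (z + 1)" using f_pos[OF z1 ne1] .
  ultimately have "(sp z (z + 1) > 0 \<and> sp z (z + 1) * f z \<le> sp z (z + 1) * f (z + 1)) \<or>
     (sq z (z + 1) > 0 \<and> sq z (z + 1) * f z \<le> sq z (z + 1) * f (z + 1))"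
    unfolding pz qz by (auto simp: zero_le_mult_iff)
  then show ?thesis by auto
qed

lemma ffact_pos: "z \<in> I \<Longrightarrow> 0 < ffact f z"
proof -
  assume z: "z \<in> I"
  have "0 < f y" if "y \<in> {1..z}" for y
  proof (rule f_pos)
    show "y \<in> I" using I_convex[OF zero_in_I z] that by auto
    show "ereal (of_int y) \<noteq> wmin" using above_wmin[OF zero_in_I] that by auto
  qed
  moreover have "0 < f y" if "y \<in> {z+1..0}" for y
  proof (rule f_pos)
    show "y \<in> I" using I_convex[OF z zero_in_I] that by auto
    show "ereal (of_int y) \<noteq> wmin" using above_wmin[OF z] that by auto
  qed
  ultimately show ?thesis by (auto simp: ffact_def intro!: prod_pos)
qed

lemma ffact_Suc:
  assumes "z \<in> I" "z + 1 \<in> I"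
  shows "ffact f (z + 1) = f (z + 1) * ffact f z"
proof (cases "0 \<le> z")
  case True
  then have "{1..z+1} = insert (z+1) {1..z}" by auto
  with True show ?thesis by (auto simp: ffact_def)
next
  case False
  then have *: "{z+1..0} = insert (z+1) {z+2..0}" by auto
  have "f (z + 1) \<noteq> 0"
    using ffact_pos[OF assms(1)] False * by (auto simp: ffact_def)
  moreover have "z + 1 = 0 \<or> z + 1 < 0" using False by auto
  ultimately show ?thesis using False * by (auto simp: ffact_def add.commute)
qed

end

lemma summable_geometric_tail:
  fixes a :: "nat \<Rightarrow> real"
  assumes "\<And>n. 0 \<le> a n" and "c < 1" and "\<And>n. n \<ge> N \<Longrightarrow> a (Suc n) \<le> c * a n"
  shows "summable a"
  using assms by (intro summable_ratio_test[where c=c and N=N]) auto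

context deposition_rates begin

text \<open>Ratio test: the quotient of successive weights is \<open>exp \<theta> / f (n + 1)\<close>, and \<open>ln f\<close> increases to a
  limit above \<open>\<theta>\<close>.\<close>

lemma summable_weights_nonneg:
  assumes th: "ereal \<theta> < theta_upper wmax f"
  shows "(\<lambda>z. exp (\<theta> * of_int z) / ffact f z) summable_on {z \<in> I. 0 \<le> z}"
proof (cases "wmax = \<infinity>")
  case False
  then obtain b where "wmax = ereal (of_int b)" using wmax_integer by auto
  then have "{z \<in> I. 0 \<le> z} \<subseteq> {0..b}" unfolding mem_state_space_iff by auto
  then show ?thesis by (intro summable_on_finite) (rule finite_subset, auto)
next
  case True
  have nI: "int n \<in> I" for n
    using zero_in_I True unfolding mem_state_space_iff
    by (auto intro: order_trans[of _ "ereal 0"])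
  have set: "{z \<in> I. 0 \<le> z} = int ` UNIV"
    using nI by (auto simp: image_iff) (metis nonneg_int_cases)
  (* The sequence starts at 1, because f 0 may be zero, where ln has a default value. *)
  define l where "l n = ereal (ln (f (int (Suc n))))" for n
  have pos: "0 < f (int (Suc n))" for n
    by (rule f_pos[OF nI above_wmin[OF zero_in_I]]) simp
  have mono: "f (int n) \<le> f (int (Suc n))" for n
    using f_mono_Suc[OF nI, of n] nI[of "Suc n"] by (simp add: add.commute)
  have inc: "incseq l"
    unfolding l_def by (intro incseq_SucI) (simp only: ereal_less_eq ln_le_cancel_iff[OF pos pos] mono)
  have "l \<longlonglongrightarrow> (SUP n. l n)" using inc by (rule LIMSEQ_SUP)
  then have "(\<lambda>n. ereal (ln (f (int n)))) \<longlonglongrightarrow> (SUP n. l n)"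
    unfolding l_def by (subst (asm) filterlim_sequentially_Suc)
  then have "theta_upper wmax f = (SUP n. l n)" using True by (simp add: theta_upper_def limI)
  with th obtain N where N: "ereal \<theta> < l N" by (auto simp: less_SUP_iff)
  define c where "c = exp \<theta> / f (int (Suc N))"
  have "exp \<theta> < f (int (Suc N))" using exp_less_mono[of \<theta> "ln (f (int (Suc N)))"] N pos[of N] by (simp add: l_def del: of_nat_Suc)
  then have c1: "c < 1" using pos[of N] by (simp add: c_def divide_less_eq del: of_nat_Suc)
  have fN: "f (int (Suc N)) \<le> f (int (Suc n))" if "n \<ge> N" for n
    using lift_Suc_mono_le[of "\<lambda>n. f (int n)", OF mono] that by blast
  have "summable (\<lambda>n. exp (\<theta> * of_int (int n)) / ffact f (int n))"
  proof (rule summable_geometric_tail[OF _ c1])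
    show "0 \<le> exp (\<theta> * of_int (int n)) / ffact f (int n)" for n using ffact_pos[OF nI] by (simp add: less_imp_le)
    fix n assume n: "n \<ge> N"
    have s: "ffact f (int (Suc n)) = f (int (Suc n)) * ffact f (int n)"
      using ffact_Suc[of "int n"] nI[of n] nI[of "Suc n"] by (simp add: add.commute)
    have "exp (\<theta> * of_int (int (Suc n))) / ffact f (int (Suc n)) =
       (exp \<theta> / f (int (Suc n))) * (exp (\<theta> * of_int (int n)) / ffact f (int n))"
      unfolding s by (simp add: exp_add algebra_simps)
    also have "\<dots> \<le> c * (exp (\<theta> * of_int (int n)) / ffact f (int n))"
      unfolding c_def using fN[OF n] pos[of N] pos[of n] ffact_pos[OF nI[of n]]
      by (intro mult_right_mono divide_left_mono) (auto simp del: of_nat_Suc)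
    finally show "exp (\<theta> * of_int (int (Suc n))) / ffact f (int (Suc n)) \<le> c * (exp (\<theta> * of_int (int n)) / ffact f (int n))" .
  qed
  then have "(\<lambda>n. exp (\<theta> * of_int (int n)) / ffact f (int n)) summable_on UNIV"
    using ffact_pos[OF nI] by (subst summable_on_UNIV_nonneg_real_iff) (auto simp: less_imp_le)
  then show ?thesis unfolding set by (subst summable_on_reindex) (auto simp: o_def)
qed

lemma summable_weights_nonpos:
  assumes th: "theta_lower wmin f < ereal \<theta>"
  shows "(\<lambda>z. exp (\<theta> * of_int z) / ffact f z) summable_on {z \<in> I. z \<le> 0}"
proof (cases "wmin = -\<infinity>")
  case False
  then obtain b where "wmin = ereal (of_int b)" using wmin_integer by auto
  then have "{z \<in> I. z \<le> 0} \<subseteq> {b..0}" unfolding mem_state_space_iff by auto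
  then show ?thesis by (intro summable_on_finite) (rule finite_subset, auto)
next
  case True
  have nI: "- int n \<in> I" for n
    using zero_in_I True unfolding mem_state_space_iff
    by (auto intro: order_trans[of _ "ereal 0"])
  have set: "{z \<in> I. z \<le> 0} = (\<lambda>n. - int n) ` UNIV"
    using nI by (auto simp: image_iff) (metis nonpos_int_cases)
  define l where "l n = ereal (ln (f (- int n)))" for n
  have pos: "0 < f (- int n)" for n using f_pos[OF nI] True by auto
  have mono: "f (- int (Suc n)) \<le> f (- int n)" for n
    using f_mono_Suc[of "- int (Suc n)"] nI[of "Suc n"] nI[of n] by simp
  have dec: "decseq l"
    unfolding l_def by (intro decseq_SucI) (simp only: ereal_less_eq ln_le_cancel_iff[OF pos pos] mono)
  have "l \<longlonglongrightarrow> (INF n. l n)" using dec by (rule LIMSEQ_INF)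
  then have "theta_lower wmin f = (INF n. l n)" using True limI unfolding theta_lower_def l_def by auto
  with th obtain N where N: "l N < ereal \<theta>" by (auto simp: INF_less_iff)
  define c where "c = f (- int N) / exp \<theta>"
  have "f (- int N) < exp \<theta>" using exp_less_mono[of "ln (f (- int N))" \<theta>] N pos[of N] by (simp add: l_def)
  then have c1: "c < 1" by (simp add: c_def divide_less_eq)
  have fN: "f (- int n) \<le> f (- int N)" if "n \<ge> N" for n
    using lift_Suc_antimono_le[of "\<lambda>n. f (- int n)", OF mono] that by blast
  have "summable (\<lambda>n. exp (\<theta> * of_int (- int n)) / ffact f (- int n))"
  proof (rule summable_geometric_tail[OF _ c1])
    show "0 \<le> exp (\<theta> * of_int (- int n)) / ffact f (- int n)" for n using ffact_pos[OF nI, of n] by (simp add: less_imp_le)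
    fix n assume n: "n \<ge> N"
    have s: "ffact f (- int n) = f (- int n) * ffact f (- int (Suc n))"
      using ffact_Suc[of "- int (Suc n)"] nI[of n] nI[of "Suc n"] by simp
    have "exp (\<theta> * of_int (- int (Suc n))) / ffact f (- int (Suc n)) =
       (f (- int n) / exp \<theta>) * (exp (\<theta> * of_int (- int n)) / ffact f (- int n))"
      unfolding s using pos[of n] by (simp add: exp_add exp_minus exp_diff algebra_simps divide_simps)
    also have "\<dots> \<le> c * (exp (\<theta> * of_int (- int n)) / ffact f (- int n))"
      unfolding c_def using fN[OF n] ffact_pos[OF nI[of n]]
      by (intro mult_right_mono divide_right_mono) auto
    finally show "exp (\<theta> * of_int (- int (Suc n))) / ffact f (- int (Suc n)) \<le> c * (exp (\<theta> * of_int (- int n)) / ffact f (- int n))" .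
  qed
  then have "(\<lambda>n. exp (\<theta> * of_int (- int n)) / ffact f (- int n)) summable_on UNIV"
    using ffact_pos[OF nI] by (subst summable_on_UNIV_nonneg_real_iff) (auto simp: less_imp_le)
  then show ?thesis unfolding set by (subst summable_on_reindex) (auto simp: o_def inj_on_def)
qed

lemma summable_weights:
  assumes "theta_lower wmin f < ereal \<theta>" "ereal \<theta> < theta_upper wmax f"
  shows "(\<lambda>z. exp (\<theta> * of_int z) / ffact f z) summable_on I"
proof -
  have "I = {z \<in> I. 0 \<le> z} \<union> {z \<in> I. z \<le> 0}" by auto
  moreover have "(\<lambda>z. exp (\<theta> * of_int z) / ffact f z) summable_on ({z \<in> I. 0 \<le> z} \<union> {z \<in> I. z \<le> 0})"
    by (rule summable_on_union[OF summable_weights_nonneg[OF assms(2)] summable_weights_nonpos[OF assms(1)]])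
  ultimately show ?thesis by simp
qed

end

locale site_marginal = deposition_rates wmin wmax p q f I
  for wmin wmax p q f I + fixes \<theta> :: real
  assumes theta_lower: "theta_lower wmin f < ereal \<theta>"
    and theta_upper: "ereal \<theta> < theta_upper wmax f"
begin

abbreviation "mass \<equiv> site_mass I f \<theta>"
abbreviation "site \<equiv> site_measure I f \<theta>"

text \<open>Polynomial moments come for free from the openness of the parameter range, since
  \<open>z\<^sup>2\<close> is dominated by \<open>exp (\<epsilon> z) + exp (- \<epsilon> z)\<close>.\<close>

lemma summable_second_moment_weights:
  "(\<lambda>z. (1 + (of_int z)\<^sup>2) * (exp (\<theta> * of_int z) / ffact f z)) summable_on I"
proof -
  obtain a where a: "theta_lower wmin f < ereal a" "ereal a < ereal \<theta>"
    using ereal_dense2[OF theta_lower] by auto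
  obtain b where b: "ereal \<theta> < ereal b" "ereal b < theta_upper wmax f"
    using ereal_dense2[OF theta_upper] by auto
  define e where "e = min (\<theta> - a) (b - \<theta>)"
  have e: "0 < e" "e \<le> \<theta> - a" "e \<le> b - \<theta>" using a b by (auto simp: e_def)
  have "theta_lower wmin f < ereal (\<theta> - e)"
    by (rule less_le_trans[OF a(1)]) (use e in auto)
  moreover have "ereal (\<theta> - e) < theta_upper wmax f"
    by (rule le_less_trans[OF _ theta_upper]) (use e in auto)
  moreover have "theta_lower wmin f < ereal (\<theta> + e)"
    by (rule less_le_trans[OF theta_lower]) (use e in auto)
  moreover have "ereal (\<theta> + e) < theta_upper wmax f"
    by (rule le_less_trans[OF _ b(2)]) (use e in auto)
  ultimately have s: "(\<lambda>z. exp ((\<theta> + e) * of_int z) / ffact f z + exp ((\<theta> - e) * of_int z) / ffact f z) summable_on I"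
    by (intro summable_on_add summable_weights)
  have key: "1 + x\<^sup>2 \<le> (1 + 2 / e\<^sup>2) * (exp (e * x) + exp (- e * x))" for x :: real
  proof -
    have "1 + \<bar>e * x\<bar> + \<bar>e * x\<bar>\<^sup>2 / 2 \<le> exp \<bar>e * x\<bar>"
      by (rule exp_lower_Taylor_quadratic) simp
    also have "exp \<bar>e * x\<bar> \<le> exp (e * x) + exp (- e * x)" by (cases "0 \<le> e * x") auto
    finally have h: "1 + (e*x)\<^sup>2 / 2 \<le> exp (e * x) + exp (- e * x)" by simp
    have "1 + x\<^sup>2 = 1 + (2/e\<^sup>2) * ((e*x)\<^sup>2 / 2)" using e by (simp add: power_mult_distrib)
    also have "\<dots> \<le> (1 + (e*x)\<^sup>2 / 2) + (2/e\<^sup>2) * (1 + (e*x)\<^sup>2 / 2)"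
      using e by (intro add_mono mult_left_mono) auto
    also have "\<dots> = (1 + 2/e\<^sup>2) * (1 + (e*x)\<^sup>2 / 2)" by (simp add: algebra_simps)
    also have "\<dots> \<le> (1 + 2/e\<^sup>2) * (exp (e * x) + exp (- e * x))"
      using h e by (intro mult_left_mono) auto
    finally show ?thesis .
  qed
  show ?thesis
  proof (rule summable_on_comparison_test[OF summable_on_cmult_right[OF s, of "1 + 2 / e\<^sup>2"]])
    fix z assume z: "z \<in> I"
    have "(1 + (of_int z)\<^sup>2) * (exp (\<theta> * of_int z) / ffact f z) \<le>
       ((1 + 2 / e\<^sup>2) * (exp (e * of_int z) + exp (- e * of_int z))) * (exp (\<theta> * of_int z) / ffact f z)"
      using ffact_pos[OF z] by (intro mult_right_mono key) (auto simp: less_imp_le)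
    also have "\<dots> = (1 + 2 / e\<^sup>2) * (exp ((\<theta> + e) * of_int z) / ffact f z + exp ((\<theta> - e) * of_int z) / ffact f z)"
    proof -
      have "exp ((\<theta> + e) * of_int z) = exp (e * of_int z) * exp (\<theta> * of_int z)"
        "exp ((\<theta> - e) * of_int z) = exp (- e * of_int z) * exp (\<theta> * of_int z)"
        by (simp_all add: exp_add[symmetric] algebra_simps)
      then show ?thesis by (simp add: distrib_right distrib_left add_divide_distrib)
    qed
    finally show "(1 + (of_int z)\<^sup>2) * (exp (\<theta> * of_int z) / ffact f z) \<le> \<dots>" .
    show "0 \<le> (1 + (of_int z)\<^sup>2) * (exp (\<theta> * of_int z) / ffact f z)" using ffact_pos[OF z] by auto
  qed
qed

lemma partition_pos: "0 < partition_fun I f \<theta>"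
proof -
  have "exp (\<theta> * of_int 0) / ffact f 0 \<le> partition_fun I f \<theta>"
    unfolding partition_fun_def
    using finite_sum_le_infsum[OF summable_weights[OF theta_lower theta_upper], of "{0}"] zero_in_I ffact_pos
    by (auto simp: less_imp_le)
  then show ?thesis using ffact_pos[OF zero_in_I] by (simp add: ffact_def)
qed

lemma mass_pos: "z \<in> I \<Longrightarrow> 0 < mass z"
  using partition_pos ffact_pos by (simp add: site_mass_def)

lemma mass_nonneg: "0 \<le> mass z"
  using mass_pos[of z] by (cases "z \<in> I") (auto simp: site_mass_def)

lemma mass_outside: "z \<notin> I \<Longrightarrow> mass z = 0"
  by (simp add: site_mass_def)

lemma mass_sums: "(\<Sum>\<^sub>\<infinity>z. mass z) = 1" "mass summable_on UNIV"
proof -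
  have s: "(\<lambda>z. 1 / partition_fun I f \<theta> * (exp (\<theta> * of_int z) / ffact f z)) summable_on I"
    by (intro summable_on_cmult_right summable_weights[OF theta_lower theta_upper])
  have "(\<Sum>\<^sub>\<infinity>z. mass z) = (\<Sum>\<^sub>\<infinity>z\<in>I. 1 / partition_fun I f \<theta> * (exp (\<theta> * of_int z) / ffact f z))"
    by (rule infsum_cong_neutral) (auto simp: site_mass_def)
  also have "\<dots> = 1"
    using partition_pos by (subst infsum_cmult_right') (simp add: partition_fun_def)
  finally show "(\<Sum>\<^sub>\<infinity>z. mass z) = 1" .
  show "mass summable_on UNIV"
    using s by (rule summable_on_cong_neutral[THEN iffD1, rotated -1]) (auto simp: site_mass_def)
qed

lemma summable_second_moment: "(\<lambda>z. (1 + (of_int z)\<^sup>2) * mass z) summable_on UNIV"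
proof -
  have s: "(\<lambda>z. 1 / partition_fun I f \<theta> * ((1 + (of_int z)\<^sup>2) * (exp (\<theta> * of_int z) / ffact f z))) summable_on I"
    by (intro summable_on_cmult_right summable_second_moment_weights)
  show ?thesis
    using s by (rule summable_on_cong_neutral[THEN iffD1, rotated -1]) (auto simp: site_mass_def)
qed

end

section \<open>Site marginals and summation by parts\<close>

lemma integrable_count_space_iff:
  fixes h :: "'a \<Rightarrow> real"
  shows "integrable (count_space A) h \<longleftrightarrow> h summable_on A"
  by (metis abs_summable_equivalent abs_summable_on_def summable_on_iff_abs_summable_on_real)

lemma integral_count_space_eq_infsum:
  fixes h :: "'a \<Rightarrow> real"
  assumes "h summable_on A"
  shows "(LINT z|count_space A. h z) = (\<Sum>\<^sub>\<infinity>z\<in>A. h z)"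
  using assms unfolding infsetsum_def[symmetric]
  by (intro infsetsum_infsum) (metis abs_summable_equivalent summable_on_iff_abs_summable_on_real)

context site_marginal begin

lemma sets_site [simp]: "sets site = UNIV" and space_site [simp]: "space site = UNIV"
  by (simp_all add: site_measure_def)

lemma measurable_site [measurable, simp]: "h \<in> measurable site N \<longleftrightarrow> range h \<subseteq> space N"
  by (auto simp: measurable_def)

lemma integrable_site_iff:
  fixes h :: "int \<Rightarrow> real"
  shows "integrable site h \<longleftrightarrow> (\<lambda>z. mass z * h z) summable_on UNIV"
proof -
  have "integrable site h \<longleftrightarrow> integrable (count_space UNIV) (\<lambda>z. mass z * h z)"
    unfolding site_measure_def by (subst integrable_density) (auto simp: mass_nonneg)
  also have "\<dots> \<longleftrightarrow> (\<lambda>z. mass z * h z) summable_on UNIV"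
    by (rule integrable_count_space_iff)
  finally show ?thesis .
qed

lemma integral_site:
  fixes h :: "int \<Rightarrow> real"
  assumes "(\<lambda>z. mass z * h z) summable_on UNIV"
  shows "(LINT z|site. h z) = (\<Sum>\<^sub>\<infinity>z. mass z * h z)"
proof -
  have "(LINT z|site. h z) = (LINT z|count_space UNIV. mass z * h z)"
    unfolding site_measure_def by (subst integral_density) (auto simp: mass_nonneg)
  also have "\<dots> = (\<Sum>\<^sub>\<infinity>z. mass z * h z)"
    using assms by (rule integral_count_space_eq_infsum)
  finally show ?thesis .
qed

lemma prob_space_site: "prob_space site"
proof
  have "emeasure site (space site) = (\<integral>\<^sup>+z. ennreal (mass z) \<partial>count_space UNIV)"
    by (simp add: site_measure_def emeasure_density)
  also have "\<dots> = ennreal (LINT z|count_space UNIV. mass z)"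
    using mass_sums(2) by (intro nn_integral_eq_integral) (auto simp: mass_nonneg integrable_count_space_iff)
  also have "(LINT z|count_space UNIV. mass z) = 1"
    using mass_sums by (simp add: integral_count_space_eq_infsum)
  finally show "emeasure site (space site) = 1" by simp
qed

sublocale site: prob_space site by (rule prob_space_site)

lemma AE_siteD: "AE z in site. Q z \<Longrightarrow> z \<in> I \<Longrightarrow> Q z"
  unfolding site_measure_def by (subst (asm) AE_density) (auto simp: AE_count_space mass_pos)

lemma integrable_site_quadratic:
  fixes h :: "int \<Rightarrow> real"
  assumes "\<And>z. \<bar>h z\<bar> \<le> c * (1 + (of_int z)\<^sup>2)"
  shows "integrable site h"
proof -
  have "integrable site (\<lambda>z. c * (1 + (of_int z)\<^sup>2))"
    unfolding integrable_site_iff using summable_on_cmult_right[OF summable_second_moment, of c]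
    by (simp add: mult_ac)
  then show ?thesis by (rule Bochner_Integration.integrable_bound) (auto intro!: AE_I2 order_trans[OF assms])
qed

lemma abs_le_one_plus_square: "\<bar>x\<bar> \<le> 1 + x\<^sup>2" for x :: real
  using zero_le_power2[of "\<bar>x\<bar> - 1/2"] by (simp add: power2_diff power2_eq_square field_simps)

abbreviation "mean \<equiv> (LINT z|site. real_of_int z)"

lemma integrable_site_id: "integrable site real_of_int"
  by (rule integrable_site_quadratic[of _ 1]) (simp add: abs_le_one_plus_square)

lemma centred_eq: "centred I f \<theta> z = of_int z - mean"
proof -
  have "mean = (\<Sum>\<^sub>\<infinity>z. mass z * of_int z)"
    using integrable_site_id by (intro integral_site) (simp add: integrable_site_iff)
  also have "\<dots> = (\<Sum>\<^sub>\<infinity>y\<in>I. of_int y * site_mass I f \<theta> y)"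
    by (rule infsum_cong_neutral) (auto simp: mass_outside)
  finally show ?thesis by (simp add: centred_def)
qed

lemma integrable_site_centred_sq: "integrable site (\<lambda>z. (of_int z - mean)\<^sup>2)"
proof (rule integrable_site_quadratic[of _ "2 + 2 * mean\<^sup>2"])
  fix z
  have "(of_int z - mean)\<^sup>2 \<le> 2 * (of_int z)\<^sup>2 + 2 * mean\<^sup>2"
    using zero_le_power2[of "of_int z + mean"] by (simp add: power2_diff power2_sum)
  also have "\<dots> \<le> (2 + 2 * mean\<^sup>2) * (1 + (of_int z)\<^sup>2)" by (simp add: algebra_simps)
  finally show "\<bar>(of_int z - mean)\<^sup>2\<bar> \<le> (2 + 2 * mean\<^sup>2) * (1 + (of_int z)\<^sup>2)" by simp
qed

lemma site_var_eq: "site_var I f \<theta> = (LINT z|site. (of_int z - mean)\<^sup>2)"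
  by (simp add: site_var_def)

abbreviation "gmass z \<equiv> (of_int z - mean) * mass z"

text \<open>The unnormalised law of the origin under the modified initial distribution.\<close>

definition tail :: "int \<Rightarrow> real" where "tail y = (\<Sum>\<^sub>\<infinity>z\<in>{y<..}. gmass z)"

lemma summable_gmass: "gmass summable_on UNIV"
  using integrable_site_iff[of "\<lambda>z. of_int z - mean"] integrable_site_id by (simp add: mult.commute)

lemma infsum_gmass: "(\<Sum>\<^sub>\<infinity>z. gmass z) = 0"
proof -
  have "(\<Sum>\<^sub>\<infinity>z. gmass z) = (LINT z|site. of_int z - mean)"
    using summable_gmass by (subst integral_site) (auto simp: mult.commute)
  also have "\<dots> = 0" using integrable_site_id by (simp add: site.prob_space[simplified])
  finally show ?thesis .
qed

lemma tail_alt: "tail y = - (\<Sum>\<^sub>\<infinity>z\<in>{..y}. gmass z)"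
proof -
  have "(\<Sum>\<^sub>\<infinity>z\<in>{..y} \<union> {y<..}. gmass z) = (\<Sum>\<^sub>\<infinity>z\<in>{..y}. gmass z) + (\<Sum>\<^sub>\<infinity>z\<in>{y<..}. gmass z)"
    by (rule infsum_Un_disjoint) (auto intro: summable_on_subset_banach[OF summable_gmass])
  moreover have "{..y} \<union> {y<..} = UNIV" by auto
  ultimately show ?thesis using infsum_gmass by (simp add: tail_def)
qed

text \<open>The summands are nonnegative beyond the mean and nonpositive before it. As their total is zero,
  whichever of the two complementary sums has summands of one sign can be used.\<close>

lemma tail_nonneg: "0 \<le> tail y"
proof (cases "mean \<le> of_int y")
  case True
  then show ?thesis unfolding tail_def by (intro infsum_nonneg mult_nonneg_nonneg) (auto simp: mass_nonneg)
next
  case False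
  then have "0 \<le> (\<Sum>\<^sub>\<infinity>z\<in>{..y}. - gmass z)"
    by (intro infsum_nonneg) (auto simp: mass_nonneg intro!: mult_nonpos_nonneg)
  then show ?thesis unfolding tail_alt by (simp add: infsum_uminus)
qed

lemma tail_outside: "y \<notin> I \<or> y + 1 \<notin> I \<Longrightarrow> tail y = 0"
proof -
  assume *: "y \<notin> I \<or> y + 1 \<notin> I"
  have "(\<forall>z>y. z \<notin> I) \<or> (\<forall>z\<le>y. z \<notin> I)"
  proof (rule ccontr)
    assume "\<not> ?thesis"
    then obtain a b where "a \<in> I" "b \<in> I" "a \<le> y" "y < b" by auto
    then have "y \<in> I" "y + 1 \<in> I" using I_convex[of a b] by auto
    with * show False by simp
  qed
  then show "tail y = 0"
  proof
    assume "\<forall>z>y. z \<notin> I"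
    then show ?thesis unfolding tail_def by (intro infsum_0) (auto simp: mass_outside)
  next
    assume "\<forall>z\<le>y. z \<notin> I"
    then show ?thesis unfolding tail_alt by (simp, intro infsum_0) (auto simp: mass_outside)
  qed
qed

lemma telescope:
  fixes b \<Delta> :: "int \<Rightarrow> real"
  assumes step: "\<And>y. y \<in> I \<Longrightarrow> y + 1 \<in> I \<Longrightarrow> b (y + 1) - b y = \<Delta> y" and z: "z \<in> I"
  shows "b z - b 0 = (\<Sum>y\<in>{0..<z}. \<Delta> y) - (\<Sum>y\<in>{z..<0}. \<Delta> y)"
proof (cases "0 \<le> z")
  case True
  from True z have "b z - b 0 = (\<Sum>y\<in>{0..<z}. \<Delta> y)"
  proof (induction z rule: int_ge_induct)
    case (step i)
    have i: "i \<in> I" using I_convex[OF zero_in_I step.prems] step.hyps by auto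
    have "{0..<i+1} = insert i {0..<i}" using step.hyps by auto
    then show ?case using step.IH[OF i] assms(1)[OF i step.prems] by simp
  qed simp
  with True show ?thesis by simp
next
  case False
  then have "z \<le> 0" by simp
  from this z have "b z - b 0 = - (\<Sum>y\<in>{z..<0}. \<Delta> y)"
  proof (induction z rule: int_le_induct)
    case (step i)
    have i: "i \<in> I" using I_convex[OF step.prems zero_in_I] step.hyps by auto
    have "{i-1..<0} = insert (i-1) {i..<0}" using step.hyps by auto
    then show ?case using step.IH[OF i] assms(1)[of "i - 1"] i step.prems by simp
  qed simp
  with False show ?thesis by simp
qed

text \<open>Abel summation on the two-sided state space. A function with bounded increments has at most
  linear growth, so the double series obtained by telescoping from the origin converges
  absolutely and may be rearranged.\<close>

lemma summation_by_parts:
  fixes b \<Delta> :: "int \<Rightarrow> real"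
  assumes step: "\<And>y. y \<in> I \<Longrightarrow> y + 1 \<in> I \<Longrightarrow> b (y + 1) - b y = \<Delta> y"
    and bound: "\<And>y. \<bar>\<Delta> y\<bar> \<le> 1"
  shows "(\<lambda>y. tail y * \<Delta> y) summable_on UNIV"
    and "(\<Sum>\<^sub>\<infinity>z. gmass z * b z) = (\<Sum>\<^sub>\<infinity>y. tail y * \<Delta> y)"
proof -
  (* The kernel of telescoping from the origin: b z - b 0 is the sum of k z y * \<Delta> y over y. *)
  define k :: "int \<Rightarrow> int \<Rightarrow> real" where "k z y = of_bool (0 \<le> y \<and> y < z) - of_bool (z \<le> y \<and> y < 0)" for z y
  have k_sum: "((\<lambda>y. k z y * d y) has_sum ((\<Sum>y\<in>{0..<z}. d y) - (\<Sum>y\<in>{z..<0}. d y))) UNIV" for z and d :: "int \<Rightarrow> real"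
  proof -
    have "((\<lambda>y. k z y * d y) has_sum (\<Sum>y\<in>{0..<z} \<union> {z..<0}. k z y * d y)) ({0..<z} \<union> {z..<0})"
      by (rule has_sum_finite) auto
    then have "((\<lambda>y. k z y * d y) has_sum (\<Sum>y\<in>{0..<z} \<union> {z..<0}. k z y * d y)) UNIV"
      by (rule has_sum_cong_neutral[THEN iffD1, rotated -1]) (auto simp: k_def)
    moreover have "(\<Sum>y\<in>{0..<z} \<union> {z..<0}. k z y * d y) = (\<Sum>y\<in>{0..<z}. k z y * d y) + (\<Sum>y\<in>{z..<0}. k z y * d y)"
      by (rule sum.union_disjoint) auto
    moreover have "(\<Sum>y\<in>{0..<z}. k z y * d y) = (\<Sum>y\<in>{0..<z}. d y)"
      by (rule sum.cong) (auto simp: k_def)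
    moreover have "(\<Sum>y\<in>{z..<0}. k z y * d y) = - (\<Sum>y\<in>{z..<0}. d y)"
      unfolding sum_negf[symmetric] by (rule sum.cong) (auto simp: k_def)
    ultimately show ?thesis by simp
  qed
  have kabs_sum: "((\<lambda>y. \<bar>k z y\<bar>) has_sum \<bar>of_int z\<bar>) UNIV" for z
  proof -
    have "\<bar>k z y\<bar> = k z y * (if 0 \<le> y then 1 else -1)" for y by (auto simp: k_def)
    then show ?thesis using k_sum[of z "\<lambda>y. if 0 \<le> y then 1 else -1"]
      by (cases "0 \<le> z") (auto simp: sum_negf)
  qed
  have "integrable site (\<lambda>z. \<bar>of_int z - mean\<bar> * \<bar>of_int z\<bar>)"
  proof (rule integrable_site_quadratic[of _ "1 + \<bar>mean\<bar>"])
    fix z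
    have "\<bar>of_int z - mean\<bar> * \<bar>of_int z\<bar> \<le> (\<bar>of_int z\<bar> + \<bar>mean\<bar>) * \<bar>of_int z\<bar>"
      by (intro mult_right_mono) auto
    also have "\<dots> = (of_int z)\<^sup>2 + \<bar>mean\<bar> * \<bar>of_int z\<bar>" by (simp add: power2_eq_square algebra_simps)
    also have "\<dots> \<le> (1 + (of_int z)\<^sup>2) + \<bar>mean\<bar> * (1 + (of_int z)\<^sup>2)"
      using abs_le_one_plus_square[of "of_int z"] by (intro add_mono mult_left_mono) auto
    finally show "\<bar>\<bar>of_int z - mean\<bar> * \<bar>of_int z\<bar>\<bar> \<le> (1 + \<bar>mean\<bar>) * (1 + (of_int z)\<^sup>2)"
      by (simp add: algebra_simps abs_mult)
  qed
  then have s1: "(\<lambda>z. \<bar>gmass z\<bar> * \<bar>of_int z\<bar>) summable_on UNIV"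
    unfolding integrable_site_iff by (simp add: abs_mult mass_nonneg mult_ac)
  have "(\<lambda>(z,y). \<bar>gmass z\<bar> * \<bar>k z y\<bar>) summable_on (UNIV \<times> UNIV)"
    by (rule summable_on_SigmaI[where g="\<lambda>z. \<bar>gmass z\<bar> * \<bar>of_int z\<bar>"])
      (auto intro: s1 has_sum_cmult_right kabs_sum)
  then have "(\<lambda>x. norm (case x of (z, y) \<Rightarrow> gmass z * (k z y * \<Delta> y))) summable_on (UNIV \<times> UNIV)"
  proof (rule summable_on_comparison_test)
    fix x :: "int \<times> int"
    obtain z y where x: "x = (z, y)" by (cases x)
    have "\<bar>gmass z\<bar> * (\<bar>k z y\<bar> * \<bar>\<Delta> y\<bar>) \<le> \<bar>gmass z\<bar> * (\<bar>k z y\<bar> * 1)"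
      using bound by (intro mult_left_mono) auto
    then show "norm (case x of (z, y) \<Rightarrow> gmass z * (k z y * \<Delta> y)) \<le> (case x of (z,y) \<Rightarrow> \<bar>gmass z\<bar> * \<bar>k z y\<bar>)"
      unfolding x by (simp add: abs_mult)
  qed simp
  then have summ: "(\<lambda>(z,y). gmass z * (k z y * \<Delta> y)) summable_on (UNIV \<times> UNIV)"
    by (subst summable_on_iff_abs_summable_on_real)
  have kg: "(\<Sum>\<^sub>\<infinity>z. gmass z * (k z y * \<Delta> y)) = tail y * \<Delta> y" for y
  proof -
    have "(\<Sum>\<^sub>\<infinity>z. gmass z * k z y) = tail y"
    proof (cases "0 \<le> y")
      case True
      then show ?thesis unfolding tail_def by (intro infsum_cong_neutral) (auto simp: k_def)
    next
      case False
      then have "(\<Sum>\<^sub>\<infinity>z. gmass z * k z y) = (\<Sum>\<^sub>\<infinity>z\<in>{..y}. - gmass z)"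
        by (intro infsum_cong_neutral) (auto simp: k_def)
      then show ?thesis unfolding tail_alt by (simp add: infsum_uminus)
    qed
    then show ?thesis by (simp add: mult.assoc[symmetric] infsum_cmult_left')
  qed
  have summ': "(\<lambda>(y,z). gmass z * (k z y * \<Delta> y)) summable_on (UNIV \<times> UNIV)"
    using summable_on_swap[THEN iffD1, OF summ] by (simp add: case_prod_unfold)
  show "(\<lambda>y. tail y * \<Delta> y) summable_on UNIV"
    using summable_on_Sigma_banach[OF summ'] by (simp add: kg)
  have b: "gmass z * b z = gmass z * b 0 + (\<Sum>\<^sub>\<infinity>y. gmass z * (k z y * \<Delta> y))" for z
  proof (cases "z \<in> I")
    case True
    have "(\<Sum>\<^sub>\<infinity>y. k z y * \<Delta> y) = b z - b 0"
      unfolding telescope[of b \<Delta>, OF step True, simplified] by (rule infsumI[OF k_sum])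
    then have "(\<Sum>\<^sub>\<infinity>y. gmass z * (k z y * \<Delta> y)) = gmass z * (b z - b 0)"
      by (simp only: infsum_cmult_right')
    then show ?thesis by (simp only: right_diff_distrib)
  qed (simp add: mass_outside)
  have "(\<Sum>\<^sub>\<infinity>z. gmass z * b z) = (\<Sum>\<^sub>\<infinity>z. gmass z * b 0 + (\<Sum>\<^sub>\<infinity>y. gmass z * (k z y * \<Delta> y)))"
    by (rule infsum_cong) (rule b)
  also have "\<dots> = (\<Sum>\<^sub>\<infinity>z. gmass z * b 0) + (\<Sum>\<^sub>\<infinity>z. \<Sum>\<^sub>\<infinity>y. gmass z * (k z y * \<Delta> y))"
    using summable_on_cmult_left[OF summable_gmass] summable_on_Sigma_banach[OF summ]
    by (intro infsum_add) auto
  also have "(\<Sum>\<^sub>\<infinity>z. gmass z * b 0) = 0" by (simp add: infsum_cmult_left' infsum_gmass)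
  also have "(\<Sum>\<^sub>\<infinity>z. \<Sum>\<^sub>\<infinity>y. gmass z * (k z y * \<Delta> y)) = (\<Sum>\<^sub>\<infinity>y. \<Sum>\<^sub>\<infinity>z. gmass z * (k z y * \<Delta> y))"
    by (rule infsum_swap_banach[OF summ])
  finally show "(\<Sum>\<^sub>\<infinity>z. gmass z * b z) = (\<Sum>\<^sub>\<infinity>y. tail y * \<Delta> y)" by (simp add: kg)
qed

text \<open>Summation by parts for the centred identity, whose increments are all one.\<close>

lemma tail_sums: "tail summable_on UNIV" "(\<Sum>\<^sub>\<infinity>y. tail y) = site_var I f \<theta>"
proof -
  show "tail summable_on UNIV" using summation_by_parts(1)[of real_of_int "\<lambda>_. 1"] by simp
  have s: "(\<lambda>z. gmass z * (of_int z - mean)) summable_on UNIV"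
    using integrable_site_centred_sq unfolding integrable_site_iff by (simp add: power2_eq_square mult_ac)
  have "(\<Sum>\<^sub>\<infinity>y. tail y) = (\<Sum>\<^sub>\<infinity>z. gmass z * (of_int z - mean))"
    using summation_by_parts(2)[of "\<lambda>z. of_int z - mean" "\<lambda>_. 1"] by simp
  also have "\<dots> = site_var I f \<theta>"
    unfolding site_var_eq using s by (subst integral_site) (auto simp: power2_eq_square mult_ac)
  finally show "(\<Sum>\<^sub>\<infinity>y. tail y) = site_var I f \<theta>" .
qed

lemma site_var_pos: "0 < site_var I f \<theta>"
proof (rule ccontr)
  assume "\<not> 0 < site_var I f \<theta>"
  then have "(LINT z|site. (of_int z - mean)\<^sup>2) = 0" unfolding site_var_eq
    by (metis antisym not_less integral_nonneg_AE AE_I2 zero_le_power2)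
  then have "AE z in site. (of_int z - mean)\<^sup>2 = 0"
    by (subst (asm) integral_nonneg_eq_0_iff_AE[OF integrable_site_centred_sq]) auto
  from AE_siteD[OF this zero_in_I] AE_siteD[OF this one_in_I] show False by simp
qed

lemma origin_mass_eq: "origin_mass I f \<theta> y = tail y / site_var I f \<theta>"
proof -
  have "(\<Sum>\<^sub>\<infinity>z\<in>{z \<in> I. y < z}. centred I f \<theta> z * mass z) = tail y"
    unfolding tail_def centred_eq by (rule infsum_cong_neutral) (auto simp: mass_outside)
  then show ?thesis using tail_outside[of y] by (auto simp: origin_mass_def)
qed

abbreviation "origin \<equiv> origin_measure I f \<theta>"

lemma sets_origin [simp]: "sets origin = UNIV" and space_origin [simp]: "space origin = UNIV"
  by (simp_all add: origin_measure_def)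

lemma integral_origin:
  fixes \<Delta> :: "int \<Rightarrow> real"
  assumes "(\<lambda>y. tail y * \<Delta> y) summable_on UNIV"
  shows "site_var I f \<theta> * (LINT y|origin. \<Delta> y) = (\<Sum>\<^sub>\<infinity>y. tail y * \<Delta> y)"
proof -
  have "(LINT y|origin. \<Delta> y) = (LINT y|count_space UNIV. tail y / site_var I f \<theta> * \<Delta> y)"
    unfolding origin_measure_def origin_mass_eq
    using tail_nonneg site_var_pos by (subst integral_density) (auto simp: less_imp_le)
  also have "\<dots> = (LINT y|count_space UNIV. tail y * \<Delta> y / site_var I f \<theta>)" by simp
  also have "\<dots> = (LINT y|count_space UNIV. tail y * \<Delta> y) / site_var I f \<theta>"
    by (rule integral_divide_zero)
  also have "(LINT y|count_space UNIV. tail y * \<Delta> y) = (\<Sum>\<^sub>\<infinity>y. tail y * \<Delta> y)"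
    using assms by (rule integral_count_space_eq_infsum)
  finally show ?thesis using site_var_pos by simp
qed

lemma prob_space_origin: "prob_space origin"
proof
  have int: "integrable (count_space UNIV) tail"
    using tail_sums(1) by (simp add: integrable_count_space_iff)
  have "emeasure origin (space origin) = (\<integral>\<^sup>+y. ennreal (tail y / site_var I f \<theta>) \<partial>count_space UNIV)"
    by (simp add: origin_measure_def emeasure_density origin_mass_eq)
  also have "\<dots> = ennreal (LINT y|count_space UNIV. tail y / site_var I f \<theta>)"
    using int tail_nonneg site_var_pos by (intro nn_integral_eq_integral) (auto simp: less_imp_le)
  also have "(LINT y|count_space UNIV. tail y / site_var I f \<theta>) = (LINT y|count_space UNIV. tail y) / site_var I f \<theta>"
    by (rule integral_divide_zero)
  also have "(LINT y|count_space UNIV. tail y) = site_var I f \<theta>"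
    using tail_sums by (simp add: integral_count_space_eq_infsum)
  finally show "emeasure origin (space origin) = 1" using site_var_pos by simp
qed

end

section \<open>Configurations and product measures\<close>

lemma space_config_space [simp]: "space config_space = UNIV"
  by (auto simp: config_space_def space_PiM)

lemma measurable_config_coordinate [measurable]: "(\<lambda>\<omega>. \<omega> i) \<in> config_space \<rightarrow>\<^sub>M count_space UNIV"
  unfolding config_space_def by (rule measurable_component_singleton) simp

lemma measurable_coordinate_compose:
  assumes "g \<in> N \<rightarrow>\<^sub>M config_space"
  shows "(\<lambda>x. g x i) \<in> N \<rightarrow>\<^sub>M count_space UNIV"
  by (rule measurable_compose[OF assms measurable_config_coordinate])

abbreviation "config_pairs \<equiv> config_space \<Otimes>\<^sub>M config_space"

lemma measurable_into_config_space:
  assumes "\<And>i. (\<lambda>x. g x i) \<in> N \<rightarrow>\<^sub>M count_space UNIV"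
  shows "g \<in> N \<rightarrow>\<^sub>M config_space"
  unfolding config_space_def by (rule measurable_PiM_single') (use assms in auto)

lemma measurable_countable_binop:
  fixes g h :: "'a \<Rightarrow> int" and k :: "int \<Rightarrow> int \<Rightarrow> 'b"
  assumes [measurable]: "g \<in> N \<rightarrow>\<^sub>M count_space UNIV" "h \<in> N \<rightarrow>\<^sub>M count_space UNIV"
    and "\<And>a b. k a b \<in> space L"
  shows "(\<lambda>x. k (g x) (h x)) \<in> N \<rightarrow>\<^sub>M L"
proof -
  have "(\<lambda>x. k a (h x)) \<in> N \<rightarrow>\<^sub>M L" for a
    using assms(3) by (intro measurable_compose[OF assms(2)]) (auto simp: measurable_def)
  from measurable_compose_countable[OF this assms(1)] show ?thesis .
qed

lemma measurable_rate:
  fixes g h :: "'a \<Rightarrow> int" and k :: "int \<Rightarrow> int \<Rightarrow> real"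
  assumes "g \<in> N \<rightarrow>\<^sub>M count_space UNIV" "h \<in> N \<rightarrow>\<^sub>M count_space UNIV"
  shows "(\<lambda>x. k (g x) (h x)) \<in> borel_measurable N"
  using assms by (rule measurable_countable_binop) simp

lemma measurable_int_sum:
  fixes g :: "'i \<Rightarrow> 'a \<Rightarrow> int"
  assumes "\<And>j. j \<in> A \<Longrightarrow> g j \<in> N \<rightarrow>\<^sub>M count_space UNIV"
  shows "(\<lambda>x. \<Sum>j\<in>A. g j x) \<in> N \<rightarrow>\<^sub>M count_space UNIV"
  using assms
proof (induction A rule: infinite_finite_induct)
  case (insert j A)
  then have "(\<lambda>x. g j x + (\<Sum>j\<in>A. g j x)) \<in> N \<rightarrow>\<^sub>M count_space UNIV"
    by (intro measurable_countable_binop[where k="(+)"]) auto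
  with insert show ?case by simp
qed auto

lemma measurable_incr [measurable]: "incr \<in> config_space \<rightarrow>\<^sub>M config_space"
  unfolding incr_def
  by (intro measurable_into_config_space measurable_countable_binop[where k="(-)"] measurable_config_coordinate) auto

lemma measurable_real_incr:
  "X \<in> N \<rightarrow>\<^sub>M config_space \<Longrightarrow> (\<lambda>w. real_of_int (incr (X w) j)) \<in> borel_measurable N"
  by (rule measurable_compose[OF measurable_coordinate_compose[OF measurable_compose[OF _ measurable_incr]]]) simp_all

lemma measurable_heights [measurable]: "heights \<in> config_space \<rightarrow>\<^sub>M config_space"
proof (rule measurable_into_config_space)
  fix i
  show "(\<lambda>\<omega>. heights \<omega> i) \<in> config_space \<rightarrow>\<^sub>M count_space UNIV"
  proof (cases "0 \<le> i")
    case True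
    have "(\<lambda>\<omega>. 0 - (\<Sum>j\<in>{1..i}. \<omega> j)) \<in> config_space \<rightarrow>\<^sub>M count_space UNIV"
      by (intro measurable_countable_binop[where k="(-)"] measurable_int_sum) auto
    with True show ?thesis by (simp add: heights_def)
  next
    case False
    then show ?thesis unfolding heights_def by (simp, intro measurable_int_sum) auto
  qed
qed

lemma measurable_shift [measurable]: "(\<lambda>h i. h (i + k) + c) \<in> config_space \<rightarrow>\<^sub>M config_space"
  by (intro measurable_into_config_space measurable_countable_binop[where k="(+)"]) auto

lemma measurable_shift0 [measurable]: "(\<lambda>h i. h (i + k)) \<in> config_space \<rightarrow>\<^sub>M config_space"
  by (intro measurable_into_config_space) auto

lemma measurable_bump [measurable]: "(\<lambda>h. bump h i c) \<in> config_space \<rightarrow>\<^sub>M config_space"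
proof (rule measurable_into_config_space)
  fix j
  have "(\<lambda>h. h i + c) \<in> config_space \<rightarrow>\<^sub>M count_space UNIV"
    by (rule measurable_countable_binop[where k="(+)"]) auto
  then show "(\<lambda>h. bump h i c j) \<in> config_space \<rightarrow>\<^sub>M count_space UNIV"
    by (cases "j = i") (auto simp: bump_def)
qed

lemma abs_mult_le_squares: "\<bar>a * b\<bar> \<le> (a\<^sup>2 + b\<^sup>2) / 2" for a b :: real
  using zero_le_power2[of "\<bar>a\<bar> - \<bar>b\<bar>"] by (simp add: power2_diff abs_mult)

lemma mult_le_squares: "a * b \<le> (a\<^sup>2 + b\<^sup>2) / 2" for a b :: real
  using abs_mult_le_squares[of a b] abs_ge_self[of "a * b"] by linarith

lemma integrable_product_of_squares:
  fixes X Y :: "'a \<Rightarrow> real"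
  assumes [measurable]: "X \<in> borel_measurable M" "Y \<in> borel_measurable M"
    and "integrable M (\<lambda>w. (X w)\<^sup>2)" "integrable M (\<lambda>w. (Y w)\<^sup>2)"
  shows "integrable M (\<lambda>w. X w * Y w)"
proof (rule Bochner_Integration.integrable_bound)
  show "integrable M (\<lambda>w. ((X w)\<^sup>2 + (Y w)\<^sup>2) / 2)" using assms by simp
  show "AE w in M. norm (X w * Y w) \<le> norm (((X w)\<^sup>2 + (Y w)\<^sup>2) / 2)"
    using abs_mult_le_squares by (intro AE_I2) (auto intro: order_trans)
qed measurable

lemma integrable_sum_square:
  fixes X :: "'i \<Rightarrow> 'a \<Rightarrow> real"
  assumes "\<And>n. n \<in> A \<Longrightarrow> X n \<in> borel_measurable M" "\<And>n. n \<in> A \<Longrightarrow> integrable M (\<lambda>w. (X n w)\<^sup>2)"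
  shows "integrable M (\<lambda>w. (\<Sum>n\<in>A. X n w)\<^sup>2)"
proof -
  have "integrable M (\<lambda>w. \<Sum>n\<in>A. \<Sum>k\<in>A. X n w * X k w)"
    using assms by (intro Bochner_Integration.integrable_sum integrable_product_of_squares)
  then show ?thesis by (simp add: power2_eq_square sum_product)
qed

lemma square_sum_le:
  fixes a :: "'i \<Rightarrow> real"
  shows "(\<Sum>k\<in>A. a k)\<^sup>2 \<le> real (card A) * (\<Sum>k\<in>A. (a k)\<^sup>2)"
  using Cauchy_Schwarz_ineq_sum[of "\<lambda>_. 1" a A] by simp

text \<open>Only neighbouring indices contribute to the double sum of covariances.\<close>

lemma nearly_orthogonal_sum:
  fixes Z :: "int \<Rightarrow> 'a \<Rightarrow> real"
  assumes "finite A" and meas: "\<And>n. Z n \<in> borel_measurable M"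
    and sq: "\<And>n. integrable M (\<lambda>w. (Z n w)\<^sup>2)" and v: "\<And>n. (LINT w|M. (Z n w)\<^sup>2) \<le> v"
    and orth: "\<And>n k. 1 < \<bar>n - k\<bar> \<Longrightarrow> (LINT w|M. Z n w * Z k w) = 0"
  shows "(LINT w|M. (\<Sum>n\<in>A. Z n w)\<^sup>2) \<le> 3 * v * card A"
proof -
  have "0 \<le> (LINT w|M. (Z 0 w)\<^sup>2)" by simp
  from order_trans[OF this v[of 0]] have v0: "0 \<le> v" .
  have int: "integrable M (\<lambda>w. Z n w * Z k w)" for n k
    by (intro integrable_product_of_squares meas sq)
  have le: "(LINT w|M. Z n w * Z k w) \<le> v * of_bool (\<bar>n - k\<bar> \<le> 1)" for n k
  proof (cases "\<bar>n - k\<bar> \<le> 1")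
    case True
    have "(LINT w|M. Z n w * Z k w) \<le> (LINT w|M. ((Z n w)\<^sup>2 + (Z k w)\<^sup>2) / 2)"
      by (rule integral_mono) (intro int mult_le_squares Bochner_Integration.integrable_add integrable_divide sq)+
    also have "\<dots> = ((LINT w|M. (Z n w)\<^sup>2) + (LINT w|M. (Z k w)\<^sup>2)) / 2" using sq by simp
    also have "\<dots> \<le> v" using v[of n] v[of k] by simp
    finally show ?thesis using True by simp
  qed (simp add: orth)
  have "(LINT w|M. (\<Sum>n\<in>A. Z n w)\<^sup>2) = (\<Sum>n\<in>A. \<Sum>k\<in>A. LINT w|M. Z n w * Z k w)"
    by (simp add: power2_eq_square sum_product int Bochner_Integration.integral_sum Bochner_Integration.integrable_sum)
  also have "\<dots> \<le> (\<Sum>n\<in>A. \<Sum>k\<in>A. v * of_bool (\<bar>n - k\<bar> \<le> 1))"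
    by (intro sum_mono le)
  also have "\<dots> = (\<Sum>n\<in>A. v * card (A \<inter> {n - 1..n + 1}))"
  proof (rule sum.cong)
    fix n
    have "(\<Sum>k\<in>A. v * of_bool (\<bar>n - k\<bar> \<le> 1)) = (\<Sum>k\<in>A \<inter> {n-1..n+1}. v)"
      using \<open>finite A\<close> by (intro sum.mono_neutral_cong_right) auto
    then show "(\<Sum>k\<in>A. v * of_bool (\<bar>n - k\<bar> \<le> 1)) = v * card (A \<inter> {n - 1..n + 1})" by simp
  qed simp
  also have "\<dots> \<le> (\<Sum>n\<in>A. v * 3)"
  proof (rule sum_mono)
    fix n :: int
    have "card (A \<inter> {n - 1..n + 1}) \<le> card {n - 1..n + 1}" by (intro card_mono) auto
    then show "v * card (A \<inter> {n - 1..n + 1}) \<le> v * 3" using v0 by (intro mult_left_mono) auto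
  qed
  finally show ?thesis by (simp add: mult_ac)
qed

context site_marginal begin

abbreviation "\<mu> \<equiv> product_measure I f \<theta>"

lemma sets_site_eq: "sets site = sets (count_space UNIV)" by simp

lemma sets_product_measure [measurable_cong, simp]: "sets \<mu> = sets config_space"
  unfolding product_measure_def config_space_def by (intro sets_PiM_cong) auto

lemma space_product_measure [simp]: "space \<mu> = UNIV"
  using sets_eq_imp_space_eq[OF sets_product_measure] by simp

sublocale \<mu>: prob_space \<mu>
  unfolding product_measure_def by (intro prob_space_PiM prob_space_site)

lemma distr_coordinate: "distr \<mu> site (\<lambda>\<omega>. \<omega> i) = site"
  unfolding product_measure_def by (rule distr_PiM_component) (auto simp: prob_space_site)

lemma measurable_coordinate_site: "(\<lambda>\<omega>. \<omega> i) \<in> \<mu> \<rightarrow>\<^sub>M site"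
  using measurable_config_coordinate by (simp add: measurable_cong_sets[OF sets_product_measure sets_site_eq])

lemma integrable_coordinate_iff:
  fixes h :: "int \<Rightarrow> real"
  shows "integrable \<mu> (\<lambda>\<omega>. h (\<omega> i)) \<longleftrightarrow> integrable site h"
  using integrable_distr_eq[OF measurable_coordinate_site, of h i] by (simp add: distr_coordinate)

lemma integral_coordinate:
  fixes h :: "int \<Rightarrow> real"
  shows "(LINT \<omega>|\<mu>. h (\<omega> i)) = (LINT z|site. h z)"
  using integral_distr[OF measurable_coordinate_site, of h i] by (simp add: distr_coordinate)

lemma indep_coordinates: "\<mu>.indep_vars (\<lambda>_. count_space UNIV) (\<lambda>i \<omega>. \<omega> i) UNIV"
proof (subst \<mu>.indep_vars_iff_distr_eq_PiM)
  have d: "distr \<mu> (count_space UNIV) (\<lambda>\<omega>. \<omega> i) = site" for i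
    using distr_coordinate[of i] by (metis distr_cong sets_site_eq)
  have "distr \<mu> (\<Pi>\<^sub>M i\<in>UNIV. count_space UNIV) (\<lambda>x. \<lambda>i\<in>UNIV. x i) = distr \<mu> \<mu> (\<lambda>x. x)"
    by (intro distr_cong) (auto simp: config_space_def[symmetric])
  also have "\<dots> = \<mu>" by (rule distr_id)
  also have "\<dots> = (\<Pi>\<^sub>M i\<in>UNIV. distr \<mu> (count_space UNIV) (\<lambda>\<omega>. \<omega> i))"
    unfolding d by (simp add: product_measure_def)
  finally show "distr \<mu> (\<Pi>\<^sub>M i\<in>UNIV. count_space UNIV) (\<lambda>x. \<lambda>i\<in>UNIV. x i) = (\<Pi>\<^sub>M i\<in>UNIV. distr \<mu> (count_space UNIV) (\<lambda>\<omega>. \<omega> i))" .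
qed (auto intro: measurable_config_coordinate)

lemma disjoint_dependence_integral:
  fixes g h :: "config \<Rightarrow> real"
  assumes [measurable]: "g \<in> borel_measurable config_space" "h \<in> borel_measurable config_space"
    and g: "\<And>\<omega> \<omega>'. (\<And>i. i \<in> A \<Longrightarrow> \<omega> i = \<omega>' i) \<Longrightarrow> g \<omega> = g \<omega>'"
    and h: "\<And>\<omega> \<omega>'. (\<And>i. i \<in> B \<Longrightarrow> \<omega> i = \<omega>' i) \<Longrightarrow> h \<omega> = h \<omega>'"
    and "A \<inter> B = {}" and int: "integrable \<mu> g" "integrable \<mu> h"
  shows "(LINT \<omega>|\<mu>. g \<omega> * h \<omega>) = (LINT \<omega>|\<mu>. g \<omega>) * (LINT \<omega>|\<mu>. h \<omega>)"
proof -
  let ?P = "\<lambda>A. \<Pi>\<^sub>M i\<in>A. count_space UNIV :: int measure"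
  (* ext A rebuilds, from the coordinates in A alone, a configuration at which an observable
     depending on A has the same value. *)
  define ext :: "int set \<Rightarrow> config \<Rightarrow> config" where "ext A x = (\<lambda>i. if i \<in> A then x i else 0)" for A x
  have ext: "ext A \<in> ?P A \<rightarrow>\<^sub>M config_space" for A
  proof (rule measurable_into_config_space)
    show "(\<lambda>x. ext A x i) \<in> ?P A \<rightarrow>\<^sub>M count_space UNIV" for i
      by (cases "i \<in> A") (auto simp: ext_def)
  qed
  have "\<mu>.indep_var (?P A) (\<lambda>\<omega>. restrict (\<lambda>i. \<omega> i) A) (?P B) (\<lambda>\<omega>. restrict (\<lambda>i. \<omega> i) B)"
    using \<open>A \<inter> B = {}\<close> by (intro \<mu>.indep_var_restrict[OF indep_coordinates]) auto
  then have "\<mu>.indep_var borel ((g \<circ> ext A) \<circ> (\<lambda>\<omega>. restrict (\<lambda>i. \<omega> i) A))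
       borel ((h \<circ> ext B) \<circ> (\<lambda>\<omega>. restrict (\<lambda>i. \<omega> i) B))"
    by (rule \<mu>.indep_var_compose) (auto intro!: measurable_comp[OF ext])
  moreover have "(g \<circ> ext A) \<circ> (\<lambda>\<omega>. restrict (\<lambda>i. \<omega> i) A) = g"
    by (auto simp: fun_eq_iff ext_def intro!: g)
  moreover have "(h \<circ> ext B) \<circ> (\<lambda>\<omega>. restrict (\<lambda>i. \<omega> i) B) = h"
    by (auto simp: fun_eq_iff ext_def intro!: h)
  ultimately show ?thesis using int by (simp add: \<mu>.indep_var_lebesgue_integral)
qed

lemma distr_shift: "distr \<mu> config_space (\<lambda>\<omega> i. \<omega> (i + k)) = \<mu>"
proof -
  have "distr \<mu> \<mu> (\<lambda>\<omega>. \<lambda>n\<in>UNIV. \<omega> (n + k)) = \<mu>"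
    using distr_PiM_reindex[of UNIV "\<lambda>_. site" "\<lambda>n. n + k" UNIV] by (simp add: prob_space_site product_measure_def)
  moreover have "distr \<mu> \<mu> (\<lambda>\<omega>. \<lambda>n\<in>UNIV. \<omega> (n + k)) = distr \<mu> config_space (\<lambda>\<omega> i. \<omega> (i + k))"
    by (intro distr_cong) auto
  ultimately show ?thesis by simp
qed

text \<open>The configuration away from the origin, which is distributed in the same way under the
  stationary and the modified initial distribution.\<close>

definition rest :: "config measure" where "rest = (\<Pi>\<^sub>M i\<in>UNIV - {0}. site)"

sublocale rest: prob_space rest
  unfolding rest_def by (intro prob_space_PiM prob_space_site)

lemma measurable_update_origin [measurable]: "(\<lambda>X. X(0 := z)) \<in> rest \<rightarrow>\<^sub>M config_space"
proof (rule measurable_into_config_space)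
  fix i :: int
  have s: "sets rest = sets (\<Pi>\<^sub>M i\<in>UNIV - {0}. count_space UNIV)"
    unfolding rest_def by (intro sets_PiM_cong) auto
  show "(\<lambda>X. (X(0 := z)) i) \<in> rest \<rightarrow>\<^sub>M count_space UNIV"
  proof (cases "i = 0")
    case False
    then have "i \<in> UNIV - {0}" by simp
    from measurable_component_singleton[OF this, of "\<lambda>_. count_space UNIV :: int measure"]
    have "(\<lambda>X. X i) \<in> rest \<rightarrow>\<^sub>M count_space UNIV"
      by (simp only: measurable_cong_sets[OF s refl])
    moreover have "(\<lambda>X :: config. (X(0 := z)) i) = (\<lambda>X. X i)" using False by auto
    ultimately show ?thesis by (simp only:)
  next
    case True
    then have "(\<lambda>X :: config. (X(0 := z)) i) = (\<lambda>X. z)" by auto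
    then show ?thesis by (simp only: measurable_const space_count_space UNIV_I)
  qed
qed

lemma measurable_update_origin_pair:
  assumes "sets N = (UNIV :: int set set)"
  shows "(\<lambda>(z, X). X(0 := z)) \<in> N \<Otimes>\<^sub>M rest \<rightarrow>\<^sub>M config_space"
proof -
  have s: "sets (N \<Otimes>\<^sub>M rest) = sets (count_space UNIV \<Otimes>\<^sub>M rest)"
    using assms by (intro sets_pair_measure_cong) auto
  have "(\<lambda>(z, X). X(0 := z)) \<in> count_space UNIV \<Otimes>\<^sub>M rest \<rightarrow>\<^sub>M config_space"
    by (rule measurable_pair_measure_countable1) auto
  then show ?thesis by (subst measurable_cong_sets[OF s refl])
qed

lemma resample_origin:
  assumes N: "prob_space N" "sets N = UNIV"
  shows "distr (N \<Otimes>\<^sub>M rest) config_space (\<lambda>(z, X). X(0 := z)) = (\<Pi>\<^sub>M i\<in>UNIV. if i = 0 then N else site)"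
proof -
  let ?M = "\<lambda>i::int. if i = 0 then N else site"
  have "distr (?M 0 \<Otimes>\<^sub>M (\<Pi>\<^sub>M i\<in>UNIV - {0}. ?M i)) (\<Pi>\<^sub>M i\<in>insert 0 (UNIV - {0}). ?M i) (\<lambda>(x, X). X(0 := x)) =
    (\<Pi>\<^sub>M i\<in>insert 0 (UNIV - {0}). ?M i)"
    by (rule distr_pair_PiM_eq_PiM) (auto simp: N prob_space_site)
  moreover have "(\<Pi>\<^sub>M i\<in>UNIV - {0}. ?M i) = rest"
    unfolding rest_def by (intro PiM_cong) auto
  moreover have "insert 0 (UNIV - {0}) = (UNIV :: int set)" by auto
  moreover have "sets (\<Pi>\<^sub>M i\<in>UNIV. ?M i) = sets config_space"
    unfolding config_space_def by (intro sets_PiM_cong) (auto simp: N)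
  ultimately show ?thesis by (metis (mono_tags, lifting) distr_cong)
qed

lemma product_measure_resample: "\<mu> = distr (site \<Otimes>\<^sub>M rest) config_space (\<lambda>(z, X). X(0 := z))"
  using resample_origin[OF prob_space_site] by (simp add: product_measure_def)

lemma modified_measure_resample:
  "modified_product_measure I f \<theta> = distr (origin \<Otimes>\<^sub>M rest) config_space (\<lambda>(z, X). X(0 := z))"
  using resample_origin[OF prob_space_origin] by (simp add: modified_product_measure_def)

end

section \<open>Kernels, time integrals and Gronwall's inequality\<close>

text \<open>Disintegration along a kernel for integrands that need not be bounded: nonnegative integrals
  disintegrate in general, and an integrable function is the difference of its two parts.\<close>

lemma
  fixes g :: "'b \<Rightarrow> real"
  assumes N: "N \<in> M \<rightarrow>\<^sub>M prob_algebra B" and g [measurable]: "g \<in> borel_measurable B"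
    and int: "integrable (M \<bind> N) g"
  shows AE_integrable_bind: "AE x in M. integrable (N x) g"
    and integrable_bind: "integrable M (\<lambda>x. LINT y|N x. g y)"
    and integral_bind: "(LINT y|(M \<bind> N). g y) = (LINT x|M. LINT y|N x. g y)"
proof -
  have N': "N \<in> M \<rightarrow>\<^sub>M subprob_algebra B" using N by (rule measurable_prob_algebraD)
  have sets_N: "sets (N x) = sets B" if "x \<in> space M" for x
    using measurable_space[OF N that] by (simp add: space_prob_algebra)
  then have gN: "h \<in> borel_measurable (N x)" if "x \<in> space M" "h \<in> borel_measurable B" for h :: "'b \<Rightarrow> real" and x
    using measurable_cong_sets[OF sets_N[OF that(1)] refl, of "borel :: real measure"] that by auto
  have meas [measurable]: "(\<lambda>x. LINT y|N x. h y) \<in> borel_measurable M" if [measurable]: "h \<in> borel_measurable B" for h :: "'b \<Rightarrow> real"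
    by (rule measurable_compose[OF N' integral_measurable_subprob_algebra[OF that]])
  have fin: "(\<integral>\<^sup>+x. \<integral>\<^sup>+y. norm (g y) \<partial>N x \<partial>M) < \<infinity>"
    using int by (simp add: integrable_iff_bounded nn_integral_bind[OF _ N'])
  have "(\<lambda>x. \<integral>\<^sup>+y. norm (g y) \<partial>N x) \<in> borel_measurable M"
    by (rule measurable_compose[OF N' nn_integral_measurable_subprob_algebra]) simp
  then have "AE x in M. (\<integral>\<^sup>+y. norm (g y) \<partial>N x) \<noteq> \<infinity>"
    using fin by (intro nn_integral_PInf_AE) auto
  then show ae: "AE x in M. integrable (N x) g"
    using AE_space by eventually_elim (auto simp: integrable_iff_bounded gN top.not_eq_extremum)
  have nonneg: "integrable M (\<lambda>x. LINT y|N x. h y) \<and> (LINT y|(M \<bind> N). h y) = (LINT x|M. LINT y|N x. h y)"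
    if [measurable]: "h \<in> borel_measurable B" and h: "\<And>y. 0 \<le> h y" "\<And>y. h y \<le> norm (g y)"
    for h :: "'b \<Rightarrow> real"
  proof -
    have aeh: "AE x in M. (\<integral>\<^sup>+y. h y \<partial>N x) = ennreal (LINT y|N x. h y)"
      using ae AE_space
    proof eventually_elim
      fix x assume "integrable (N x) g" "x \<in> space M"
      then have "integrable (N x) h"
        using h gN[OF \<open>x \<in> space M\<close> that(1)] by (intro Bochner_Integration.integrable_bound[of _ g h]) auto
      then show "(\<integral>\<^sup>+y. h y \<partial>N x) = ennreal (LINT y|N x. h y)"
        using h by (intro nn_integral_eq_integral) auto
    qed
    have eq: "(\<integral>\<^sup>+y. h y \<partial>(M \<bind> N)) = (\<integral>\<^sup>+x. ennreal (LINT y|N x. h y) \<partial>M)"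
      unfolding nn_integral_bind[OF measurable_compose[OF that(1) measurable_ennreal] N']
      by (rule nn_integral_cong_AE) (rule aeh)
    have "(\<integral>\<^sup>+y. h y \<partial>(M \<bind> N)) \<le> (\<integral>\<^sup>+y. norm (g y) \<partial>(M \<bind> N))"
      using h by (intro nn_integral_mono ennreal_leI) auto
    also have "\<dots> < \<infinity>" using int by (simp add: integrable_iff_bounded)
    finally have finh: "(\<integral>\<^sup>+x. ennreal (LINT y|N x. h y) \<partial>M) < \<infinity>" using eq by simp
    have nn: "0 \<le> (LINT y|N x. h y)" for x using h by simp
    have 1: "integrable M (\<lambda>x. LINT y|N x. h y)"
      using finh nn by (intro integrableI_nonneg) auto
    have hb: "h \<in> borel_measurable (M \<bind> N)"
    proof (cases "space M = {}")
      case True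
      then show ?thesis by (simp add: bind_empty measurable_def)
    next
      case False
      show ?thesis using sets_bind[OF sets_N False] that(1) by (simp cong: measurable_cong_sets)
    qed
    have "(LINT y|(M \<bind> N). h y) = enn2real (\<integral>\<^sup>+y. h y \<partial>(M \<bind> N))"
      by (rule integral_eq_nn_integral) (use h hb in auto)
    also have "\<dots> = (LINT x|M. LINT y|N x. h y)"
      unfolding eq by (rule integral_eq_nn_integral[symmetric]) (use nn in auto)
    finally show ?thesis using 1 by simp
  qed
  let ?p = "\<lambda>y. max 0 (g y)" and ?n = "\<lambda>y. max 0 (- g y)"
  have p: "integrable M (\<lambda>x. LINT y|N x. ?p y)" "(LINT y|(M \<bind> N). ?p y) = (LINT x|M. LINT y|N x. ?p y)"
    using nonneg[of ?p] by auto
  have n: "integrable M (\<lambda>x. LINT y|N x. ?n y)" "(LINT y|(M \<bind> N). ?n y) = (LINT x|M. LINT y|N x. ?n y)"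
    using nonneg[of ?n] by auto
  have split: "AE x in M. (LINT y|N x. g y) = (LINT y|N x. ?p y) - (LINT y|N x. ?n y)"
    using ae
  proof eventually_elim
    fix x assume i: "integrable (N x) g"
    then have ipn: "integrable (N x) ?p" "integrable (N x) ?n" by auto
    have "(LINT y|N x. g y) = (LINT y|N x. ?p y - ?n y)"
      by (rule Bochner_Integration.integral_cong) (auto simp: max_def)
    then show "(LINT y|N x. g y) = (LINT y|N x. ?p y) - (LINT y|N x. ?n y)"
      unfolding Bochner_Integration.integral_diff[OF ipn] .
  qed
  have meas_p: "(\<lambda>x. LINT y|N x. g y) \<in> borel_measurable M" by (rule meas[OF g])
  have d: "integrable M (\<lambda>x. (LINT y|N x. ?p y) - (LINT y|N x. ?n y))"
    by (rule Bochner_Integration.integrable_diff[OF p(1) n(1)])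
  show "integrable M (\<lambda>x. LINT y|N x. g y)"
    by (rule integrable_cong_AE[THEN iffD2, OF meas_p borel_measurable_integrable[OF d] split d])
  have ipn: "integrable (M \<bind> N) ?p" "integrable (M \<bind> N) ?n" using int by auto
  have "(LINT y|(M \<bind> N). g y) = (LINT y|(M \<bind> N). ?p y - ?n y)"
    by (rule Bochner_Integration.integral_cong) (auto simp: max_def)
  also have "\<dots> = (LINT y|(M \<bind> N). ?p y) - (LINT y|(M \<bind> N). ?n y)"
    by (rule Bochner_Integration.integral_diff[OF ipn])
  also have "\<dots> = (LINT x|M. (LINT y|N x. ?p y) - (LINT y|N x. ?n y))"
    unfolding p(2) n(2) using p n by simp
  also have "\<dots> = (LINT x|M. LINT y|N x. g y)"
    by (rule integral_cong_AE[symmetric, OF meas_p borel_measurable_integrable[OF d] split])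
  finally show "(LINT y|(M \<bind> N). g y) = (LINT x|M. LINT y|N x. g y)" .
qed

abbreviation "time t \<equiv> restrict_space lborel {0..t::real}"

lemma space_time [simp]: "space (time t) = {0..t}"
  by (simp add: space_restrict_space)

lemma finite_measure_time: "finite_measure (time t)"
proof
  show "emeasure (time t) (space (time t)) \<noteq> \<infinity>"
    by (cases "0 \<le> t") (simp_all add: emeasure_restrict_space)
qed

lemma measure_time: "0 \<le> t \<Longrightarrow> measure (time t) {0..t} = t"
  by (simp add: measure_restrict_space)

lemma integral_time_FTC:
  assumes "0 \<le> r" "\<And>s. (F has_real_derivative f s) (at s)" "continuous_on UNIV f"
  shows "integrable (time r) f" "(LINT s|time r. f s) = F r - F 0"
proof -
  have 1: "\<And>x. (F has_vector_derivative f x) (at x within {0..r})"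
    using assms(2) by (auto simp: has_real_derivative_iff_has_vector_derivative intro: has_vector_derivative_at_within)
  show "(LINT s|time r. f s) = F r - F 0"
    using integral_FTC_atLeastAtMost[OF assms(1) 1 continuous_on_subset[OF assms(3)]]
    by (simp add: integral_restrict_space)
  have "set_integrable lborel {0..r} f"
    by (rule borel_integrable_atLeastAtMost') (rule continuous_on_subset[OF assms(3)], simp)
  then show "integrable (time r) f"
    by (simp add: integrable_restrict_space set_integrable_def)
qed

text \<open>Gronwall's inequality with a non-optimal rate. Taking the supremum of \<open>exp (-2s) u s\<close>
  avoids iterating the integral inequality: half of the supremum is absorbed.\<close>

lemma gronwall:
  fixes u :: "real \<Rightarrow> real"
  assumes t: "0 \<le> t" and a: "0 \<le> a"
    and meas: "\<And>r. u \<in> borel_measurable (time r)"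
    and u: "\<And>s. 0 \<le> s \<Longrightarrow> s \<le> t \<Longrightarrow> 0 \<le> u s" "\<And>s. 0 \<le> s \<Longrightarrow> s \<le> t \<Longrightarrow> u s \<le> B"
    and ineq: "\<And>r. 0 \<le> r \<Longrightarrow> r \<le> t \<Longrightarrow> u r \<le> (LINT s|time r. a + u s)"
  shows "u t \<le> 2 * a * exp (2 * t)"
proof -
  define w where "w s = exp (- 2 * s) * u s" for s
  define K where "K = (SUP s\<in>{0..t}. w s)"
  have "w s \<le> B" if "s \<in> {0..t}" for s
  proof -
    have "w s \<le> 1 * u s" unfolding w_def using that u(1)[of s] by (intro mult_right_mono) auto
    then show ?thesis using u(2)[of s] that by simp
  qed
  then have bdd: "bdd_above (w ` {0..t})" by (intro bdd_aboveI[of _ B]) auto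
  have wK: "w s \<le> K" if "s \<in> {0..t}" for s
    unfolding K_def by (rule cSUP_upper[OF that bdd])
  have K0: "0 \<le> K" using wK[of 0] u(1)[of 0] t by (auto simp: w_def)
  have uK: "u s \<le> K * exp (2 * s)" if "s \<in> {0..t}" for s
  proof -
    have "u s = w s * exp (2 * s)" by (simp add: w_def exp_minus field_simps)
    also have "\<dots> \<le> K * exp (2 * s)" using wK[OF that] by (intro mult_right_mono) auto
    finally show ?thesis .
  qed
  have wr: "w r \<le> a + K / 2" if r: "r \<in> {0..t}" for r
  proof -
    interpret finite_measure "time r" by (rule finite_measure_time)
    have der: "((\<lambda>s. a * s + K * exp (2 * s) / 2) has_real_derivative (a + K * exp (2 * s))) (at s)" for s
      by (auto intro!: derivative_eq_intros)
    have cont: "continuous_on UNIV (\<lambda>s. a + K * exp (2 * s))" by (intro continuous_intros)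
    have r0: "0 \<le> r" using r by simp
    note F = integral_time_FTC[OF r0 der cont]
    have "integrable (time r) u"
      using u r by (intro integrable_const_bound[of _ B] meas AE_I2) auto
    then have "(LINT s|time r. a + u s) \<le> (LINT s|time r. a + K * exp (2 * s))"
      using F r uK by (intro integral_mono) auto
    also have "\<dots> = a * r + K * exp (2 * r) / 2 - K / 2"
      using F(2) by simp
    finally have "u r \<le> a * r + K * exp (2 * r) / 2" using ineq[of r] r K0 by auto
    then have "w r \<le> exp (- 2 * r) * (a * r + K * exp (2 * r) / 2)"
      unfolding w_def by (intro mult_left_mono) auto
    also have "\<dots> = a * (r * exp (- 2 * r)) + K / 2" by (simp add: exp_minus field_simps)
    also have "\<dots> \<le> a * 1 + K / 2"
    proof (intro add_mono mult_left_mono a order_refl)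
      have "r \<le> exp (2 * r)" using exp_ge_add_one_self[of "2 * r"] r0 by linarith
      then have "r * exp (- 2 * r) \<le> exp (2 * r) * exp (- 2 * r)" by (intro mult_right_mono) auto
      then show "r * exp (- 2 * r) \<le> 1" by (simp add: exp_minus)
    qed
    finally show ?thesis by simp
  qed
  have "K \<le> a + K / 2" unfolding K_def[of ] by (rule cSUP_least) (use t wr in \<open>auto simp: K_def\<close>)
  then have "K \<le> 2 * a" by simp
  then have "K * exp (2 * t) \<le> 2 * a * exp (2 * t)" by (intro mult_right_mono) auto
  then show ?thesis using t by (intro order_trans[OF uK]) auto
qed

text \<open>Right-continuity of the coordinates makes the process jointly measurable in time and sample
  point: it is the limit of its values at the next point of a grid of mesh \<open>1 / (n + 1)\<close>.\<close>

lemma jointly_measurable_right_continuous: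
  fixes X :: "real \<Rightarrow> 'a \<Rightarrow> config"
  assumes meas: "\<And>t. 0 \<le> t \<Longrightarrow> X t \<in> F \<rightarrow>\<^sub>M config_space"
    and rc: "\<And>w i t. w \<in> space F \<Longrightarrow> 0 \<le> t \<Longrightarrow> continuous (at_right t) (\<lambda>s. real_of_int (X s w i))"
  shows "(\<lambda>(s, w). X (max 0 s) w) \<in> borel \<Otimes>\<^sub>M F \<rightarrow>\<^sub>M config_space"
proof (rule measurable_into_config_space)
  fix i
  define d where "d n s = (of_int \<lfloor>real (Suc n) * max 0 s\<rfloor> + 1) / real (Suc n)" for n :: nat and s :: real
  have "(\<lambda>x. real_of_int (X (d n (fst x)) (snd x) i)) \<in> borel_measurable (borel \<Otimes>\<^sub>M F)" for n
  proof -
    have "(\<lambda>x. real_of_int (X (max 0 ((of_int k + 1) / real (Suc n))) (snd x) i)) \<in> borel_measurable (borel \<Otimes>\<^sub>M F)" for k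
    proof -
      have "(\<lambda>w. X (max 0 ((of_int k + 1) / real (Suc n))) w i) \<in> F \<rightarrow>\<^sub>M count_space UNIV"
        by (rule measurable_coordinate_compose[OF meas]) simp
      then have "(\<lambda>x. X (max 0 ((of_int k + 1) / real (Suc n))) (snd x) i) \<in> borel \<Otimes>\<^sub>M F \<rightarrow>\<^sub>M count_space UNIV"
        by (rule measurable_compose[OF measurable_snd])
      then show ?thesis by (rule measurable_compose) simp
    qed
    note k = this
    have fl: "(\<lambda>x :: real \<times> 'a. \<lfloor>real (Suc n) * max 0 (fst x)\<rfloor>) \<in> borel \<Otimes>\<^sub>M F \<rightarrow>\<^sub>M count_space UNIV"
      by (rule measurable_compose[OF measurable_fst], rule measurable_compose[OF _ measurable_real_floor]) simp
    have "(\<lambda>x. real_of_int (X (max 0 ((of_int \<lfloor>real (Suc n) * max 0 (fst x)\<rfloor> + 1) / real (Suc n))) (snd x) i)) \<in> borel_measurable (borel \<Otimes>\<^sub>M F)"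
      by (rule measurable_compose_countable[OF k fl])
    moreover have "max 0 ((of_int \<lfloor>real (Suc n) * max 0 (s::real)\<rfloor> + 1) / real (Suc n)) = d n s" for s
      unfolding d_def by (rule max_absorb2) (auto intro!: divide_nonneg_pos add_nonneg_nonneg)
    ultimately show ?thesis by (simp only:)
  qed
  moreover have "(\<lambda>n. real_of_int (X (d n (fst x)) (snd x) i)) \<longlonglongrightarrow> real_of_int (X (max 0 (fst x)) (snd x) i)"
    if x: "x \<in> space (borel \<Otimes>\<^sub>M F)" for x
  proof -
    let ?s = "max 0 (fst x)"
    (* The next grid point lies strictly to the right, as the one-sided limit requires. *)
    have gt: "?s < d n (fst x)" for n
    proof -
      have "real (Suc n) * ?s < of_int \<lfloor>real (Suc n) * ?s\<rfloor> + 1" by linarith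
      then show ?thesis
        unfolding d_def by (simp only: pos_less_divide_eq of_nat_0_less_iff zero_less_Suc mult.commute)
    qed
    have le: "d n (fst x) \<le> ?s + inverse (real (Suc n))" for n
    proof -
      have "of_int \<lfloor>real (Suc n) * ?s\<rfloor> + 1 \<le> real (Suc n) * ?s + 1" by linarith
      then have "d n (fst x) \<le> (real (Suc n) * ?s + 1) / real (Suc n)"
        unfolding d_def by (intro divide_right_mono) auto
      also have "\<dots> = ?s + inverse (real (Suc n))" by (simp add: add_divide_distrib inverse_eq_divide)
      finally show ?thesis .
    qed
    have "(\<lambda>n. d n (fst x)) \<longlonglongrightarrow> ?s"
    proof (rule tendsto_sandwich[OF _ _ tendsto_const])
      show "(\<lambda>n. ?s + inverse (real (Suc n))) \<longlonglongrightarrow> ?s"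
        using tendsto_add[OF tendsto_const LIMSEQ_inverse_real_of_nat, of ?s] by simp
    qed (use gt le in \<open>auto intro!: always_eventually less_imp_le\<close>)
    then have "filterlim (\<lambda>n. d n (fst x)) (at_right ?s) sequentially"
    proof (subst filterlim_at, intro conjI always_eventually allI)
      show "d n (fst x) \<in> {?s<..}" for n using gt[of n] by (simp only: greaterThan_iff)
      show "d n (fst x) \<noteq> ?s" for n using gt[of n] by (metis less_irrefl)
    qed
    moreover have "((\<lambda>s. real_of_int (X s (snd x) i)) \<longlongrightarrow> real_of_int (X ?s (snd x) i)) (at_right ?s)"
      using rc[of "snd x" ?s i] x by (auto simp: continuous_within space_pair_measure)
    ultimately show ?thesis by (rule filterlim_compose[rotated])
  qed
  ultimately have "(\<lambda>x. real_of_int (X (max 0 (fst x)) (snd x) i)) \<in> borel_measurable (borel \<Otimes>\<^sub>M F)"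
    by (rule borel_measurable_LIMSEQ_real[rotated])
  from measurable_compose[OF this measurable_real_floor]
  show "(\<lambda>x. (case x of (s, w) \<Rightarrow> X (max 0 s) w) i) \<in> borel \<Otimes>\<^sub>M F \<rightarrow>\<^sub>M count_space UNIV"
    by (simp only: case_prod_unfold floor_of_int)
qed

section \<open>The stationary process and its rates\<close>

locale stationary_process =
  deposition_process wmin wmax p q f I T F P H + site_marginal wmin wmax p q f I \<theta>
  for wmin wmax p q f I and T and F :: "'a measure" and P H \<theta>
begin

abbreviation "M \<equiv> started P \<mu>"

lemma measurable_started_kernel: "(\<lambda>\<omega>. P (heights \<omega>)) \<in> \<mu> \<rightarrow>\<^sub>M prob_algebra F"
proof -
  have "heights \<in> \<mu> \<rightarrow>\<^sub>M config_space"
    using measurable_heights by (subst measurable_cong_sets[OF sets_product_measure refl])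
  then show ?thesis by (rule measurable_compose[OF _ proc.kernel])
qed

lemma M_eq: "M = \<mu> \<bind> (\<lambda>\<omega>. P (heights \<omega>))"
proof -
  have "heights \<in> \<mu> \<rightarrow>\<^sub>M config_space"
    using measurable_heights by (subst measurable_cong_sets[OF sets_product_measure refl])
  then show ?thesis
    unfolding started_def by (rule bind_distr[OF _ measurable_prob_algebraD[OF proc.kernel]]) simp
qed

lemma
  shows sets_P: "sets (P h) = sets F" and prob_space_P: "prob_space (P h)"
  using measurable_space[OF proc.kernel, of h] by (simp_all add: space_prob_algebra)

lemma sets_M: "sets M = sets F"
  unfolding M_eq by (rule sets_bind) (auto simp: sets_P)

sublocale M: prob_space M
  unfolding M_eq by (rule \<mu>.prob_space_bind[OF _ measurable_prob_algebraD[OF measurable_started_kernel]])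
    (simp add: prob_space_P)

lemma tempered_sets: "T \<in> sets config_space"
proof -
  have "heights -` {h. incr h \<in> T} \<inter> space config_space \<in> sets config_space"
    by (rule measurable_sets[OF measurable_heights proc.state_space])
  then show ?thesis by (simp add: vimage_def incr_heights)
qed

lemma AE_tempered: "AE \<omega> in \<mu>. \<omega> \<in> T"
  by (rule tempered_full[OF theta_lower theta_upper])

lemma measurable_F_eq:
  assumes "sets N = sets F" shows "measurable N L = measurable F L"
  by (rule measurable_cong_sets[OF assms refl])

lemma measurable_H: "sets N = sets F \<Longrightarrow> 0 \<le> t \<Longrightarrow> H t \<in> N \<rightarrow>\<^sub>M config_space"
  by (subst measurable_F_eq) (auto intro: proc.random_variable)

lemma measurable_incr_H: "sets N = sets F \<Longrightarrow> 0 \<le> t \<Longrightarrow> (\<lambda>w. incr (H t w)) \<in> N \<rightarrow>\<^sub>M config_space"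
  by (rule measurable_compose[OF measurable_H measurable_incr])

lemma distr_incr_H: "0 \<le> t \<Longrightarrow> distr M config_space (\<lambda>w. incr (H t w)) = \<mu>"
  by (rule stationary[OF theta_lower theta_upper])

lemma integral_stationary:
  fixes g :: "config \<Rightarrow> real"
  assumes "0 \<le> t" "g \<in> borel_measurable config_space"
  shows "(LINT w|M. g (incr (H t w))) = (LINT \<omega>|\<mu>. g \<omega>)"
  using integral_distr[OF measurable_incr_H[OF sets_M assms(1)] assms(2)] distr_incr_H[OF assms(1)] by simp

lemma integrable_stationary:
  fixes g :: "config \<Rightarrow> real"
  assumes "0 \<le> t" "g \<in> borel_measurable config_space"
  shows "integrable M (\<lambda>w. g (incr (H t w))) \<longleftrightarrow> integrable \<mu> g"
  using integrable_distr_eq[OF measurable_incr_H[OF sets_M assms(1)] assms(2)] distr_incr_H[OF assms(1)] by simp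

lemma AE_incr_tempered:
  assumes "0 \<le> t" shows "AE w in M. incr (H t w) \<in> T"
proof -
  have "AE \<omega> in distr M config_space (\<lambda>w. incr (H t w)). \<omega> \<in> T"
    unfolding distr_incr_H[OF assms] by (rule AE_tempered)
  then show ?thesis by (rule AE_distrD[OF measurable_incr_H[OF sets_M assms]])
qed

lemma integral_shift:
  fixes g :: "config \<Rightarrow> real"
  assumes "g \<in> borel_measurable config_space"
  shows "(LINT \<omega>|\<mu>. g (\<lambda>i. \<omega> (i + k))) = (LINT \<omega>|\<mu>. g \<omega>)"
    and "integrable \<mu> (\<lambda>\<omega>. g (\<lambda>i. \<omega> (i + k))) \<longleftrightarrow> integrable \<mu> g"
proof -
  have m: "(\<lambda>\<omega> i. \<omega> (i + k)) \<in> \<mu> \<rightarrow>\<^sub>M config_space"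
    using measurable_shift0 by (subst measurable_cong_sets[OF sets_product_measure refl])
  show "(LINT \<omega>|\<mu>. g (\<lambda>i. \<omega> (i + k))) = (LINT \<omega>|\<mu>. g \<omega>)"
    using integral_distr[OF m assms] by (simp add: distr_shift)
  show "integrable \<mu> (\<lambda>\<omega>. g (\<lambda>i. \<omega> (i + k))) \<longleftrightarrow> integrable \<mu> g"
    using integrable_distr_eq[OF m assms] by (simp add: distr_shift)
qed

abbreviation "occ s i w \<equiv> real_of_int (incr (H s w) i)"

definition up :: "int \<Rightarrow> config \<Rightarrow> real" where "up n \<omega> = p (\<omega> n) (\<omega> (n + 1))"
definition down :: "int \<Rightarrow> config \<Rightarrow> real" where "down n \<omega> = q (\<omega> n) (\<omega> (n + 1))"

lemma measurable_up [measurable]: "up n \<in> borel_measurable config_space"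
  and measurable_down [measurable]: "down n \<in> borel_measurable config_space"
  unfolding up_def down_def by (intro measurable_rate measurable_config_coordinate)+

lemma borel_\<mu>: "borel_measurable \<mu> = borel_measurable config_space"
  by (rule measurable_cong_sets[OF sets_product_measure refl])

lemma rates_nonneg_tempered: "\<omega> \<in> T \<Longrightarrow> 0 \<le> up n \<omega>" "\<omega> \<in> T \<Longrightarrow> 0 \<le> down n \<omega>"
  unfolding up_def down_def using rates_nonneg tempered_subset by auto

lemma up_shift: "up n \<omega> = up 0 (\<lambda>i. \<omega> (i + n))" and down_shift: "down n \<omega> = down 0 (\<lambda>i. \<omega> (i + n))"
  by (simp_all add: up_def down_def add.commute)

lemma integrable_rate_squares: "integrable \<mu> (\<lambda>\<omega>. (up n \<omega>)\<^sup>2)" "integrable \<mu> (\<lambda>\<omega>. (down n \<omega>)\<^sup>2)"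
proof -
  have "integrable \<mu> (\<lambda>\<omega>. (up 0 \<omega>)\<^sup>2)" "integrable \<mu> (\<lambda>\<omega>. (down 0 \<omega>)\<^sup>2)"
    using moments[OF theta_lower theta_upper, of 2] by (simp_all add: up_def down_def)
  then show "integrable \<mu> (\<lambda>\<omega>. (up n \<omega>)\<^sup>2)" "integrable \<mu> (\<lambda>\<omega>. (down n \<omega>)\<^sup>2)"
    unfolding up_shift[of n] down_shift[of n]
    by (subst integral_shift(2)[of "\<lambda>\<omega>. (up 0 \<omega>)\<^sup>2"] integral_shift(2)[of "\<lambda>\<omega>. (down 0 \<omega>)\<^sup>2"], measurable)+
qed

text \<open>The total jump rate over \<open>A\<close>. In the generator of the squared number of bricks over \<open>A\<close> it is the
  contribution of the second order.\<close>

definition activity :: "int set \<Rightarrow> config \<Rightarrow> real" where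
  "activity A \<omega> = (\<Sum>n\<in>A. up n \<omega> + down n \<omega>)"

text \<open>The generator applied to the sum of the heights over \<open>A\<close>.\<close>

definition drift :: "int set \<Rightarrow> config \<Rightarrow> real" where
  "drift A \<omega> = (\<Sum>n\<in>A. up n \<omega> - down n \<omega>)"

lemma measurable_activity [measurable]: "activity A \<in> borel_measurable config_space"
  and measurable_drift [measurable]: "drift A \<in> borel_measurable config_space"
  unfolding activity_def drift_def by measurable

lemma
  shows integrable_activity_sq: "integrable \<mu> (\<lambda>\<omega>. (activity A \<omega>)\<^sup>2)"
    and integrable_drift_sq: "integrable \<mu> (\<lambda>\<omega>. (drift A \<omega>)\<^sup>2)"
proof -
  have ud: "integrable \<mu> (\<lambda>\<omega>. up n \<omega> * down n \<omega>)" for n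
    by (rule integrable_product_of_squares[OF _ _ integrable_rate_squares]) (simp_all only: borel_\<mu> measurable_up measurable_down)
  have "integrable \<mu> (\<lambda>\<omega>. (up n \<omega>)\<^sup>2 + (down n \<omega>)\<^sup>2 + 2 * (up n \<omega> * down n \<omega>))" for n
    by (intro Bochner_Integration.integrable_add integrable_mult_right integrable_rate_squares ud)
  then have 1: "integrable \<mu> (\<lambda>\<omega>. (up n \<omega> + down n \<omega>)\<^sup>2)" for n by (simp add: power2_sum mult.assoc)
  have "integrable \<mu> (\<lambda>\<omega>. (up n \<omega>)\<^sup>2 + (down n \<omega>)\<^sup>2 - 2 * (up n \<omega> * down n \<omega>))" for n
    by (intro Bochner_Integration.integrable_add Bochner_Integration.integrable_diff integrable_mult_right integrable_rate_squares ud)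
  then have 2: "integrable \<mu> (\<lambda>\<omega>. (up n \<omega> - down n \<omega>)\<^sup>2)" for n by (simp add: power2_diff mult.assoc)
  show "integrable \<mu> (\<lambda>\<omega>. (activity A \<omega>)\<^sup>2)"
    unfolding activity_def by (rule integrable_sum_square[OF _ 1]) (unfold borel_\<mu>, measurable)
  show "integrable \<mu> (\<lambda>\<omega>. (drift A \<omega>)\<^sup>2)"
    unfolding drift_def by (rule integrable_sum_square[OF _ 2]) (unfold borel_\<mu>, measurable)
qed

lemma integrable_of_square:
  fixes g :: "'b \<Rightarrow> real"
  assumes "prob_space N" "g \<in> borel_measurable N" "integrable N (\<lambda>x. (g x)\<^sup>2)"
  shows "integrable N g"
proof -
  interpret N: prob_space N by fact
  show ?thesis using integrable_product_of_squares[of g N "\<lambda>_. 1"] assms by simp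
qed

lemma integrable_activity: "integrable \<mu> (activity A)"
  by (rule integrable_of_square[OF \<mu>.prob_space_axioms _ integrable_activity_sq]) (simp only: borel_\<mu> measurable_activity)

lemma integrable_drift: "integrable \<mu> (drift A)"
  by (rule integrable_of_square[OF \<mu>.prob_space_axioms _ integrable_drift_sq]) (simp only: borel_\<mu> measurable_drift)

lemma activity_nonneg: "\<omega> \<in> T \<Longrightarrow> 0 \<le> activity A \<omega>"
  unfolding activity_def by (intro sum_nonneg add_nonneg_nonneg rates_nonneg_tempered)

text \<open>The drift at one bond depends on two neighbouring sites only, so that under the product measure
  the drifts at bonds with distance greater than one are independent.\<close>

lemma drift_variance_linear:
  obtains v :: real where "0 \<le> v" "\<And>A. finite A \<Longrightarrow>
    (LINT \<omega>|\<mu>. (drift A \<omega> - (LINT \<omega>|\<mu>. drift A \<omega>))\<^sup>2) \<le> v * real (card A)"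
proof -
  define \<rho> where "\<rho> = (LINT \<omega>|\<mu>. drift {0} \<omega>)"
  define Z where "Z n \<omega> = drift {n} \<omega> - \<rho>" for n :: int and \<omega>
  have Z_shift: "Z n \<omega> = Z 0 (\<lambda>i. \<omega> (i + n))" for n \<omega>
    by (simp add: Z_def drift_def up_shift[of n] down_shift[of n])
  have Zm [measurable]: "Z n \<in> borel_measurable config_space" for n unfolding Z_def by measurable
  have Zi: "integrable \<mu> (Z n)" for n unfolding Z_def by (intro Bochner_Integration.integrable_diff integrable_drift) simp
  have Zsq: "integrable \<mu> (\<lambda>\<omega>. (Z n \<omega>)\<^sup>2)" for n
  proof -
    have "integrable \<mu> (\<lambda>\<omega>. (drift {n} \<omega>)\<^sup>2 + \<rho>\<^sup>2 - 2 * \<rho> * drift {n} \<omega>)"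
      by (intro Bochner_Integration.integrable_add Bochner_Integration.integrable_diff integrable_mult_right integrable_drift integrable_drift_sq) simp
    then show ?thesis by (simp add: Z_def power2_diff mult_ac)
  qed
  have Z0: "(LINT \<omega>|\<mu>. Z n \<omega>) = 0" for n
  proof -
    have "(LINT \<omega>|\<mu>. Z 0 \<omega>) = 0"
      unfolding Z_def using integrable_drift by (simp add: \<rho>_def \<mu>.prob_space[simplified])
    then show ?thesis unfolding Z_shift[of n] by (subst integral_shift(1)[of "Z 0", OF Zm])
  qed
  define v where "v = (LINT \<omega>|\<mu>. (Z 0 \<omega>)\<^sup>2)"
  have "0 \<le> v" unfolding v_def by simp
  have var: "(LINT \<omega>|\<mu>. (Z n \<omega>)\<^sup>2) = v" for n
    unfolding Z_shift[of n] v_def by (rule integral_shift(1)[of "\<lambda>\<omega>. (Z 0 \<omega>)\<^sup>2"]) measurable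
  have orth: "(LINT \<omega>|\<mu>. Z n \<omega> * Z k \<omega>) = 0" if "1 < \<bar>n - k\<bar>" for n k
  proof -
    have "(LINT \<omega>|\<mu>. Z n \<omega> * Z k \<omega>) = (LINT \<omega>|\<mu>. Z n \<omega>) * (LINT \<omega>|\<mu>. Z k \<omega>)"
    proof (rule disjoint_dependence_integral[where A="{n, n + 1}" and B="{k, k + 1}"])
      show "{n, n + 1} \<inter> {k, k + 1} = {}" using that by auto
      show "integrable \<mu> (Z n)" "integrable \<mu> (Z k)" by (rule Zi)+
      show "Z n \<in> borel_measurable config_space" "Z k \<in> borel_measurable config_space" by (rule Zm)+
    qed (auto simp: Z_def drift_def up_def down_def)
    then show ?thesis by (simp add: Z0)
  qed
  have "(LINT \<omega>|\<mu>. (drift A \<omega> - (LINT \<omega>|\<mu>. drift A \<omega>))\<^sup>2) \<le> (3 * v) * real (card A)" if "finite A" for A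
  proof -
    have sum: "drift A \<omega> = (\<Sum>n\<in>A. Z n \<omega>) + \<rho> * card A" for \<omega>
      by (simp add: Z_def drift_def sum_subtractf mult.commute)
    have "(LINT \<omega>|\<mu>. drift A \<omega>) = \<rho> * card A"
      unfolding sum using Zi by (simp add: Bochner_Integration.integral_sum Z0 \<mu>.prob_space[simplified])
    then have "(LINT \<omega>|\<mu>. (drift A \<omega> - (LINT \<omega>|\<mu>. drift A \<omega>))\<^sup>2) = (LINT \<omega>|\<mu>. (\<Sum>n\<in>A. Z n \<omega>)\<^sup>2)"
      by (simp add: sum)
    also have "\<dots> \<le> 3 * v * card A"
      using that Zsq var orth by (intro nearly_orthogonal_sum) (auto simp: borel_\<mu> Zm)
    finally show ?thesis .
  qed
  then show thesis using that[of "3 * v"] \<open>0 \<le> v\<close> by simp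
qed

lemma activity_moments_linear:
  obtains c :: real where "0 \<le> c" "\<And>A. finite A \<Longrightarrow> (LINT \<omega>|\<mu>. activity A \<omega>) \<le> c * real (card A)"
proof -
  have ae: "AE \<omega> in \<mu>. 0 \<le> activity A \<omega>" for A
    using AE_tempered by eventually_elim (rule activity_nonneg)
  have "(LINT \<omega>|\<mu>. activity A \<omega>) = (LINT \<omega>|\<mu>. activity {0} \<omega>) * card A" for A
  proof -
    have sum: "activity A \<omega> = (\<Sum>n\<in>A. activity {n} \<omega>)" for \<omega> by (simp add: activity_def)
    have "(LINT \<omega>|\<mu>. activity {n} \<omega>) = (LINT \<omega>|\<mu>. activity {0} \<omega>)" for n
    proof -
      have "activity {n} \<omega> = activity {0} (\<lambda>i. \<omega> (i + n))" for \<omega>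
        by (simp add: activity_def up_shift[of n] down_shift[of n])
      then show ?thesis by (simp add: integral_shift(1)[of "activity {0}", OF measurable_activity])
    qed
    then have "(\<Sum>n\<in>A. LINT \<omega>|\<mu>. activity {n} \<omega>) = (\<Sum>n\<in>A. LINT \<omega>|\<mu>. activity {0} \<omega>)"
      by (intro sum.cong refl)
    then show ?thesis unfolding sum using integrable_activity
      by (simp only: Bochner_Integration.integral_sum) (simp add: mult.commute)
  qed
  moreover have "0 \<le> (LINT \<omega>|\<mu>. activity {0} \<omega>)" using ae by (rule integral_nonneg_AE)
  ultimately show thesis using that by (metis order_refl)
qed

end

section \<open>Dynkin's formula for the number of bricks\<close>

lemma heights_incr: "h i = heights (incr h) i + h 0"
proof -
  have up: "h (int n) = heights (incr h) (int n) + h 0" for n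
  proof (induction n)
    case (Suc n)
    have "incr (heights (incr h)) (int (Suc n)) = incr h (int (Suc n))" by (simp add: incr_heights)
    with Suc show ?case by (simp add: incr_def)
  qed (simp add: heights_0)
  have dn: "h (- int n) = heights (incr h) (- int n) + h 0" for n
  proof (induction n)
    case (Suc n)
    have "incr (heights (incr h)) (- int n) = incr h (- int n)" by (simp add: incr_heights)
    moreover have "- int n - 1 = - int (Suc n)" by simp
    ultimately show ?case using Suc by (simp add: incr_def)
  qed (simp add: heights_0)
  show ?thesis using up[of "nat i"] dn[of "nat (- i)"] by (cases "0 \<le> i") auto
qed

text \<open>The net number of bricks over \<open>A\<close> by which \<open>h\<close> exceeds \<open>h0\<close>. The reference profile is an
  argument: a test function can refer to a fixed profile, but not to the random initial one.\<close>

definition disp :: "int set \<Rightarrow> config \<Rightarrow> config \<Rightarrow> int" where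
  "disp A h h0 = (\<Sum>n\<in>A. h n - h0 n)"

lemma disp_self [simp]: "disp A h h = 0"
  by (simp add: disp_def)

lemma disp_bump:
  assumes "finite A"
  shows "disp A (bump h i c) x = disp A h x + (if i \<in> A then c else 0)"
proof -
  have "disp A (bump h i c) x = (\<Sum>n\<in>A. (h n - x n) + (if n = i then c else 0))"
    unfolding disp_def bump_def by (rule sum.cong) auto
  then show ?thesis using assms by (simp add: sum.distrib disp_def)
qed

lemma measurable_disp: "(\<lambda>x. disp A (fst x) (snd x)) \<in> config_pairs \<rightarrow>\<^sub>M count_space UNIV"
  unfolding disp_def
  by (intro measurable_int_sum measurable_countable_binop[where k="(-)"] measurable_coordinate_compose measurable_fst measurable_snd) auto

lemma measurable_disp_fun:
  fixes \<psi> :: "int \<Rightarrow> real"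
  shows "(\<lambda>x. \<psi> (disp A (fst x) (snd x))) \<in> borel_measurable config_pairs"
  by (rule measurable_compose[OF measurable_disp]) simp

text \<open>Truncation is 1-Lipschitz, so that the increments of truncated squares stay at most linear.\<close>

definition clip :: "int \<Rightarrow> int \<Rightarrow> int" where "clip m k = max (- m) (min m k)"

lemma clip_bound: "0 \<le> m \<Longrightarrow> \<bar>clip m k\<bar> \<le> m"
  and clip_le: "0 \<le> m \<Longrightarrow> \<bar>clip m k\<bar> \<le> \<bar>k\<bar>"
  and clip_id: "\<bar>k\<bar> \<le> m \<Longrightarrow> clip m k = k"
  and clip_step: "\<bar>clip m (k + 1) - clip m k\<bar> \<le> 1" "\<bar>clip m (k - 1) - clip m k\<bar> \<le> 1"
  by (auto simp: clip_def)

lemma square_step: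
  fixes a b :: int
  assumes "\<bar>a - b\<bar> \<le> 1"
  shows "\<bar>(real_of_int a)\<^sup>2 - (real_of_int b)\<^sup>2\<bar> \<le> 2 * \<bar>real_of_int b\<bar> + 1"
proof -
  consider "a = b" | "a = b + 1" | "a = b - 1" using assms by linarith
  then show ?thesis by cases (auto simp: power2_sum power2_diff)
qed

context stationary_process begin

text \<open>The height generator applied to the function \<open>\<psi> (disp A _ h0)\<close>.\<close>

definition dyn :: "(int \<Rightarrow> real) \<Rightarrow> int set \<Rightarrow> config \<Rightarrow> config \<Rightarrow> real" where
  "dyn \<psi> A h h0 = (let k = disp A h h0 in
     \<Sum>n\<in>A. up n (incr h) * (\<psi> (k + 1) - \<psi> k) + down n (incr h) * (\<psi> (k - 1) - \<psi> k))"

lemma height_generator_disp: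
  assumes "finite A"
  shows "height_generator p q (\<lambda>h. \<psi> (disp A h x)) h = dyn \<psi> A h x"
proof -
  have *: "(\<Sum>\<^sub>\<infinity>i. r i * (\<psi> (disp A (bump h i c) x) - \<psi> (disp A h x))) = (\<Sum>i\<in>A. r i * (\<psi> (disp A h x + c) - \<psi> (disp A h x)))"
    for r :: "int \<Rightarrow> real" and c
  proof -
    have "(\<Sum>\<^sub>\<infinity>i. r i * (\<psi> (disp A (bump h i c) x) - \<psi> (disp A h x))) = (\<Sum>\<^sub>\<infinity>i\<in>A. r i * (\<psi> (disp A h x + c) - \<psi> (disp A h x)))"
      by (rule infsum_cong_neutral) (auto simp: disp_bump[OF assms])
    then show ?thesis using assms by simp
  qed
  show ?thesis
    unfolding height_generator_def Let_def * dyn_def up_def down_def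
    by (simp add: sum.distrib)
qed

lemma measurable_dyn: "(\<lambda>x. dyn \<psi> A (fst x) (snd x)) \<in> borel_measurable config_pairs"
proof -
  have 2: "(\<lambda>x. g (incr (fst x))) \<in> borel_measurable config_pairs"
    if "g \<in> borel_measurable config_space" for g :: "config \<Rightarrow> real"
    by (rule measurable_compose[OF measurable_compose[OF measurable_fst measurable_incr] that])
  show ?thesis
    unfolding dyn_def Let_def
    by (intro borel_measurable_sum borel_measurable_add borel_measurable_times 2[OF measurable_up] 2[OF measurable_down] borel_measurable_diff
        measurable_disp_fun[of \<psi>] measurable_disp_fun[of "\<lambda>k. \<psi> (k + 1)"] measurable_disp_fun[of "\<lambda>k. \<psi> (k - 1)"])
qed

lemma dyn_abs_le:
  assumes "incr h \<in> T"
    and "\<bar>\<psi> (disp A h x + 1) - \<psi> (disp A h x)\<bar> \<le> c" "\<bar>\<psi> (disp A h x - 1) - \<psi> (disp A h x)\<bar> \<le> c"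
  shows "\<bar>dyn \<psi> A h x\<bar> \<le> activity A (incr h) * c"
proof -
  have "\<bar>dyn \<psi> A h x\<bar> \<le> (\<Sum>n\<in>A. \<bar>up n (incr h) * (\<psi> (disp A h x + 1) - \<psi> (disp A h x)) + down n (incr h) * (\<psi> (disp A h x - 1) - \<psi> (disp A h x))\<bar>)"
    unfolding dyn_def Let_def by (rule sum_abs)
  also have "\<dots> \<le> (\<Sum>n\<in>A. (up n (incr h) + down n (incr h)) * c)"
  proof (rule sum_mono)
    fix n
    have "\<bar>up n (incr h) * (\<psi> (disp A h x + 1) - \<psi> (disp A h x))\<bar> \<le> up n (incr h) * c"
      "\<bar>down n (incr h) * (\<psi> (disp A h x - 1) - \<psi> (disp A h x))\<bar> \<le> down n (incr h) * c"
      using rates_nonneg_tempered[OF assms(1), of n] assms(2,3) by (auto simp: abs_mult intro!: mult_left_mono)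
    then show "\<bar>up n (incr h) * (\<psi> (disp A h x + 1) - \<psi> (disp A h x)) + down n (incr h) * (\<psi> (disp A h x - 1) - \<psi> (disp A h x))\<bar>
        \<le> (up n (incr h) + down n (incr h)) * c"
      unfolding distrib_right by linarith
  qed
  finally show ?thesis by (simp add: activity_def sum_distrib_right)
qed

lemma measurable_H_time: "(\<lambda>(s, w). H (max 0 s) w) \<in> borel \<Otimes>\<^sub>M F \<rightarrow>\<^sub>M config_space"
proof (rule jointly_measurable_right_continuous[OF proc.random_variable])
  fix w i and t :: real assume "w \<in> space F" "0 \<le> t"
  moreover have "(\<lambda>h. real_of_int (h i)) \<in> cylinder"
    by (auto simp: cylinder_def intro!: exI[of _ "{i}"])
  ultimately show "continuous (at_right t) (\<lambda>s. real_of_int (H s w i))"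
    using proc.right_continuous[of w "\<lambda>h. real_of_int (h i)" t] by simp
qed

lemma joint_measurable:
  fixes g :: "config \<times> config \<Rightarrow> real"
  assumes N: "sets N = sets F" and g: "g \<in> borel_measurable config_pairs"
  shows "(\<lambda>(s, w). g (H s w, H 0 w)) \<in> borel_measurable (time t \<Otimes>\<^sub>M N)"
proof -
  have i: "(\<lambda>s. s) \<in> time t \<rightarrow>\<^sub>M borel" by (rule measurable_restrict_space1) simp
  have snd: "snd \<in> time t \<Otimes>\<^sub>M N \<rightarrow>\<^sub>M F"
    using measurable_snd[of "time t" N] measurable_cong_sets[OF refl N, of "time t \<Otimes>\<^sub>M N"] by blast
  have pair: "(\<lambda>x. (fst x, snd x)) \<in> time t \<Otimes>\<^sub>M N \<rightarrow>\<^sub>M borel \<Otimes>\<^sub>M F"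
    by (rule measurable_Pair[OF measurable_compose[OF measurable_fst i] snd])
  have "(\<lambda>x. (H (max 0 (fst x)) (snd x), H 0 (snd x))) \<in> time t \<Otimes>\<^sub>M N \<rightarrow>\<^sub>M config_pairs"
    using measurable_compose[OF pair measurable_H_time] measurable_compose[OF snd proc.random_variable[of 0]]
    by (intro measurable_Pair) (simp_all only: split_conv order_refl)
  from measurable_compose[OF this g]
  show ?thesis
    by (rule measurable_cong[THEN iffD1, rotated]) (auto simp: space_pair_measure max_def)
qed

lemma pair_sigma_finite_time: "prob_space N \<Longrightarrow> pair_sigma_finite (time t) N"
  by (intro pair_sigma_finite.intro finite_measure.axioms(1) finite_measure_time prob_space.axioms(1))
    (simp_all add: prob_space_def finite_measure_def)

lemma integrable_time_stationary:
  fixes g :: "config \<times> config \<Rightarrow> real"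
  assumes g: "g \<in> borel_measurable config_pairs"
    and int: "\<And>s. 0 \<le> s \<Longrightarrow> s \<le> t \<Longrightarrow> integrable M (\<lambda>w. g (H s w, H 0 w))"
    and bound: "\<And>s. 0 \<le> s \<Longrightarrow> s \<le> t \<Longrightarrow> (LINT w|M. \<bar>g (H s w, H 0 w)\<bar>) \<le> C"
  shows "integrable (time t \<Otimes>\<^sub>M M) (\<lambda>(s, w). g (H s w, H 0 w))"
proof -
  interpret time: finite_measure "time t" by (rule finite_measure_time)
  interpret pair_sigma_finite "time t" M by (rule pair_sigma_finite_time) (rule M.prob_space_axioms)
  note m = joint_measurable[OF sets_M g, of t]
  have m': "(\<lambda>(s, w). \<bar>g (H s w, H 0 w)\<bar>) \<in> borel_measurable (time t \<Otimes>\<^sub>M M)"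
    using joint_measurable[OF sets_M borel_measurable_abs[OF g], of t] by simp
  show ?thesis
  proof (rule Fubini_integrable[OF m])
    show "integrable (time t) (\<lambda>s. LINT w|M. norm (case (s, w) of (s, w) \<Rightarrow> g (H s w, H 0 w)))"
    proof (rule time.integrable_const_bound[of _ C])
      show "(\<lambda>s. LINT w|M. norm (case (s, w) of (s, w) \<Rightarrow> g (H s w, H 0 w))) \<in> borel_measurable (time t)"
        using M.borel_measurable_lebesgue_integral[OF m'] by simp
      show "AE s in time t. norm (LINT w|M. norm (case (s, w) of (s, w) \<Rightarrow> g (H s w, H 0 w))) \<le> C"
        using bound by (intro AE_I2) simp
    qed
    show "AE s in time t. integrable M (\<lambda>w. case (s, w) of (s, w) \<Rightarrow> g (H s w, H 0 w))"
      using int by (intro AE_I2) simp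
  qed
qed

lemma measurable_time_integral:
  fixes g :: "config \<times> config \<Rightarrow> real"
  assumes N: "sets N = sets F" and g: "g \<in> borel_measurable config_pairs"
  shows "(\<lambda>w. LINT s|time t. g (H s w, H 0 w)) \<in> borel_measurable N"
proof -
  interpret time: finite_measure "time t" by (rule finite_measure_time)
  have "(\<lambda>(w, s). g (H s w, H 0 w)) \<in> borel_measurable (N \<Otimes>\<^sub>M time t)"
    using measurable_compose[OF measurable_pair_swap' joint_measurable[OF N g, of t]] by (simp add: case_prod_unfold)
  then show ?thesis by (rule time.borel_measurable_lebesgue_integral)
qed

lemma measurable_H2: "sets N = sets F \<Longrightarrow> 0 \<le> t \<Longrightarrow> (\<lambda>w. (H t w, H 0 w)) \<in> N \<rightarrow>\<^sub>M config_pairs"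
  by (intro measurable_Pair measurable_H) auto

text \<open>From the start \<open>x\<close> the displacement relative to \<open>x\<close> is a cylinder function. As the process starts
  almost surely in \<open>x\<close>, the reference profile \<open>x\<close> may be replaced by \<open>H 0\<close>; in this form the
  identity can be averaged over \<open>x\<close>.\<close>

lemma dynkin_pointwise:
  assumes x: "incr x \<in> T" and A: "finite A" and B: "\<And>k. \<bar>\<psi> k\<bar> \<le> B" and t: "0 \<le> t"
  shows "(LINT w|P x. \<psi> (disp A (H t w) (H 0 w)) - \<psi> 0 - (LINT s|time t. dyn \<psi> A (H s w) (H 0 w))) = 0"
proof -
  interpret Px: prob_space "P x" by (rule prob_space_P)
  interpret pair_sigma_finite "time t" "P x" by (rule pair_sigma_finite_time) (rule Px.prob_space_axioms)
  define \<phi> where "\<phi> h = \<psi> (disp A h x)" for h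
  have xE: "x \<in> {h. incr h \<in> T}" using x by simp
  have cyl: "\<phi> \<in> cylinder"
    using A by (auto simp: cylinder_def \<phi>_def disp_def intro!: exI[of _ A] arg_cong[of _ _ \<psi>])
  have bdd: "bounded (range \<phi>)"
    using B by (auto simp: bounded_iff \<phi>_def intro!: exI[of _ B])
  have gen: "height_generator p q \<phi> h = dyn \<psi> A h x" for h
    unfolding \<phi>_def by (rule height_generator_disp[OF A])
  have int: "integrable (time t \<Otimes>\<^sub>M P x) (case_prod (\<lambda>s w. dyn \<psi> A (H s w) x))"
    using proc.generator_integrable[OF xE cyl bdd t] by (simp only: gen)
  have dk: "(LINT w|P x. \<phi> (H t w)) - \<phi> x = (LINT s|time t. LINT w|P x. dyn \<psi> A (H s w) x)"
    using proc.dynkin[OF xE cyl bdd t] by (simp add: gen set_lebesgue_integral_def integral_restrict_space)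
  have fub: "(LINT w|P x. LINT s|time t. dyn \<psi> A (H s w) x) = (LINT s|time t. LINT w|P x. dyn \<psi> A (H s w) x)"
    by (rule Fubini_integral[OF int])
  have i1: "integrable (P x) (\<lambda>w. \<phi> (H t w))"
  proof (rule Px.integrable_const_bound[of _ B])
    have "(\<lambda>h. disp A h x) \<in> config_space \<rightarrow>\<^sub>M count_space UNIV"
      unfolding disp_def by (intro measurable_int_sum measurable_countable_binop[where k="(-)"]) auto
    then have "\<phi> \<in> borel_measurable config_space" unfolding \<phi>_def by (rule measurable_compose) simp
    then show "(\<lambda>w. \<phi> (H t w)) \<in> borel_measurable (P x)"
      by (rule measurable_compose[OF measurable_H[OF sets_P t]])
  qed (use B in \<open>auto simp: \<phi>_def\<close>)
  have i2: "integrable (P x) (\<lambda>w. LINT s|time t. dyn \<psi> A (H s w) x)"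
    by (rule integrable_snd[OF int])
  have i12: "integrable (P x) (\<lambda>w. \<phi> (H t w) - \<psi> 0 - (LINT s|time t. dyn \<psi> A (H s w) x))"
    by (intro Bochner_Integration.integrable_diff i1 i2) simp
  have "(LINT w|P x. \<psi> (disp A (H t w) (H 0 w)) - \<psi> 0 - (LINT s|time t. dyn \<psi> A (H s w) (H 0 w))) =
     (LINT w|P x. \<phi> (H t w) - \<psi> 0 - (LINT s|time t. dyn \<psi> A (H s w) x))"
  proof (rule integral_cong_AE)
    from measurable_compose[OF measurable_H2[OF sets_P t] measurable_disp_fun[of \<psi> A], of x]
      measurable_time_integral[OF sets_P[of x] measurable_dyn[of \<psi> A], of t]
    show "(\<lambda>w. \<psi> (disp A (H t w) (H 0 w)) - \<psi> 0 - (LINT s|time t. dyn \<psi> A (H s w) (H 0 w))) \<in> borel_measurable (P x)"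
      by (intro borel_measurable_diff borel_measurable_const) (simp_all only: fst_conv snd_conv)
    show "AE w in P x. \<psi> (disp A (H t w) (H 0 w)) - \<psi> 0 - (LINT s|time t. dyn \<psi> A (H s w) (H 0 w)) =
        \<phi> (H t w) - \<psi> 0 - (LINT s|time t. dyn \<psi> A (H s w) x)"
      using proc.initial[OF xE] by eventually_elim (simp only: \<phi>_def)
  qed (rule borel_measurable_integrable[OF i12])
  also have "\<dots> = (LINT w|P x. \<phi> (H t w)) - \<psi> 0 - (LINT w|P x. LINT s|time t. dyn \<psi> A (H s w) x)"
    using i1 i2 by (simp add: Px.prob_space[simplified])
  also have "\<dots> = 0" using dk fub by (simp add: \<phi>_def)
  finally show ?thesis .
qed

text \<open>Average of the pointwise identity. The integrand is at most the activity times a constant, whose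
  expectation does not depend on the time, and this justifies the exchange of integrals.\<close>

lemma dynkin_stationary:
  assumes A: "finite A" and B: "\<And>k. \<bar>\<psi> k\<bar> \<le> B" and t: "0 \<le> t"
  shows "integrable (time t \<Otimes>\<^sub>M M) (\<lambda>(s, w). dyn \<psi> A (H s w) (H 0 w))"
    and "(LINT w|M. \<psi> (disp A (H t w) (H 0 w))) - \<psi> 0 = (LINT s|time t. LINT w|M. dyn \<psi> A (H s w) (H 0 w))"
proof -
  interpret pair_sigma_finite "time t" M by (rule pair_sigma_finite_time) (rule M.prob_space_axioms)
  have dyn_m: "(\<lambda>w. dyn \<psi> A (H s w) (H 0 w)) \<in> borel_measurable M" if "0 \<le> s" for s
    using measurable_compose[OF measurable_H2[OF sets_M that] measurable_dyn[of \<psi> A]] by (simp only: fst_conv snd_conv)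
  have act_i: "integrable M (\<lambda>w. activity A (incr (H s w)) * (2 * B))" if "0 \<le> s" for s
    using integrable_stationary[OF that measurable_activity] integrable_activity by (intro integrable_mult_left) simp
  have dyn_le: "AE w in M. \<bar>dyn \<psi> A (H s w) (H 0 w)\<bar> \<le> activity A (incr (H s w)) * (2 * B)" if "0 \<le> s" for s
    using AE_incr_tempered[OF that]
  proof eventually_elim
    fix w assume "incr (H s w) \<in> T"
    then show "\<bar>dyn \<psi> A (H s w) (H 0 w)\<bar> \<le> activity A (incr (H s w)) * (2 * B)"
    proof (rule dyn_abs_le)
      fix k show "\<bar>\<psi> (k + 1) - \<psi> k\<bar> \<le> 2 * B" "\<bar>\<psi> (k - 1) - \<psi> k\<bar> \<le> 2 * B"
        using B[of k] B[of "k+1"] B[of "k-1"] by linarith+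
    qed
  qed
  have dyn_i: "integrable M (\<lambda>w. dyn \<psi> A (H s w) (H 0 w))" if "0 \<le> s" for s
    by (rule Bochner_Integration.integrable_bound[OF act_i[OF that] dyn_m[OF that]])
      (rule eventually_mono[OF dyn_le[OF that]], unfold real_norm_def, erule order_trans, rule abs_ge_self)
  show int: "integrable (time t \<Otimes>\<^sub>M M) (\<lambda>(s, w). dyn \<psi> A (H s w) (H 0 w))"
  proof (rule integrable_time_stationary[OF measurable_dyn[of \<psi> A], of t "(LINT \<omega>|\<mu>. activity A \<omega>) * (2 * B)", unfolded fst_conv snd_conv])
    fix s assume s: "0 \<le> s" "s \<le> t"
    show "integrable M (\<lambda>w. dyn \<psi> A (H s w) (H 0 w))" by (rule dyn_i[OF s(1)])
    have "(LINT w|M. \<bar>dyn \<psi> A (H s w) (H 0 w)\<bar>) \<le> (LINT w|M. activity A (incr (H s w)) * (2 * B))"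
      by (rule integral_mono_AE[OF integrable_abs[OF dyn_i[OF s(1)]] act_i[OF s(1)] dyn_le[OF s(1)]])
    also have "\<dots> = (LINT \<omega>|\<mu>. activity A \<omega>) * (2 * B)"
      using integral_stationary[OF s(1) measurable_activity] by simp
    finally show "(LINT w|M. \<bar>dyn \<psi> A (H s w) (H 0 w)\<bar>) \<le> (LINT \<omega>|\<mu>. activity A \<omega>) * (2 * B)" .
  qed
  have int': "integrable (time t \<Otimes>\<^sub>M M) (case_prod (\<lambda>s w. dyn \<psi> A (H s w) (H 0 w)))"
    using int by simp
  define D where "D w = \<psi> (disp A (H t w) (H 0 w)) - \<psi> 0 - (LINT s|time t. dyn \<psi> A (H s w) (H 0 w))" for w
  have \<psi>_m: "(\<lambda>w. \<psi> (disp A (H t w) (H 0 w))) \<in> borel_measurable N" if "sets N = sets F" for N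
    using measurable_compose[OF measurable_H2[OF that t] measurable_disp_fun[of \<psi> A]] by (simp only: fst_conv snd_conv)
  have i1: "integrable M (\<lambda>w. \<psi> (disp A (H t w) (H 0 w)))"
    by (rule M.integrable_const_bound[of _ B, OF _ \<psi>_m[OF sets_M]]) (rule AE_I2, unfold real_norm_def, rule B)
  have i2: "integrable M (\<lambda>w. LINT s|time t. dyn \<psi> A (H s w) (H 0 w))"
    by (rule integrable_snd[OF int'])
  have iD: "integrable M D" unfolding D_def by (intro Bochner_Integration.integrable_diff i1 i2) simp
  have D_m: "D \<in> borel_measurable F"
    unfolding D_def using measurable_time_integral[OF refl measurable_dyn[of \<psi> A], of t] \<psi>_m[OF refl]
    by (intro borel_measurable_diff borel_measurable_const) (simp_all only: fst_conv snd_conv)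
  have "(LINT w|M. D w) = (LINT \<omega>|\<mu>. LINT w|P (heights \<omega>). D w)"
    using integral_bind[OF measurable_started_kernel D_m] iD unfolding M_eq by simp
  also have "\<dots> = (LINT \<omega>|\<mu>. 0)"
  proof (rule integral_cong_AE)
    show "(\<lambda>\<omega>. LINT w|P (heights \<omega>). D w) \<in> borel_measurable \<mu>"
      using integrable_bind[OF measurable_started_kernel D_m] iD unfolding M_eq by simp
    show "AE \<omega> in \<mu>. (LINT w|P (heights \<omega>). D w) = 0"
      using AE_tempered
    proof eventually_elim
      fix \<omega> assume "\<omega> \<in> T"
      then have "incr (heights \<omega>) \<in> T" by (simp add: incr_heights)
      then show "(LINT w|P (heights \<omega>). D w) = 0"
        unfolding D_def by (rule dynkin_pointwise[OF _ A B t])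
    qed
  qed simp
  finally have "(LINT w|M. D w) = 0" by simp
  moreover have "(LINT w|M. D w) = (LINT w|M. \<psi> (disp A (H t w) (H 0 w))) - \<psi> 0 - (LINT w|M. LINT s|time t. dyn \<psi> A (H s w) (H 0 w))"
    unfolding D_def using i1 i2 by (simp add: M.prob_space[simplified])
  ultimately show "(LINT w|M. \<psi> (disp A (H t w) (H 0 w))) - \<psi> 0 = (LINT s|time t. LINT w|M. dyn \<psi> A (H s w) (H 0 w))"
    using Fubini_integral[OF int'] by simp
qed

section \<open>Variance of the number of bricks over a block\<close>

abbreviation "dsp A t w \<equiv> disp A (H t w) (H 0 w)"

lemma measurable_dsp:
  assumes "sets N = sets F" "0 \<le> t"
  shows "(\<lambda>w. dsp A t w) \<in> N \<rightarrow>\<^sub>M count_space UNIV"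
  using measurable_compose[OF measurable_H2[OF assms] measurable_disp] by (simp only: fst_conv snd_conv)

lemma measurable_dsp_real:
  fixes \<psi> :: "int \<Rightarrow> real"
  assumes "0 \<le> t"
  shows "(\<lambda>w. \<psi> (dsp A t w)) \<in> borel_measurable M"
  by (rule measurable_compose[OF measurable_dsp[OF sets_M assms]]) simp

lemma clip_bound_real: "0 \<le> m \<Longrightarrow> \<bar>real_of_int (clip m k)\<bar> \<le> real_of_int m"
  using clip_bound[of m k] by (simp only: of_int_abs[symmetric] of_int_le_iff)

lemma clip_square_bound: "0 \<le> m \<Longrightarrow> (real_of_int (clip m k))\<^sup>2 \<le> (real_of_int m)\<^sup>2"
  using clip_bound_real[of m k] abs_le_square_iff[of "real_of_int (clip m k)" "real_of_int m"] by simp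

text \<open>A priori bound: for the truncated square of the displacement the generator yields at most
  \<open>activity * (2 |clip| + 1)\<close>, which the square of the activity and the truncated square itself
  control; Gronwall's inequality closes the estimate uniformly in the truncation.\<close>

lemma truncated_second_moment:
  assumes A: "finite A" and t: "0 \<le> t" and m: "0 \<le> m"
  defines "a \<equiv> (LINT \<omega>|\<mu>. (activity A \<omega>)\<^sup>2 + activity A \<omega>)"
  shows "(LINT w|M. (real_of_int (clip m (dsp A t w)))\<^sup>2) \<le> 2 * a * exp (2 * t)"
proof -
  define \<psi> where "\<psi> k = (real_of_int (clip m k))\<^sup>2" for k
  define u where "u s = (LINT w|M. \<psi> (dsp A s w))" for s
  have \<psi>B: "\<bar>\<psi> k\<bar> \<le> (real_of_int m)\<^sup>2" for k
    using clip_square_bound[OF m, of k] unfolding \<psi>_def by simp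
  have \<psi>step: "\<bar>\<psi> (k + 1) - \<psi> k\<bar> \<le> 2 * \<bar>real_of_int (clip m k)\<bar> + 1"
    "\<bar>\<psi> (k - 1) - \<psi> k\<bar> \<le> 2 * \<bar>real_of_int (clip m k)\<bar> + 1" for k
    unfolding \<psi>_def by (intro square_step clip_step)+
  have \<psi>i: "integrable M (\<lambda>w. \<psi> (dsp A s w))" if "0 \<le> s" for s
    by (rule M.integrable_const_bound[of _ "(real_of_int m)\<^sup>2", OF _ measurable_dsp_real[OF that]])
      (rule AE_I2, unfold real_norm_def, rule \<psi>B)
  have act: "integrable M (\<lambda>w. (activity A (incr (H s w)))\<^sup>2 + activity A (incr (H s w)))"
    "(LINT w|M. (activity A (incr (H s w)))\<^sup>2 + activity A (incr (H s w))) = a" if "0 \<le> s" for s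
  proof -
    have g: "(\<lambda>\<omega>. (activity A \<omega>)\<^sup>2 + activity A \<omega>) \<in> borel_measurable config_space" by measurable
    show "integrable M (\<lambda>w. (activity A (incr (H s w)))\<^sup>2 + activity A (incr (H s w)))"
      using integrable_stationary[OF that g] integrable_activity integrable_activity_sq by simp
    show "(LINT w|M. (activity A (incr (H s w)))\<^sup>2 + activity A (incr (H s w))) = a"
      using integral_stationary[OF that g] by (simp add: a_def)
  qed
  have a0: "0 \<le> a"
    unfolding a_def by (rule integral_nonneg_AE) (use AE_tempered activity_nonneg in auto)
  have um: "u \<in> borel_measurable (time r)" for r
    unfolding u_def
    using M.borel_measurable_lebesgue_integral[OF joint_measurable[OF sets_M measurable_disp_fun[of \<psi> A], of r, unfolded fst_conv snd_conv]] .
  have u_bounds: "0 \<le> u s" "0 \<le> s \<Longrightarrow> u s \<le> (real_of_int m)\<^sup>2" for s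
  proof -
    show "0 \<le> u s" by (simp add: u_def \<psi>_def)
    assume s: "0 \<le> s"
    have "u s \<le> (LINT w|M. (real_of_int m)\<^sup>2)"
      unfolding u_def using \<psi>B by (intro integral_mono \<psi>i s) (auto intro: abs_le_D1)
    then show "u s \<le> (real_of_int m)\<^sup>2" by (simp add: M.prob_space[simplified])
  qed
  have "u t \<le> 2 * a * exp (2 * t)"
  proof (rule gronwall[OF t a0, of u "(real_of_int m)\<^sup>2"])
    show "u \<in> borel_measurable (time r)" for r by (rule um)
    show "0 \<le> u s" for s by (rule u_bounds)
    show "u s \<le> (real_of_int m)\<^sup>2" if "0 \<le> s" for s by (rule u_bounds(2)[OF that])
  next
    fix r :: real assume r: "0 \<le> r" "r \<le> t"
    interpret pair_sigma_finite "time r" M by (rule pair_sigma_finite_time) (rule M.prob_space_axioms)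
    interpret time: finite_measure "time r" by (rule finite_measure_time)
    note D = dynkin_stationary[where \<psi>=\<psi>, OF A \<psi>B r(1)]
    have \<psi>0: "\<psi> 0 = 0" using m by (simp add: \<psi>_def clip_def)
    have "u r = (LINT s|time r. LINT w|M. dyn \<psi> A (H s w) (H 0 w))"
      using D(2) \<psi>0 by (simp add: u_def)
    also have "\<dots> \<le> (LINT s|time r. a + u s)"
    proof (rule integral_mono)
      show "integrable (time r) (\<lambda>s. LINT w|M. dyn \<psi> A (H s w) (H 0 w))"
        using integrable_fst[of "\<lambda>s w. dyn \<psi> A (H s w) (H 0 w)"] D(1) by simp
      show "integrable (time r) (\<lambda>s. a + u s)"
      proof (rule time.integrable_const_bound[of _ "a + (real_of_int m)\<^sup>2"])
        show "AE s in time r. norm (a + u s) \<le> a + (real_of_int m)\<^sup>2"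
          by (rule AE_I2) (use u_bounds a0 in simp)
      qed (use um in simp)
      fix s assume "s \<in> space (time r)"
      then have s: "0 \<le> s" by simp
      have "AE w in M. dyn \<psi> A (H s w) (H 0 w) \<le> ((activity A (incr (H s w)))\<^sup>2 + activity A (incr (H s w))) + \<psi> (dsp A s w)"
        using AE_incr_tempered[OF s]
      proof eventually_elim
        fix w assume T: "incr (H s w) \<in> T"
        let ?c = "\<bar>real_of_int (clip m (dsp A s w))\<bar>" and ?a = "activity A (incr (H s w))"
        have "dyn \<psi> A (H s w) (H 0 w) \<le> ?a * (2 * ?c + 1)"
          using dyn_abs_le[OF T \<psi>step] by (rule abs_le_D1)
        also have "\<dots> = 2 * (?a * ?c) + ?a" by (simp add: algebra_simps)
        also have "\<dots> \<le> (?a\<^sup>2 + ?c\<^sup>2) + ?a" using mult_le_squares[of ?a ?c] by simp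
        finally show "dyn \<psi> A (H s w) (H 0 w) \<le> (?a\<^sup>2 + ?a) + \<psi> (dsp A s w)" by (simp add: \<psi>_def)
      qed
      moreover have "integrable M (\<lambda>w. dyn \<psi> A (H s w) (H 0 w))"
      proof -
        have mm: "(\<lambda>w. dyn \<psi> A (H s w) (H 0 w)) \<in> borel_measurable M"
          using measurable_compose[OF measurable_H2[OF sets_M s] measurable_dyn[of \<psi> A]] by (simp only: fst_conv snd_conv)
        have "integrable M (\<lambda>w. activity A (incr (H s w)) * (2 * real_of_int m + 1))"
          using integrable_stationary[OF s measurable_activity] integrable_activity by (intro integrable_mult_left) simp
        then show ?thesis
        proof (rule Bochner_Integration.integrable_bound[OF _ mm])
          show "AE w in M. norm (dyn \<psi> A (H s w) (H 0 w)) \<le> norm (activity A (incr (H s w)) * (2 * real_of_int m + 1))"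
            using AE_incr_tempered[OF s]
          proof eventually_elim
            fix w assume T: "incr (H s w) \<in> T"
            have "\<bar>dyn \<psi> A (H s w) (H 0 w)\<bar> \<le> activity A (incr (H s w)) * (2 * \<bar>real_of_int (clip m (dsp A s w))\<bar> + 1)"
              by (rule dyn_abs_le[OF T \<psi>step])
            also have "\<dots> \<le> activity A (incr (H s w)) * (2 * real_of_int m + 1)"
              using clip_bound_real[OF m, of "dsp A s w"] activity_nonneg[OF T] by (intro mult_left_mono) auto
            finally show "norm (dyn \<psi> A (H s w) (H 0 w)) \<le> norm (activity A (incr (H s w)) * (2 * real_of_int m + 1))"
              unfolding real_norm_def by (rule order_trans[OF _ abs_ge_self])
          qed
        qed
      qed
      ultimately have "(LINT w|M. dyn \<psi> A (H s w) (H 0 w)) \<le>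
         (LINT w|M. ((activity A (incr (H s w)))\<^sup>2 + activity A (incr (H s w))) + \<psi> (dsp A s w))"
        by (intro integral_mono_AE Bochner_Integration.integrable_add[OF act(1)[OF s] \<psi>i[OF s]])
      also have "\<dots> = a + u s"
        by (simp only: Bochner_Integration.integral_add[OF act(1)[OF s] \<psi>i[OF s]] act(2)[OF s] u_def)
      finally show "(LINT w|M. dyn \<psi> A (H s w) (H 0 w)) \<le> a + u s" .
    qed
    finally show "u r \<le> (LINT s|time r. a + u s)" .
  qed
  then show ?thesis by (simp add: u_def \<psi>_def)
qed

text \<open>Monotone convergence in the truncation level.\<close>

lemma second_moment:
  assumes A: "finite A" and t: "0 \<le> t"
  shows "integrable M (\<lambda>w. (real_of_int (dsp A t w))\<^sup>2)"
    and "(LINT w|M. (real_of_int (dsp A t w))\<^sup>2) \<le> 2 * (LINT \<omega>|\<mu>. (activity A \<omega>)\<^sup>2 + activity A \<omega>) * exp (2 * t)"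
proof -
  let ?C = "2 * (LINT \<omega>|\<mu>. (activity A \<omega>)\<^sup>2 + activity A \<omega>) * exp (2 * t)"
  let ?f = "\<lambda>n w. ennreal ((real_of_int (clip (int n) (dsp A t w)))\<^sup>2)"
  have C0: "0 \<le> ?C"
    by (rule order_trans[OF _ truncated_second_moment[OF A t, of 0]]) simp_all
  have fm: "?f n \<in> borel_measurable M" for n
    by (rule measurable_compose[OF measurable_dsp_real[OF t, of "\<lambda>k. (real_of_int (clip (int n) k))\<^sup>2"]]) simp
  have "incseq ?f"
  proof (intro incseq_SucI le_funI ennreal_leI)
    fix n w
    have "\<bar>clip (int n) k\<bar> \<le> \<bar>clip (int (Suc n)) k\<bar>" for k by (auto simp: clip_def)
    then show "(real_of_int (clip (int n) (dsp A t w)))\<^sup>2 \<le> (real_of_int (clip (int (Suc n)) (dsp A t w)))\<^sup>2"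
      by (simp only: abs_le_square_iff[symmetric] of_int_abs[symmetric] of_int_le_iff)
  qed
  from nn_integral_monotone_convergence_SUP[OF this fm]
  have mc: "(\<integral>\<^sup>+w. (SUP n. ?f n w) \<partial>M) = (SUP n. \<integral>\<^sup>+w. ?f n w \<partial>M)" .
  have "ennreal ((real_of_int (dsp A t w))\<^sup>2) \<le> (SUP n. ?f n w)" for w
    by (rule SUP_upper2[of "nat \<bar>dsp A t w\<bar>"]) (simp_all add: clip_id)
  then have "(\<integral>\<^sup>+w. ennreal ((real_of_int (dsp A t w))\<^sup>2) \<partial>M) \<le> (SUP n. \<integral>\<^sup>+w. ?f n w \<partial>M)"
    unfolding mc[symmetric] by (intro nn_integral_mono)
  also have "\<dots> \<le> ennreal ?C"
  proof (rule SUP_least)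
    fix n
    have "integrable M (\<lambda>w. (real_of_int (clip (int n) (dsp A t w)))\<^sup>2)"
    proof (rule M.integrable_const_bound[of _ "(real n)\<^sup>2"])
      show "AE w in M. norm ((real_of_int (clip (int n) (dsp A t w)))\<^sup>2) \<le> (real n)\<^sup>2"
        using clip_square_bound[of "int n"] by (intro AE_I2) simp
    qed (rule measurable_dsp_real[OF t])
    then have "(\<integral>\<^sup>+w. ?f n w \<partial>M) = ennreal (LINT w|M. (real_of_int (clip (int n) (dsp A t w)))\<^sup>2)"
      by (intro nn_integral_eq_integral) auto
    also have "\<dots> \<le> ennreal ?C" by (intro ennreal_leI truncated_second_moment A t) simp
    finally show "(\<integral>\<^sup>+w. ?f n w \<partial>M) \<le> ennreal ?C" .
  qed
  finally have le: "(\<integral>\<^sup>+w. ennreal ((real_of_int (dsp A t w))\<^sup>2) \<partial>M) \<le> ennreal ?C" .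
  show int: "integrable M (\<lambda>w. (real_of_int (dsp A t w))\<^sup>2)"
    using le by (intro integrableI_nonneg measurable_dsp_real[OF t]) (auto intro: le_less_trans)
  show "(LINT w|M. (real_of_int (dsp A t w))\<^sup>2) \<le> ?C"
    using le C0 by (subst (asm) nn_integral_eq_integral[OF int]) auto
qed

text \<open>Removing the truncation by dominated convergence on the product of time and sample space.\<close>

lemma dynkin_quadratic:
  assumes A: "finite A" and t: "0 \<le> t"
    and growth: "\<And>k. \<bar>\<psi> k\<bar> \<le> (real_of_int k)\<^sup>2"
    and step: "\<And>j k. \<bar>j - k\<bar> \<le> 1 \<Longrightarrow> \<bar>\<psi> j - \<psi> k\<bar> \<le> 2 * \<bar>real_of_int k\<bar> + 1"
  shows "integrable (time t \<Otimes>\<^sub>M M) (\<lambda>(s, w). dyn \<psi> A (H s w) (H 0 w))"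
    and "(LINT w|M. \<psi> (dsp A t w)) = (LINT s|time t. LINT w|M. dyn \<psi> A (H s w) (H 0 w))"
proof -
  interpret pair_sigma_finite "time t" M by (rule pair_sigma_finite_time) (rule M.prob_space_axioms)
  define a where "a = (LINT \<omega>|\<mu>. (activity A \<omega>)\<^sup>2 + activity A \<omega>)"
  (* A majorant of dyn, uniform in the truncation: 2ab is at most the sum of the squares of a and
     b, for a the activity and b the displacement. *)
  define d where "d h x = (activity A (incr h))\<^sup>2 + activity A (incr h) + (real_of_int (disp A h x))\<^sup>2" for h x
  have \<psi>0: "\<psi> 0 = 0" using growth[of 0] by simp
  have bound: "\<bar>dyn \<phi> A h x\<bar> \<le> d h x"
    if T: "incr h \<in> T" and \<phi>: "\<And>k. \<bar>\<phi> (k + 1) - \<phi> k\<bar> \<le> 2 * \<bar>real_of_int k\<bar> + 1" "\<And>k. \<bar>\<phi> (k - 1) - \<phi> k\<bar> \<le> 2 * \<bar>real_of_int k\<bar> + 1"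
    for \<phi> h x
  proof -
    let ?c = "\<bar>real_of_int (disp A h x)\<bar>" and ?a = "activity A (incr h)"
    have "\<bar>dyn \<phi> A h x\<bar> \<le> ?a * (2 * ?c + 1)" by (rule dyn_abs_le[OF T \<phi>])
    also have "\<dots> = 2 * (?a * ?c) + ?a" by (simp add: algebra_simps)
    also have "\<dots> \<le> (?a\<^sup>2 + ?c\<^sup>2) + ?a" using mult_le_squares[of ?a ?c] by simp
    finally show ?thesis by (simp add: d_def)
  qed
  have dm: "(\<lambda>x. d (fst x) (snd x)) \<in> borel_measurable config_pairs"
  proof -
    note measurable_disp_fun[of real_of_int A]
    moreover have "(\<lambda>x. activity A (incr (fst x))) \<in> borel_measurable config_pairs"
      by (rule measurable_compose[OF measurable_compose[OF measurable_fst measurable_incr] measurable_activity])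
    ultimately show ?thesis unfolding d_def by (intro borel_measurable_add borel_measurable_power)
  qed
  have di: "integrable M (\<lambda>w. d (H s w) (H 0 w))" if s: "0 \<le> s" for s
    unfolding d_def
    using integrable_stationary[OF s, of "activity A"] integrable_stationary[OF s, of "\<lambda>\<omega>. (activity A \<omega>)\<^sup>2"]
      integrable_activity integrable_activity_sq second_moment(1)[OF A s]
    by (intro Bochner_Integration.integrable_add) auto
  have d_int: "integrable (time t \<Otimes>\<^sub>M M) (\<lambda>(s, w). d (H s w) (H 0 w))"
  proof (rule integrable_time_stationary[OF dm, of t "a + 2 * a * exp (2 * t)", unfolded fst_conv snd_conv])
    fix s assume s: "0 \<le> s" "s \<le> t"
    show "integrable M (\<lambda>w. d (H s w) (H 0 w))" by (rule di[OF s(1)])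
    have a0: "0 \<le> a"
      unfolding a_def by (rule integral_nonneg_AE) (use AE_tempered activity_nonneg in auto)
    have g: "(\<lambda>\<omega>. (activity A \<omega>)\<^sup>2 + activity A \<omega>) \<in> borel_measurable config_space" by measurable
    have "(LINT w|M. \<bar>d (H s w) (H 0 w)\<bar>) = (LINT w|M. d (H s w) (H 0 w))"
    proof (rule integral_cong_AE[OF borel_measurable_integrable[OF integrable_abs[OF di[OF s(1)]]] borel_measurable_integrable[OF di[OF s(1)]]])
      show "AE w in M. \<bar>d (H s w) (H 0 w)\<bar> = d (H s w) (H 0 w)"
        using AE_incr_tempered[OF s(1)] by eventually_elim (simp add: d_def activity_nonneg)
    qed
    also have "\<dots> = (LINT w|M. (activity A (incr (H s w)))\<^sup>2 + activity A (incr (H s w))) + (LINT w|M. (real_of_int (dsp A s w))\<^sup>2)"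
      unfolding d_def
      using integrable_stationary[OF s(1) g] integrable_activity integrable_activity_sq second_moment(1)[OF A s(1)]
      by (intro Bochner_Integration.integral_add) auto
    also have "(LINT w|M. (activity A (incr (H s w)))\<^sup>2 + activity A (incr (H s w))) = a"
      using integral_stationary[OF s(1) g] by (simp add: a_def)
    also have "(LINT w|M. (real_of_int (dsp A s w))\<^sup>2) \<le> 2 * a * exp (2 * s)"
      unfolding a_def by (rule second_moment(2)[OF A s(1)])
    also have "2 * a * exp (2 * s) \<le> 2 * a * exp (2 * t)" using a0 s by (intro mult_left_mono) auto
    finally show "(LINT w|M. \<bar>d (H s w) (H 0 w)\<bar>) \<le> a + 2 * a * exp (2 * t)" by simp
  qed
  define \<psi>n where "\<psi>n n k = \<psi> (clip (int n) k)" for n k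
  have \<psi>n_bound: "\<bar>\<psi>n n k\<bar> \<le> (real n)\<^sup>2" for n k
  proof -
    have "\<bar>\<psi>n n k\<bar> \<le> (real_of_int (clip (int n) k))\<^sup>2" unfolding \<psi>n_def by (rule growth)
    also have "\<dots> \<le> (real n)\<^sup>2" using clip_square_bound[of "int n" k] by simp
    finally show ?thesis .
  qed
  have \<psi>n_le: "\<bar>\<psi>n n k\<bar> \<le> (real_of_int k)\<^sup>2" for n k
  proof -
    have "\<bar>\<psi>n n k\<bar> \<le> (real_of_int (clip (int n) k))\<^sup>2" unfolding \<psi>n_def by (rule growth)
    also have "\<dots> \<le> (real_of_int k)\<^sup>2"
      using clip_le[of "int n" k] by (simp only: abs_le_square_iff[symmetric] of_int_abs[symmetric] of_int_le_iff)
    finally show ?thesis .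
  qed
  have \<psi>n_step: "\<bar>\<psi>n n (k + 1) - \<psi>n n k\<bar> \<le> 2 * \<bar>real_of_int k\<bar> + 1" "\<bar>\<psi>n n (k - 1) - \<psi>n n k\<bar> \<le> 2 * \<bar>real_of_int k\<bar> + 1" for n k
  proof -
    have c: "\<bar>real_of_int (clip (int n) k)\<bar> \<le> \<bar>real_of_int k\<bar>"
      using clip_le[of "int n" k] by (simp only: of_int_abs[symmetric] of_int_le_iff of_nat_0_le_iff)
    show "\<bar>\<psi>n n (k + 1) - \<psi>n n k\<bar> \<le> 2 * \<bar>real_of_int k\<bar> + 1"
      using step[OF clip_step(1)[of "int n" k]] c unfolding \<psi>n_def by linarith
    show "\<bar>\<psi>n n (k - 1) - \<psi>n n k\<bar> \<le> 2 * \<bar>real_of_int k\<bar> + 1"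
      using step[OF clip_step(2)[of "int n" k]] c unfolding \<psi>n_def by linarith
  qed
  have \<psi>_step: "\<bar>\<psi> (k + 1) - \<psi> k\<bar> \<le> 2 * \<bar>real_of_int k\<bar> + 1" "\<bar>\<psi> (k - 1) - \<psi> k\<bar> \<le> 2 * \<bar>real_of_int k\<bar> + 1" for k
    by (intro step, simp)+
  have ev: "\<forall>\<^sub>F n in sequentially. \<psi>n n j = \<psi> j" for j
    using eventually_ge_at_top[of "nat \<bar>j\<bar>"] by eventually_elim (simp add: \<psi>n_def clip_id)
  have lim_\<psi>: "(\<lambda>n. \<psi>n n j) \<longlonglongrightarrow> \<psi> j" for j using ev by (rule tendsto_eventually)
  have lim_dyn: "(\<lambda>n. dyn (\<psi>n n) A h x) \<longlonglongrightarrow> dyn \<psi> A h x" for h x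
    unfolding dyn_def Let_def by (intro tendsto_intros lim_\<psi>)
  have jm: "(\<lambda>(s, w). dyn \<phi> A (H s w) (H 0 w)) \<in> borel_measurable (time t \<Otimes>\<^sub>M M)" for \<phi>
    using joint_measurable[OF sets_M measurable_dyn[of \<phi> A], of t] by (simp only: fst_conv snd_conv)
  have aeT: "AE x in time t \<Otimes>\<^sub>M M. incr (H (fst x) (snd x)) \<in> T"
  proof -
    define ind where "ind x = (indicator T (incr (fst x)) :: real)" for x :: "config \<times> config"
    have "ind \<in> borel_measurable config_pairs"
      unfolding ind_def
      by (rule measurable_compose[OF measurable_compose[OF measurable_fst measurable_incr]]) (use tempered_sets in simp)
    from joint_measurable[OF sets_M this, of t]
    have m: "(\<lambda>x. ind (H (fst x) (snd x), H 0 (snd x))) \<in> borel_measurable (time t \<Otimes>\<^sub>M M)"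
      by (simp only: case_prod_unfold)
    have "{x \<in> space (time t \<Otimes>\<^sub>M M). ind (H (fst x) (snd x), H 0 (snd x)) = 1} \<in> sets (time t \<Otimes>\<^sub>M M)"
      by (rule borel_measurable_eq[OF m borel_measurable_const])
    then have "{x \<in> space (time t \<Otimes>\<^sub>M M). incr (H (fst x) (snd x)) \<in> T} \<in> sets (time t \<Otimes>\<^sub>M M)"
      by (simp add: ind_def indicator_eq_1_iff)
    moreover have "AE s in time t. AE w in M. incr (H s w) \<in> T"
      by (rule AE_I2) (simp add: AE_incr_tempered)
    ultimately show ?thesis by (intro AE_pair_measure) simp_all
  qed
  have ineq: "AE x in time t \<Otimes>\<^sub>M M. norm (case x of (s, w) \<Rightarrow> dyn (\<psi>n n) A (H s w) (H 0 w)) \<le> (case x of (s, w) \<Rightarrow> d (H s w) (H 0 w))" for n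
    using aeT by eventually_elim (simp add: case_prod_unfold bound \<psi>n_step)
  have lim1: "(\<lambda>n. integral\<^sup>L (time t \<Otimes>\<^sub>M M) (\<lambda>(s, w). dyn (\<psi>n n) A (H s w) (H 0 w))) \<longlonglongrightarrow>
      (integral\<^sup>L (time t \<Otimes>\<^sub>M M) (\<lambda>(s, w). dyn \<psi> A (H s w) (H 0 w)))"
    by (rule integral_dominated_convergence[where s="\<lambda>n (s, w). dyn (\<psi>n n) A (H s w) (H 0 w)", OF jm jm d_int _ ineq])
      (rule AE_I2, simp add: case_prod_unfold lim_dyn)
  show int: "integrable (time t \<Otimes>\<^sub>M M) (\<lambda>(s, w). dyn \<psi> A (H s w) (H 0 w))"
    by (rule integrable_dominated_convergence[where s="\<lambda>n (s, w). dyn (\<psi>n n) A (H s w) (H 0 w)", OF jm jm d_int _ ineq])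
      (rule AE_I2, simp add: case_prod_unfold lim_dyn)
  have lim2: "(\<lambda>n. LINT w|M. \<psi>n n (dsp A t w)) \<longlonglongrightarrow> (LINT w|M. \<psi> (dsp A t w))"
    by (rule integral_dominated_convergence[OF measurable_dsp_real[OF t] measurable_dsp_real[OF t] second_moment(1)[OF A t]])
      (use \<psi>n_le lim_\<psi> in auto)
  have eq: "(LINT w|M. \<psi>n n (dsp A t w)) = (integral\<^sup>L (time t \<Otimes>\<^sub>M M) (\<lambda>(s, w). dyn (\<psi>n n) A (H s w) (H 0 w)))" for n
    using dynkin_stationary[where \<psi>="\<psi>n n", OF A \<psi>n_bound t] integral_fst[of "\<lambda>s w. dyn (\<psi>n n) A (H s w) (H 0 w)"]
    by (simp add: \<psi>n_def[of n 0] clip_def \<psi>0)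
  have "(LINT w|M. \<psi> (dsp A t w)) = (integral\<^sup>L (time t \<Otimes>\<^sub>M M) (\<lambda>(s, w). dyn \<psi> A (H s w) (H 0 w)))"
    using lim2 lim1 unfolding eq by (rule LIMSEQ_unique)
  then show "(LINT w|M. \<psi> (dsp A t w)) = (LINT s|time t. LINT w|M. dyn \<psi> A (H s w) (H 0 w))"
    using integral_fst[of "\<lambda>s w. dyn \<psi> A (H s w) (H 0 w)"] int by simp
qed

end

lemma distr_path_law:
  assumes X: "\<And>s. 0 \<le> s \<Longrightarrow> X s \<in> N \<rightarrow>\<^sub>M S"
    and \<Phi>: "\<Phi> \<in> S \<Otimes>\<^sub>M S \<rightarrow>\<^sub>M L" and t: "0 \<le> t"
  shows "distr (path_law S N X) L (\<lambda>x. \<Phi> (x 0, x t)) = distr N L (\<lambda>w. \<Phi> (X 0 w, X t w))"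
proof -
  let ?Q = "\<Pi>\<^sub>M s\<in>{0::real..}. S"
  have m: "(\<lambda>x. \<Phi> (x 0, x t)) \<in> ?Q \<rightarrow>\<^sub>M L"
    using t by (intro measurable_compose[OF _ \<Phi>] measurable_Pair measurable_component_singleton) auto
  have "(\<lambda>w. \<lambda>s\<in>{0..}. X s w) \<in> N \<rightarrow>\<^sub>M ?Q" using X by (intro measurable_restrict) auto
  from distr_distr[OF m this] show ?thesis using t by (simp add: path_law_def comp_def)
qed

lemma path_law_distr:
  assumes eq: "path_law S N X = path_law S N' X'"
    and X: "\<And>s. 0 \<le> s \<Longrightarrow> X s \<in> N \<rightarrow>\<^sub>M S" and X': "\<And>s. 0 \<le> s \<Longrightarrow> X' s \<in> N' \<rightarrow>\<^sub>M S"
    and \<Phi>: "\<Phi> \<in> S \<Otimes>\<^sub>M S \<rightarrow>\<^sub>M L" and t: "0 \<le> t"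
  shows "distr N L (\<lambda>w. \<Phi> (X 0 w, X t w)) = distr N' L (\<lambda>w. \<Phi> (X' 0 w, X' t w))"
  using distr_path_law[of X, OF X \<Phi> t] distr_path_law[of X', OF X' \<Phi> t] eq by simp

lemma emeasure_distr_indicator:
  fixes X :: "'a \<Rightarrow> real"
  assumes "X \<in> borel_measurable N" "B \<in> sets borel"
  shows "emeasure (distr N borel X) B = (\<integral>\<^sup>+w. indicator B (X w) \<partial>N)"
proof -
  have "(\<integral>\<^sup>+x. indicator B x \<partial>distr N borel X) = (\<integral>\<^sup>+w. indicator B (X w) \<partial>N)"
    by (rule nn_integral_distr[OF assms(1)]) (use assms(2) in simp)
  then show ?thesis using assms(2) by simp
qed

context stationary_process begin

lemma dyn_identity: "dyn real_of_int A h x = drift A (incr h)"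
  by (simp add: dyn_def drift_def Let_def)

lemma dyn_square: "dyn (\<lambda>k. (real_of_int k)\<^sup>2) A h x = 2 * (real_of_int (disp A h x) * drift A (incr h)) + activity A (incr h)"
proof -
  let ?k = "real_of_int (disp A h x)"
  have "dyn (\<lambda>k. (real_of_int k)\<^sup>2) A h x =
     (\<Sum>n\<in>A. 2 * ?k * (up n (incr h) - down n (incr h)) + (up n (incr h) + down n (incr h)))"
    unfolding dyn_def Let_def by (rule sum.cong) (auto simp: power2_eq_square algebra_simps)
  then show ?thesis by (simp add: sum.distrib drift_def activity_def sum_distrib_left mult.assoc)
qed

lemma integral_time_const: "0 \<le> t \<Longrightarrow> (LINT s|time t. c) = c * t" for c :: real
  using measure_time[of t] by simp

lemma mean_displacement:
  assumes A: "finite A" and t: "0 \<le> t"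
  shows "(LINT w|M. real_of_int (dsp A t w)) = (LINT \<omega>|\<mu>. drift A \<omega>) * t"
proof -
  have abs_sq: "\<bar>real_of_int k\<bar> \<le> (real_of_int k)\<^sup>2" for k
  proof -
    have "\<bar>k\<bar> \<le> k\<^sup>2" using self_le_power[of "\<bar>k\<bar>" 2] by (cases "k = 0") auto
    then show ?thesis by (simp only: of_int_power[symmetric] of_int_abs[symmetric] of_int_le_iff)
  qed
  have "(LINT w|M. real_of_int (dsp A t w)) = (LINT s|time t. LINT w|M. drift A (incr (H s w)))"
    using dynkin_quadratic(2)[where \<psi>=real_of_int, OF A t abs_sq] by (simp add: dyn_identity)
  also have "\<dots> = (LINT s|time t. LINT \<omega>|\<mu>. drift A \<omega>)"
    by (rule Bochner_Integration.integral_cong) (simp_all add: integral_stationary measurable_drift)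
  finally show ?thesis by (simp only: integral_time_const[OF t])
qed

lemma integrable_displacement:
  assumes "finite A" "0 \<le> t"
  shows "integrable M (\<lambda>w. real_of_int (dsp A t w))"
  by (rule integrable_of_square[OF M.prob_space_axioms measurable_dsp_real[OF assms(2)] second_moment(1)[OF assms]])

lemma integrable_centred_displacement_sq:
  assumes "finite A" "0 \<le> t"
  shows "integrable M (\<lambda>w. (real_of_int (dsp A t w) - c)\<^sup>2)"
proof -
  have "integrable M (\<lambda>w. (real_of_int (dsp A t w))\<^sup>2 + c\<^sup>2 - 2 * c * real_of_int (dsp A t w))"
    by (intro Bochner_Integration.integrable_add Bochner_Integration.integrable_diff integrable_mult_right second_moment integrable_displacement assms) simp
  then show ?thesis by (simp add: power2_diff mult_ac)
qed

text \<open>The variance of the number of bricks added over \<open>A\<close> grows only linearly in the size of \<open>A\<close>: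
  subtracting the square of the mean turns the drift term of the second moment into a covariance,
  to which the fluctuations of the drift contribute linearly in \<open>card A\<close>. Hence the spatial
  averages of the currents become deterministic.\<close>

lemma displacement_variance_linear:
  assumes t: "0 \<le> t"
  obtains C :: real where "0 \<le> C" "\<And>A. finite A \<Longrightarrow>
    (LINT w|M. (real_of_int (dsp A t w) - (LINT w|M. real_of_int (dsp A t w)))\<^sup>2) \<le> C * real (card A)"
proof -
  obtain v where v: "0 \<le> v" "\<And>A. finite A \<Longrightarrow>
    (LINT \<omega>|\<mu>. (drift A \<omega> - (LINT \<omega>|\<mu>. drift A \<omega>))\<^sup>2) \<le> v * real (card A)"
    using drift_variance_linear by blast
  obtain c where c: "0 \<le> c" "\<And>A. finite A \<Longrightarrow> (LINT \<omega>|\<mu>. activity A \<omega>) \<le> c * real (card A)"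
    using activity_moments_linear by blast
  have "(LINT w|M. (real_of_int (dsp A t w) - (LINT w|M. real_of_int (dsp A t w)))\<^sup>2) \<le> 2 * ((v + c) * real (card A)) * exp (2 * t)"
    if A: "finite A" for A
  proof -
    define \<rho> where "\<rho> = (LINT \<omega>|\<mu>. drift A \<omega>)"
    define b where "b = (v + c) * real (card A)"
    define u where "u s = (LINT w|M. (real_of_int (dsp A s w) - \<rho> * s)\<^sup>2)" for s
    define a where "a = 2 * (LINT \<omega>|\<mu>. (activity A \<omega>)\<^sup>2 + activity A \<omega>)"
    have mean: "(LINT w|M. real_of_int (dsp A s w)) = \<rho> * s" if "0 \<le> s" for s
      unfolding \<rho>_def by (rule mean_displacement[OF A that])
    have u_eq: "u s = (LINT w|M. (real_of_int (dsp A s w))\<^sup>2) - (\<rho> * s)\<^sup>2" if s: "0 \<le> s" for s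
    proof -
      have "u s = (LINT w|M. (real_of_int (dsp A s w))\<^sup>2 + (\<rho> * s)\<^sup>2 - 2 * (\<rho> * s) * real_of_int (dsp A s w))"
        unfolding u_def by (rule Bochner_Integration.integral_cong) (simp_all add: power2_diff mult_ac)
      also have "\<dots> = (LINT w|M. (real_of_int (dsp A s w))\<^sup>2) + (\<rho> * s)\<^sup>2 - 2 * (\<rho> * s) * (LINT w|M. real_of_int (dsp A s w))"
        using second_moment(1)[OF A s] integrable_displacement[OF A s] by (simp add: M.prob_space[simplified])
      finally show ?thesis unfolding mean[OF s] by (simp add: power2_eq_square)
    qed
    have a0: "0 \<le> a"
      unfolding a_def by (intro mult_nonneg_nonneg integral_nonneg_AE) (use AE_tempered activity_nonneg in auto)
    have u_le: "u s \<le> a * exp (2 * t)" if s: "0 \<le> s" "s \<le> t" for s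
    proof -
      have "u s \<le> (LINT w|M. (real_of_int (dsp A s w))\<^sup>2)" using u_eq[OF s(1)] by simp
      also have "\<dots> \<le> a * exp (2 * s)" unfolding a_def by (rule second_moment(2)[OF A s(1)])
      also have "\<dots> \<le> a * exp (2 * t)" using a0 s by (intro mult_left_mono) auto
      finally show ?thesis .
    qed
    have um: "u \<in> borel_measurable (time r)" for r
    proof -
      note m = measurable_disp_fun[of "\<lambda>k. (real_of_int k)\<^sup>2" A]
      have "(\<lambda>s. LINT w|M. (real_of_int (dsp A s w))\<^sup>2) \<in> borel_measurable (time r)"
        using M.borel_measurable_lebesgue_integral[OF joint_measurable[OF sets_M m, of r, unfolded fst_conv snd_conv]] .
      moreover have "(\<lambda>s. (\<rho> * s)\<^sup>2) \<in> borel_measurable (time r)"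
        by (rule measurable_restrict_space1) simp
      ultimately have "(\<lambda>s. (LINT w|M. (real_of_int (dsp A s w))\<^sup>2) - (\<rho> * s)\<^sup>2) \<in> borel_measurable (time r)"
        by (rule borel_measurable_diff)
      then show ?thesis by (rule measurable_cong[THEN iffD1, rotated]) (simp add: u_eq)
    qed
    have drift_m: "(\<lambda>w. drift A (incr (H s w))) \<in> borel_measurable M" if "0 \<le> s" for s
      by (rule measurable_compose[OF measurable_incr_H[OF sets_M that] measurable_drift])
    (* The term 2 s \<rho>^2 is the derivative of the squared mean; its subtraction centres both
       factors of the product. *)
    have cov: "2 * (LINT w|M. real_of_int (dsp A s w) * drift A (incr (H s w))) + (LINT \<omega>|\<mu>. activity A \<omega>) - 2 * s * \<rho>\<^sup>2 \<le> b + u s"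
      if s: "0 \<le> s" for s
    proof -
      let ?X = "\<lambda>w. real_of_int (dsp A s w)" and ?D = "\<lambda>w. drift A (incr (H s w))"
      have Di: "integrable M ?D" "(LINT w|M. ?D w) = \<rho>"
        using integrable_stationary[OF s measurable_drift] integral_stationary[OF s measurable_drift] integrable_drift by (auto simp: \<rho>_def)
      have D2: "integrable M (\<lambda>w. (?D w)\<^sup>2)"
        using integrable_stationary[OF s, of "\<lambda>\<omega>. (drift A \<omega>)\<^sup>2"] integrable_drift_sq by simp
      have XD: "integrable M (\<lambda>w. ?X w * ?D w)"
        by (rule integrable_product_of_squares[OF measurable_dsp_real[OF s] drift_m[OF s] second_moment(1)[OF A s] D2])
      have Xi: "integrable M ?X" by (rule integrable_displacement[OF A s])
      have Dc: "integrable M (\<lambda>w. (?D w - \<rho>)\<^sup>2)" "(LINT w|M. (?D w - \<rho>)\<^sup>2) \<le> v * real (card A)"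
      proof -
        have "integrable M (\<lambda>w. (?D w)\<^sup>2 + \<rho>\<^sup>2 - 2 * \<rho> * ?D w)"
          by (intro Bochner_Integration.integrable_add Bochner_Integration.integrable_diff integrable_mult_right D2 Di) simp
        then show "integrable M (\<lambda>w. (?D w - \<rho>)\<^sup>2)" by (simp add: power2_diff mult_ac)
        have "(LINT w|M. (?D w - \<rho>)\<^sup>2) = (LINT \<omega>|\<mu>. (drift A \<omega> - \<rho>)\<^sup>2)"
          by (rule integral_stationary[OF s, of "\<lambda>\<omega>. (drift A \<omega> - \<rho>)\<^sup>2"]) measurable
        then show "(LINT w|M. (?D w - \<rho>)\<^sup>2) \<le> v * real (card A)" using v(2)[OF A] by (simp add: \<rho>_def)
      qed
      have "(LINT w|M. (?X w - \<rho> * s) * (?D w - \<rho>)) = (LINT w|M. ?X w * ?D w - \<rho> * ?X w - \<rho> * s * ?D w + \<rho> * s * \<rho>)"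
        by (rule Bochner_Integration.integral_cong) (simp_all add: algebra_simps)
      also have "\<dots> = (LINT w|M. ?X w * ?D w) - \<rho> * (LINT w|M. ?X w) - \<rho> * s * (LINT w|M. ?D w) + \<rho> * s * \<rho>"
        using XD Xi Di(1) by (simp add: M.prob_space[simplified])
      finally have e1: "(LINT w|M. (?X w - \<rho> * s) * (?D w - \<rho>)) = (LINT w|M. ?X w * ?D w) - s * \<rho>\<^sup>2"
        unfolding mean[OF s] Di(2) by (simp add: power2_eq_square)
      have Xc: "integrable M (\<lambda>w. (?X w - \<rho> * s)\<^sup>2)" by (rule integrable_centred_displacement_sq[OF A s])
      have "(LINT w|M. (?X w - \<rho> * s) * (?D w - \<rho>)) \<le> (LINT w|M. ((?X w - \<rho> * s)\<^sup>2 + (?D w - \<rho>)\<^sup>2) / 2)"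
      proof (rule integral_mono[OF _ _ mult_le_squares])
        show "integrable M (\<lambda>w. (?X w - \<rho> * s) * (?D w - \<rho>))"
          by (rule integrable_product_of_squares[OF _ _ Xc Dc(1)])
            (intro borel_measurable_diff borel_measurable_const measurable_dsp_real[OF s] drift_m[OF s])+
        show "integrable M (\<lambda>w. ((?X w - \<rho> * s)\<^sup>2 + (?D w - \<rho>)\<^sup>2) / 2)"
          by (intro integrable_divide Bochner_Integration.integrable_add Xc Dc(1))
      qed
      also have "\<dots> = (u s + (LINT w|M. (?D w - \<rho>)\<^sup>2)) / 2"
        using Xc Dc(1) by (simp add: u_def)
      finally have "2 * (LINT w|M. (?X w - \<rho> * s) * (?D w - \<rho>)) \<le> u s + v * real (card A)"
        using Dc(2) by simp
      moreover have "(LINT \<omega>|\<mu>. activity A \<omega>) \<le> c * real (card A)" by (rule c(2)[OF A])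
      ultimately show ?thesis unfolding e1 b_def by (simp add: algebra_simps)
    qed
    have "u t \<le> 2 * b * exp (2 * t)"
    proof (rule gronwall[OF t _ um _ u_le])
      show "0 \<le> b" unfolding b_def using v c by simp
      show "0 \<le> u s" for s by (simp add: u_def)
      fix r :: real assume r: "0 \<le> r" "r \<le> t"
      interpret time: finite_measure "time r" by (rule finite_measure_time)
      interpret pair_sigma_finite "time r" M by (rule pair_sigma_finite_time) (rule M.prob_space_axioms)
      have step: "\<bar>(real_of_int j)\<^sup>2 - (real_of_int k)\<^sup>2\<bar> \<le> 2 * \<bar>real_of_int k\<bar> + 1" if "\<bar>j - k\<bar> \<le> 1" for j k
        by (rule square_step[OF that])
      have growth: "\<bar>(real_of_int k)\<^sup>2\<bar> \<le> (real_of_int k)\<^sup>2" for k by simp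
      note Q = dynkin_quadratic[where \<psi>="\<lambda>k. (real_of_int k)\<^sup>2", OF A r(1) growth step, unfolded dyn_square]
      define e where "e s = 2 * (LINT w|M. real_of_int (dsp A s w) * drift A (incr (H s w))) + (LINT \<omega>|\<mu>. activity A \<omega>)" for s
      have e: "(LINT w|M. 2 * (real_of_int (dsp A s w) * drift A (incr (H s w))) + activity A (incr (H s w))) = e s" if s: "0 \<le> s" for s
      proof -
        have "integrable M (\<lambda>w. (drift A (incr (H s w)))\<^sup>2)"
          using integrable_stationary[OF s, of "\<lambda>\<omega>. (drift A \<omega>)\<^sup>2"] integrable_drift_sq by simp
        then have "integrable M (\<lambda>w. real_of_int (dsp A s w) * drift A (incr (H s w)))"
          by (rule integrable_product_of_squares[OF measurable_dsp_real[OF s] drift_m[OF s] second_moment(1)[OF A s]])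
        moreover have "integrable M (\<lambda>w. activity A (incr (H s w)))"
          using integrable_stationary[OF s measurable_activity] integrable_activity by simp
        ultimately show ?thesis
          using integral_stationary[OF s measurable_activity] by (simp add: e_def)
      qed
      have int_e: "integrable (time r) e"
      proof -
        have "integrable (time r) (\<lambda>s. LINT w|M. 2 * (real_of_int (dsp A s w) * drift A (incr (H s w))) + activity A (incr (H s w)))"
          by (rule integrable_fst) (use Q(1) in simp)
        then show ?thesis
          by (rule Bochner_Integration.integrable_cong[THEN iffD1, rotated -1]) (simp_all add: e)
      qed
      have der: "((\<lambda>s. s\<^sup>2 * \<rho>\<^sup>2) has_real_derivative 2 * s * \<rho>\<^sup>2) (at s)" for s
        by (auto intro!: derivative_eq_intros)
      have cont: "continuous_on UNIV (\<lambda>s. 2 * s * \<rho>\<^sup>2)" by (intro continuous_intros)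
      note F = integral_time_FTC[OF r(1) der cont]
      have "(LINT w|M. (real_of_int (dsp A r w))\<^sup>2) =
          (LINT s|time r. LINT w|M. 2 * (real_of_int (dsp A s w) * drift A (incr (H s w))) + activity A (incr (H s w)))"
        by (rule Q(2))
      also have "\<dots> = (LINT s|time r. e s)"
        by (rule Bochner_Integration.integral_cong) (simp_all add: e)
      finally have "u r = (LINT s|time r. e s) - (LINT s|time r. 2 * s * \<rho>\<^sup>2)"
        unfolding F(2) u_eq[OF r(1)] by (simp add: power_mult_distrib mult.commute)
      also have "\<dots> = (LINT s|time r. e s - 2 * s * \<rho>\<^sup>2)"
        by (rule Bochner_Integration.integral_diff[OF int_e F(1), symmetric])
      also have "\<dots> \<le> (LINT s|time r. b + u s)"
      proof (rule integral_mono[OF Bochner_Integration.integrable_diff[OF int_e F(1)]])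
        have "integrable (time r) u"
        proof (rule time.integrable_const_bound[OF _ um, of "a * exp (2 * t)"])
          have "0 \<le> u s" for s by (simp add: u_def)
          then show "AE s in time r. norm (u s) \<le> a * exp (2 * t)"
            using u_le r by (intro AE_I2) simp
        qed
        then show "integrable (time r) (\<lambda>s. b + u s)" by simp
        fix s assume "s \<in> space (time r)"
        then show "e s - 2 * s * \<rho>\<^sup>2 \<le> b + u s" using cov[of s] by (simp add: e_def)
      qed
      finally show "u r \<le> (LINT s|time r. b + u s)" .
    qed
    then show ?thesis unfolding u_def b_def mean[OF t] .
  qed
  note bound = this
  show thesis
  proof (rule that[of "2 * (v + c) * exp (2 * t)"])
    show "0 \<le> 2 * (v + c) * exp (2 * t)" using v c by simp
    fix A :: "int set" assume "finite A"
    from bound[OF this]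
    show "(LINT w|M. (real_of_int (dsp A t w) - (LINT w|M. real_of_int (dsp A t w)))\<^sup>2) \<le> 2 * (v + c) * exp (2 * t) * real (card A)"
      by (simp only: mult_ac)
  qed
qed

section \<open>Translation invariance\<close>

lemma heights_shift: "heights (\<lambda>i. \<omega> (i + k)) = (\<lambda>i. heights \<omega> (i + k) + (- heights \<omega> k))"
proof
  fix i
  have "incr (\<lambda>i. heights \<omega> (i + k)) = (\<lambda>i. \<omega> (i + k))"
    using fun_cong[OF incr_heights[of \<omega>]] by (simp add: incr_def fun_eq_iff algebra_simps)
  with heights_incr[of "\<lambda>i. heights \<omega> (i + k)" i]
  show "heights (\<lambda>i. \<omega> (i + k)) i = heights \<omega> (i + k) + (- heights \<omega> k)" by simp
qed

text \<open>Homogeneity of the dynamics moves a translation of the process to its starting profile, and the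
  product measure is translation invariant. The translated profile has to be renormalised to
  height zero at the origin, which adds a constant that \<open>\<Phi>\<close> does not see.\<close>

lemma distr_translate:
  fixes \<Phi> :: "config \<times> config \<Rightarrow> real"
  assumes \<Phi>: "\<Phi> \<in> borel_measurable config_pairs"
    and inv: "\<And>g h c. \<Phi> (\<lambda>i. g i + c, \<lambda>i. h i + c) = \<Phi> (g, h)" and t: "0 \<le> t"
  shows "distr M borel (\<lambda>w. \<Phi> (\<lambda>i. H 0 w (i + k), \<lambda>i. H t w (i + k))) = distr M borel (\<lambda>w. \<Phi> (H 0 w, H t w))"
    (is "distr M borel ?L = distr M borel ?R")
proof (rule measure_eqI)
  fix B assume "B \<in> sets (distr M borel ?L)"
  then have B: "B \<in> sets borel" by simp
  have HH: "(\<lambda>w. (H 0 w, H t w)) \<in> N \<rightarrow>\<^sub>M config_pairs" if "sets N = sets F" for N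
    using measurable_H[OF that] t by (intro measurable_Pair) auto
  have sh: "(\<lambda>x. (\<lambda>i. fst x (i + k) + c, \<lambda>i. snd x (i + k) + c)) \<in> config_pairs \<rightarrow>\<^sub>M config_pairs" for c
    by (intro measurable_Pair measurable_compose[OF measurable_fst measurable_shift] measurable_compose[OF measurable_snd measurable_shift])
  have R: "?R \<in> borel_measurable N" if "sets N = sets F" for N
    by (rule measurable_compose[OF HH[OF that] \<Phi>])
  have L: "?L \<in> borel_measurable N" if "sets N = sets F" for N
    using measurable_compose[OF measurable_compose[OF HH[OF that] sh[of 0]] \<Phi>] by simp
  define G where "G \<omega> = emeasure (distr (P (heights \<omega>)) borel ?R) B" for \<omega>
  have Gint: "G \<omega> = (\<integral>\<^sup>+w. indicator B (?R w) \<partial>P (heights \<omega>))" for \<omega>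
    unfolding G_def by (rule emeasure_distr_indicator[OF R[OF sets_P] B])
  have indR: "(\<lambda>w. indicator B (?R w) :: ennreal) \<in> borel_measurable F"
    by (rule measurable_compose[OF R[OF refl]]) (use B in simp)
  have indL: "(\<lambda>w. indicator B (?L w) :: ennreal) \<in> borel_measurable F"
    by (rule measurable_compose[OF L[OF refl]]) (use B in simp)
  have kern: "(\<lambda>\<omega>. P (heights \<omega>)) \<in> config_space \<rightarrow>\<^sub>M subprob_algebra F"
    by (rule measurable_compose[OF measurable_heights measurable_prob_algebraD[OF proc.kernel]])
  have Gm: "G \<in> borel_measurable config_space"
    unfolding Gint by (rule measurable_compose[OF kern nn_integral_measurable_subprob_algebra[OF indR]])
  have shift: "(\<integral>\<^sup>+w. indicator B (?L w) \<partial>P (heights \<omega>)) = G (\<lambda>i. \<omega> (i + k))" if \<omega>: "\<omega> \<in> T" for \<omega>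
  proof -
    let ?c = "- heights \<omega> k"
    have "incr (heights \<omega>) \<in> T" using \<omega> by (simp add: incr_heights)
    from homogeneous[OF this, of k ?c]
    have pl: "path_law config_space (P (heights (\<lambda>i. \<omega> (i + k)))) H =
       path_law config_space (P (heights \<omega>)) (\<lambda>t w i. H t w (i + k) + ?c)"
      unfolding heights_shift .
    have "distr (P (heights (\<lambda>i. \<omega> (i + k)))) borel (\<lambda>w. \<Phi> (H 0 w, H t w)) =
       distr (P (heights \<omega>)) borel (\<lambda>w. \<Phi> (\<lambda>i. H 0 w (i + k) + ?c, \<lambda>i. H t w (i + k) + ?c))"
      by (rule path_law_distr[OF pl _ _ \<Phi> t])
        (intro measurable_H sets_P, simp, rule measurable_compose[OF measurable_H[OF sets_P] measurable_shift])
    also have "(\<lambda>w. \<Phi> (\<lambda>i. H 0 w (i + k) + ?c, \<lambda>i. H t w (i + k) + ?c)) = ?L"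
      using inv[of "\<lambda>i. H 0 _ (i + k)" ?c "\<lambda>i. H t _ (i + k)"] by (rule ext)
    finally have "G (\<lambda>i. \<omega> (i + k)) = emeasure (distr (P (heights \<omega>)) borel ?L) B"
      unfolding G_def by simp
    also have "\<dots> = (\<integral>\<^sup>+w. indicator B (?L w) \<partial>P (heights \<omega>))"
      by (rule emeasure_distr_indicator[OF L[OF sets_P] B])
    finally show ?thesis by simp
  qed
  have mshift: "(\<lambda>\<omega> i. \<omega> (i + k)) \<in> \<mu> \<rightarrow>\<^sub>M config_space"
    using measurable_shift0 by (subst measurable_cong_sets[OF sets_product_measure refl])
  have "emeasure (distr M borel ?L) B = (\<integral>\<^sup>+w. indicator B (?L w) \<partial>M)"
    by (rule emeasure_distr_indicator[OF L[OF sets_M] B])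
  also have "\<dots> = (\<integral>\<^sup>+\<omega>. \<integral>\<^sup>+w. indicator B (?L w) \<partial>P (heights \<omega>) \<partial>\<mu>)"
    unfolding M_eq by (rule nn_integral_bind[OF indL measurable_prob_algebraD[OF measurable_started_kernel]])
  also have "\<dots> = (\<integral>\<^sup>+\<omega>. G (\<lambda>i. \<omega> (i + k)) \<partial>\<mu>)"
    by (rule nn_integral_cong_AE) (use AE_tempered in eventually_elim, rule shift)
  also have "\<dots> = (\<integral>\<^sup>+\<omega>. G \<omega> \<partial>distr \<mu> config_space (\<lambda>\<omega> i. \<omega> (i + k)))"
    by (rule nn_integral_distr[OF mshift, symmetric]) (use Gm in simp)
  also have "\<dots> = (\<integral>\<^sup>+\<omega>. G \<omega> \<partial>\<mu>)" by (simp only: distr_shift)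
  also have "\<dots> = (\<integral>\<^sup>+w. indicator B (?R w) \<partial>M)"
    unfolding M_eq Gint by (rule nn_integral_bind[OF indR measurable_prob_algebraD[OF measurable_started_kernel], symmetric])
  also have "\<dots> = emeasure (distr M borel ?R) B"
    by (rule emeasure_distr_indicator[OF R[OF sets_M] B, symmetric])
  finally show "emeasure (distr M borel ?L) B = emeasure (distr M borel ?R) B" .
qed simp

end

section \<open>The second class particle and the two-point function\<close>

lemma bump_inj: "bump x i 1 = bump x j 1 \<Longrightarrow> i = j"
  by (metis add_cancel_left_right bump_def fun_upd_apply zero_neq_one)

locale stationary_coupling =
  basic_coupling wmin wmax p q f I T F P H F2 P2 G K + site_marginal wmin wmax p q f I \<theta>
  for wmin wmax p q f I T and F :: "'a measure" and P H
    and F2 :: "'b measure" and P2 G K \<theta>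

sublocale stationary_coupling \<subseteq> stationary_process wmin wmax p q f I T F P H \<theta>
  by unfold_locales

context stationary_coupling begin

abbreviation "\<mu>' \<equiv> modified_product_measure I f \<theta>"
abbreviation "M' \<equiv> started_pair P2 \<mu>'"
abbreviation "Q \<equiv> second_class G K"

definition start :: "config \<Rightarrow> config \<times> config" where
  "start \<omega> = (heights \<omega>, heights (bump \<omega> 0 1))"

lemma measurable_start: "start \<in> config_space \<rightarrow>\<^sub>M config_pairs"
  unfolding start_def by (intro measurable_Pair measurable_heights measurable_compose[OF measurable_bump measurable_heights])

lemma sets_modified: "sets \<mu>' = sets config_space"
  unfolding modified_measure_resample by simp

lemma
  shows sets_P2: "sets (P2 x) = sets F2" and prob_space_P2: "prob_space (P2 x)"
  using measurable_space[OF coup.kernel, of x] by (simp_all add: space_prob_algebra space_pair_measure)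

lemma measurable_start_kernel: "(\<lambda>\<omega>. P2 (start \<omega>)) \<in> \<mu>' \<rightarrow>\<^sub>M prob_algebra F2"
  using measurable_compose[OF measurable_start coup.kernel] by (subst measurable_cong_sets[OF sets_modified refl])

lemma space_modified: "space \<mu>' = UNIV"
  using sets_eq_imp_space_eq[OF sets_modified] by simp

lemma M'_eq: "M' = \<mu>' \<bind> (\<lambda>\<omega>. P2 (start \<omega>))"
proof -
  have "start \<in> \<mu>' \<rightarrow>\<^sub>M config_pairs"
    using measurable_start by (subst measurable_cong_sets[OF sets_modified refl])
  from bind_distr[OF this measurable_prob_algebraD[OF coup.kernel]]
  show ?thesis unfolding started_pair_def by (simp add: space_modified start_def[abs_def])
qed

sublocale \<mu>': prob_space \<mu>'
  unfolding modified_product_measure_def by (intro prob_space_PiM) (auto simp: prob_space_origin prob_space_site)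

sublocale M': prob_space M'
  unfolding M'_eq by (rule \<mu>'.prob_space_bind[OF _ measurable_prob_algebraD[OF measurable_start_kernel]])
    (simp add: prob_space_P2)

lemma sets_M': "sets M' = sets F2"
  unfolding M'_eq by (rule sets_bind) (auto simp: sets_P2 space_modified)

lemma
  assumes "sets N = sets F2" "0 \<le> t"
  shows measurable_G: "G t \<in> N \<rightarrow>\<^sub>M config_space" and measurable_K: "K t \<in> N \<rightarrow>\<^sub>M config_space"
proof -
  have "G t \<in> F2 \<rightarrow>\<^sub>M config_space" "K t \<in> F2 \<rightarrow>\<^sub>M config_space"
    using measurable_compose[OF coup.random_variable[OF assms(2)] measurable_fst]
      measurable_compose[OF coup.random_variable[OF assms(2)] measurable_snd] by simp_all
  then show "G t \<in> N \<rightarrow>\<^sub>M config_space" "K t \<in> N \<rightarrow>\<^sub>M config_space"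
    by (simp_all only: measurable_cong_sets[OF assms(1) refl])
qed

lemma second_class_eq: "incr (K t w) = bump (incr (G t w)) i 1 \<Longrightarrow> Q t w = i"
  unfolding second_class_def by (rule the_equality) (auto dest: bump_inj)

text \<open>Where no single discrepancy exists, the definite description takes one fixed value, so
  the position is measurable on the whole sample space.\<close>

lemma measurable_second_class:
  assumes t: "0 \<le> t"
  shows "Q t \<in> F2 \<rightarrow>\<^sub>M count_space UNIV"
proof -
  let ?D = "\<lambda>i. {w \<in> space F2. incr (K t w) = bump (incr (G t w)) i 1}"
  define u :: int where "u = (THE i. False)"
  have D: "?D i \<in> sets F2" for i
  proof -
    have Gi: "(\<lambda>w. bump (incr (G t w)) i 1) \<in> F2 \<rightarrow>\<^sub>M config_space"
      by (rule measurable_compose[OF measurable_compose[OF measurable_G[OF refl t] measurable_incr] measurable_bump])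
    have Ki: "(\<lambda>w. incr (K t w)) \<in> F2 \<rightarrow>\<^sub>M config_space"
      by (rule measurable_compose[OF measurable_K[OF refl t] measurable_incr])
    have "{w \<in> space F2. incr (K t w) j = bump (incr (G t w)) i 1 j} \<in> sets F2" for j
    proof -
      have "(\<lambda>w. incr (K t w) j - bump (incr (G t w)) i 1 j) \<in> F2 \<rightarrow>\<^sub>M count_space UNIV"
        by (intro measurable_countable_binop[where k="(-)"] measurable_coordinate_compose[OF Ki] measurable_coordinate_compose[OF Gi]) simp
      then have "(\<lambda>w. incr (K t w) j - bump (incr (G t w)) i 1 j) -` {0} \<inter> space F2 \<in> sets F2"
        by (rule measurable_sets) simp
      then show ?thesis by (rule back_subst[of "\<lambda>A. A \<in> sets F2"]) auto
    qed
    then have "{w \<in> space F2. \<forall>j. incr (K t w) j = bump (incr (G t w)) i 1 j} \<in> sets F2"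
      by (rule sets.sets_Collect_countable_All)
    then show ?thesis by (simp only: fun_eq_iff)
  qed
  have no: "Q t w = u" if "\<not> (\<exists>i. incr (K t w) = bump (incr (G t w)) i 1)" for w
    using that unfolding second_class_def u_def by simp
  have "Q t -` {i} \<inter> space F2 = ?D i \<union> (if i = u then space F2 - (\<Union>j. ?D j) else {})" for i
  proof (rule set_eqI)
    fix w
    show "w \<in> Q t -` {i} \<inter> space F2 \<longleftrightarrow> w \<in> ?D i \<union> (if i = u then space F2 - (\<Union>j. ?D j) else {})"
    proof (cases "\<exists>j. incr (K t w) = bump (incr (G t w)) j 1")
      case True
      then obtain j where j: "incr (K t w) = bump (incr (G t w)) j 1" by blast
      from second_class_eq[OF this] have "Q t w = j" .
      with j show ?thesis by (auto dest: bump_inj)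
    next
      case False
      then show ?thesis using no[OF False] by auto
    qed
  qed
  moreover have "?D i \<union> (if i = u then space F2 - (\<Union>j. ?D j) else {}) \<in> sets F2" for i
  proof -
    have "(\<Union>j. ?D j) \<in> sets F2" using D by (intro sets.countable_UN image_subsetI)
    then have "space F2 - (\<Union>j. ?D j) \<in> sets F2" by (intro sets.Diff sets.top)
    then have "(if i = u then space F2 - (\<Union>j. ?D j) else {}) \<in> sets F2"
      by (cases "i = u") (simp_all only: simp_thms if_True if_False sets.empty_sets)
    with D show ?thesis by (rule sets.Un)
  qed
  ultimately have "Q t -` {i} \<inter> space F2 \<in> sets F2" for i by (simp only:)
  then have "Q t \<in> space F2 \<rightarrow> UNIV \<and> (\<forall>i\<in>UNIV. Q t -` {i} \<inter> space F2 \<in> sets F2)"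
    by (intro conjI ballI Pi_I UNIV_I)
  then show ?thesis by (rule measurable_count_space_eq2_countable[THEN iffD2])
qed

lemma measurable_position:
  fixes h :: "int \<Rightarrow> real"
  assumes "sets N = sets F2" "0 \<le> t"
  shows "(\<lambda>w. h (Q t w)) \<in> borel_measurable N"
proof -
  have "(\<lambda>w. h (Q t w)) \<in> borel_measurable F2"
    by (rule measurable_compose[OF measurable_second_class[OF assms(2)]]) simp
  then show ?thesis by (simp only: measurable_cong_sets[OF assms(1) refl])
qed

text \<open>Adding a particle at the origin changes the expected number of particles at \<open>j\<close> by the
  probability that the second class particle sits there.\<close>

lemma discrepancy_expectation:
  assumes t: "0 \<le> t" and T: "\<omega> \<in> T" "bump \<omega> 0 1 \<in> T"
    and int: "integrable (P (heights \<omega>)) (\<lambda>w. occ t j w)"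
      "integrable (P (heights (bump \<omega> 0 1))) (\<lambda>w. occ t j w)"
  shows "(LINT w|P (heights (bump \<omega> 0 1)). occ t j w) - (LINT w|P (heights \<omega>). occ t j w) =
    (LINT w|P2 (start \<omega>). of_bool (Q t w = j))"
proof -
  let ?\<omega>' = "bump \<omega> 0 1"
  have le: "\<forall>i. incr (heights \<omega>) i \<le> incr (heights ?\<omega>') i" by (simp add: incr_heights bump_def)
  have T': "incr (heights \<omega>) \<in> T" "incr (heights ?\<omega>') \<in> T" using T by (simp_all add: incr_heights)
  note c = copies[OF T' le]
  have \<Phi>: "(\<lambda>x. real_of_int (incr (snd x) j)) \<in> borel_measurable config_pairs"
    by (rule measurable_compose[OF measurable_coordinate_compose[OF measurable_compose[OF measurable_snd measurable_incr]]]) simp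
  have dG: "distr (P2 (start \<omega>)) borel (\<lambda>w. real_of_int (incr (G t w) j)) = distr (P (heights \<omega>)) borel (\<lambda>w. occ t j w)"
    using path_law_distr[of _ _ G _ H, OF conjunct1[OF c] measurable_G[OF sets_P2] measurable_H[OF sets_P] \<Phi> t] by (simp add: start_def)
  have dK: "distr (P2 (start \<omega>)) borel (\<lambda>w. real_of_int (incr (K t w) j)) = distr (P (heights ?\<omega>')) borel (\<lambda>w. occ t j w)"
    using path_law_distr[of _ _ K _ H, OF conjunct2[OF c] measurable_K[OF sets_P2] measurable_H[OF sets_P] \<Phi> t] by (simp add: start_def)
  note mH = measurable_real_incr[OF measurable_H[OF sets_P t], of j] and mG = measurable_real_incr[OF measurable_G[OF sets_P2 t], of j]
    and mK = measurable_real_incr[OF measurable_K[OF sets_P2 t], of j]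
  have iG: "integrable (P2 (start \<omega>)) (\<lambda>w. real_of_int (incr (G t w) j))"
    using int(1) integrable_distr_eq[OF mG[of "start \<omega>"], of "\<lambda>x. x"] integrable_distr_eq[OF mH[of "heights \<omega>"], of "\<lambda>x. x"] dG by simp
  have iK: "integrable (P2 (start \<omega>)) (\<lambda>w. real_of_int (incr (K t w) j))"
    using int(2) integrable_distr_eq[OF mK[of "start \<omega>"], of "\<lambda>x. x"] integrable_distr_eq[OF mH[of "heights ?\<omega>'"], of "\<lambda>x. x"] dK by simp
  have eG: "(LINT w|P2 (start \<omega>). real_of_int (incr (G t w) j)) = (LINT w|P (heights \<omega>). occ t j w)"
    using integral_distr[OF mG[of "start \<omega>"], of "\<lambda>x. x"] integral_distr[OF mH[of "heights \<omega>"], of "\<lambda>x. x"] dG by simp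
  have eK: "(LINT w|P2 (start \<omega>). real_of_int (incr (K t w) j)) = (LINT w|P (heights ?\<omega>'). occ t j w)"
    using integral_distr[OF mK[of "start \<omega>"], of "\<lambda>x. x"] integral_distr[OF mH[of "heights ?\<omega>'"], of "\<lambda>x. x"] dK by simp
  have "AE w in P2 (start \<omega>). \<forall>t\<ge>0. \<exists>i. incr (K t w) = bump (incr (G t w)) i 1"
    unfolding start_def by (rule single_discrepancy[OF T', of 0]) (simp add: incr_heights)
  then have ae: "AE w in P2 (start \<omega>). real_of_int (incr (K t w) j) - real_of_int (incr (G t w) j) = of_bool (Q t w = j)"
  proof eventually_elim
    fix w assume "\<forall>t\<ge>0. \<exists>i. incr (K t w) = bump (incr (G t w)) i 1"
    then obtain i where i: "incr (K t w) = bump (incr (G t w)) i 1" using t by blast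
    from second_class_eq[OF i] show "real_of_int (incr (K t w) j) - real_of_int (incr (G t w) j) = of_bool (Q t w = j)"
      by (auto simp: i bump_def)
  qed
  have mQ: "(\<lambda>w. of_bool (Q t w = j) :: real) \<in> borel_measurable (P2 (start \<omega>))"
    by (rule measurable_position[OF sets_P2 t])
  have "(LINT w|P2 (start \<omega>). of_bool (Q t w = j)) = (LINT w|P2 (start \<omega>). real_of_int (incr (K t w) j) - real_of_int (incr (G t w) j))"
    using ae by (intro integral_cong_AE mQ borel_measurable_diff mG mK) auto
  also have "\<dots> = (LINT w|P2 (start \<omega>). real_of_int (incr (K t w) j)) - (LINT w|P2 (start \<omega>). real_of_int (incr (G t w) j))"
    by (rule Bochner_Integration.integral_diff[OF iK iG])
  finally show ?thesis unfolding eG eK by simp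
qed

text \<open>Every value in \<open>I\<close> has positive mass, so an almost sure property survives conditioning on the value
  at the origin.\<close>

lemma AE_resampled:
  assumes "AE \<omega> in \<mu>. R \<omega>" and z: "z \<in> I"
  shows "AE X in rest. R (X(0 := z))"
proof -
  interpret pair_prob_space site rest ..
  have m: "(\<lambda>(z, X). X(0 := z)) \<in> site \<Otimes>\<^sub>M rest \<rightarrow>\<^sub>M config_space"
    by (rule measurable_update_origin_pair) simp
  have "AE x in site \<Otimes>\<^sub>M rest. R ((\<lambda>(z, X). X(0 := z)) x)"
    using assms(1) unfolding product_measure_resample by (rule AE_distrD[OF m])
  then have "AE z in site. AE X in rest. R ((\<lambda>(z, X). X(0 := z)) (z, X))" by (rule AE_pair)
  from AE_siteD[OF this z] show ?thesis by simp
qed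

lemma integrable_site_stationary:
  fixes h :: "int \<Rightarrow> real"
  assumes "0 \<le> t"
  shows "integrable M (\<lambda>w. h (incr (H t w) i)) \<longleftrightarrow> integrable site h"
    and "(LINT w|M. h (incr (H t w) i)) = (LINT z|site. h z)"
proof -
  have m: "(\<lambda>\<omega>. h (\<omega> i)) \<in> borel_measurable config_space"
    by (rule measurable_compose[OF measurable_config_coordinate]) simp
  show "integrable M (\<lambda>w. h (incr (H t w) i)) \<longleftrightarrow> integrable site h"
    using integrable_stationary[OF assms m] by (simp add: integrable_coordinate_iff)
  show "(LINT w|M. h (incr (H t w) i)) = (LINT z|site. h z)"
    using integral_stationary[OF assms m] by (simp add: integral_coordinate)
qed

lemma measurable_site_fun:
  fixes h :: "int \<Rightarrow> real"
  assumes "sets N = sets F" "0 \<le> t"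
  shows "(\<lambda>w. h (incr (H t w) i)) \<in> borel_measurable N"
  by (rule measurable_compose[OF measurable_coordinate_compose[OF measurable_incr_H[OF assms]]]) simp

lemma
  assumes "0 \<le> s"
  shows measurable_occ_centred: "(\<lambda>w. occ s i w - mean) \<in> borel_measurable M"
    and integrable_occ_centred_sq: "integrable M (\<lambda>w. (occ s i w - mean)\<^sup>2)"
    and integrable_occ_centred: "integrable M (\<lambda>w. occ s i w - mean)"
    and mean_occ_centred: "(LINT w|M. occ s i w - mean) = 0"
proof -
  show "(\<lambda>w. occ s i w - mean) \<in> borel_measurable M"
    by (rule measurable_site_fun[OF sets_M assms, of "\<lambda>z. real_of_int z - mean"])
  show "integrable M (\<lambda>w. (occ s i w - mean)\<^sup>2)"
    using integrable_site_stationary(1)[OF assms, of "\<lambda>z. (real_of_int z - mean)\<^sup>2" i] integrable_site_centred_sq by blast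
  show "integrable M (\<lambda>w. occ s i w - mean)" "(LINT w|M. occ s i w - mean) = 0"
    using integrable_site_stationary[OF assms, of "\<lambda>z. real_of_int z - mean" i] integrable_site_id
    by (simp_all add: site.prob_space[simplified])
qed

lemma integrable_occ_product:
  assumes "0 \<le> s" "0 \<le> r"
  shows "integrable M (\<lambda>w. (occ s i w - mean) * (occ r k w - mean))"
  by (intro integrable_product_of_squares measurable_occ_centred integrable_occ_centred_sq assms)

definition expected_occ :: "real \<Rightarrow> int \<Rightarrow> config \<Rightarrow> real" where
  "expected_occ t j \<omega> = (LINT w|P (heights \<omega>). occ t j w)"

definition landing_prob :: "real \<Rightarrow> int \<Rightarrow> config \<Rightarrow> real" where
  "landing_prob t j \<omega> = (LINT w|P2 (start \<omega>). of_bool (Q t w = j))"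

lemma
  assumes t: "0 \<le> t"
  shows integrable_expected_occ: "integrable \<mu> (expected_occ t j)"
    and AE_integrable_occ: "AE \<omega> in \<mu>. integrable (P (heights \<omega>)) (\<lambda>w. occ t j w)"
    and measurable_expected_occ: "expected_occ t j \<in> borel_measurable config_space"
proof -
  have m: "(\<lambda>w. occ t j w) \<in> borel_measurable F" by (rule measurable_site_fun[OF refl t])
  have "integrable M (\<lambda>w. occ t j w)"
    using integrable_site_stationary(1)[OF t] integrable_site_id by blast
  then show int: "integrable \<mu> (expected_occ t j)" and "AE \<omega> in \<mu>. integrable (P (heights \<omega>)) (\<lambda>w. occ t j w)"
    using integrable_bind[OF measurable_started_kernel m] AE_integrable_bind[OF measurable_started_kernel m]
    unfolding M_eq expected_occ_def by blast+
  show "expected_occ t j \<in> borel_measurable config_space"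
    using borel_measurable_integrable[OF int] by (simp add: borel_\<mu>)
qed

lemma
  assumes t: "0 \<le> t"
  shows measurable_landing_prob: "landing_prob t j \<in> borel_measurable config_space"
    and landing_prob_bounds: "0 \<le> landing_prob t j \<omega>" "landing_prob t j \<omega> \<le> 1"
proof -
  have "(\<lambda>w. of_bool (Q t w = j) :: real) \<in> borel_measurable F2"
    by (rule measurable_position[OF refl t])
  from measurable_compose[OF measurable_compose[OF measurable_start measurable_prob_algebraD[OF coup.kernel]]
      integral_measurable_subprob_algebra[OF this]]
  show "landing_prob t j \<in> borel_measurable config_space" unfolding landing_prob_def .
  interpret prob_space "P2 (start \<omega>)" by (rule prob_space_P2)
  show "0 \<le> landing_prob t j \<omega>" unfolding landing_prob_def by simp
  have "(\<lambda>w. of_bool (Q t w = j) :: real) \<in> borel_measurable (P2 (start \<omega>))"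
    by (rule measurable_position[OF sets_P2 t])
  then have "integrable (P2 (start \<omega>)) (\<lambda>w. of_bool (Q t w = j) :: real)"
    by (rule integrable_const_bound[of _ 1, rotated]) (rule AE_I2, simp)
  then have "landing_prob t j \<omega> \<le> (LINT w|P2 (start \<omega>). 1)"
    unfolding landing_prob_def by (intro integral_mono) auto
  then show "landing_prob t j \<omega> \<le> 1" by (simp add: prob_space[simplified])
qed

lemma integrable_landing_prob_rest:
  "0 \<le> t \<Longrightarrow> integrable rest (\<lambda>X. landing_prob t j (X(0 := y)))"
  by (rule rest.integrable_const_bound[of _ 1, OF _ measurable_compose[OF measurable_update_origin measurable_landing_prob]])
    (simp_all add: landing_prob_bounds)

lemma integrable_expected_occ_rest:
  assumes t: "0 \<le> t" and z: "z \<in> I"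
  shows "integrable rest (\<lambda>X. expected_occ t j (X(0 := z)))"
proof -
  interpret pair_prob_space site rest ..
  have upd: "(\<lambda>(z, X). X(0 := z)) \<in> site \<Otimes>\<^sub>M rest \<rightarrow>\<^sub>M config_space"
    by (rule measurable_update_origin_pair) simp
  have "integrable (site \<Otimes>\<^sub>M rest) (\<lambda>x. expected_occ t j ((\<lambda>(z, X). X(0 := z)) x))"
    using integrable_expected_occ[OF t] integrable_distr_eq[OF upd measurable_expected_occ[OF t]]
    unfolding product_measure_resample[symmetric] by simp
  then have "AE z in site. integrable rest (\<lambda>X. expected_occ t j (X(0 := z)))"
    using AE_integrable_fst'[of "\<lambda>x. expected_occ t j ((\<lambda>(z, X). X(0 := z)) x)"] by (simp only: split_conv)
  then show ?thesis using z by (rule AE_siteD)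
qed

lemma averaged_discrepancy:
  assumes t: "0 \<le> t" and y: "y \<in> I" "y + 1 \<in> I"
  shows "(LINT X|rest. expected_occ t j (X(0 := y + 1))) - (LINT X|rest. expected_occ t j (X(0 := y))) =
    (LINT X|rest. landing_prob t j (X(0 := y)))"
proof -
  note e = integrable_expected_occ_rest[OF t y(2), of j] integrable_expected_occ_rest[OF t y(1), of j]
  have "AE X in rest. expected_occ t j (X(0 := y + 1)) - expected_occ t j (X(0 := y)) = landing_prob t j (X(0 := y))"
    using AE_resampled[OF AE_tempered y(1)] AE_resampled[OF AE_tempered y(2)]
      AE_resampled[OF AE_integrable_occ[OF t, of j] y(1)] AE_resampled[OF AE_integrable_occ[OF t, of j] y(2)]
  proof eventually_elim
    case (elim X)
    have b: "bump (X(0 := y)) 0 1 = X(0 := y + 1)" by (simp add: bump_def)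
    from discrepancy_expectation[OF t elim(1), unfolded b, OF elim(2-4)]
    show ?case unfolding expected_occ_def landing_prob_def .
  qed
  then have "(LINT X|rest. expected_occ t j (X(0 := y + 1)) - expected_occ t j (X(0 := y))) =
      (LINT X|rest. landing_prob t j (X(0 := y)))"
    by (rule integral_cong_AE[OF borel_measurable_integrable[OF Bochner_Integration.integrable_diff[OF e]]
        borel_measurable_integrable[OF integrable_landing_prob_rest[OF t]]])
  then show ?thesis unfolding Bochner_Integration.integral_diff[OF e] .
qed

text \<open>Disintegration with respect to the initial value at the origin, on which the second factor
  depends; being centred, that factor makes the centring of the first one immaterial.\<close>

lemma covariance_conditioned_on_start:
  assumes t: "0 \<le> t"
  shows "(LINT w|M. (occ t j w - mean) * (occ 0 0 w - mean)) =
    (\<Sum>\<^sub>\<infinity>z. gmass z * (LINT X|rest. expected_occ t j (X(0 := z))))"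
proof -
  let ?e = "expected_occ t j"
  interpret sr: pair_prob_space site rest ..
  have s0: "(0::real) \<le> 0" by simp
  define g where "g w = occ t j w * (occ 0 0 w - mean)" for w
  have g_fun: "g = (\<lambda>w. (occ t j w - mean) * (occ 0 0 w - mean) + mean * (occ 0 0 w - mean))"
    by (simp add: fun_eq_iff g_def algebra_simps)
  have prod: "integrable M (\<lambda>w. (occ t j w - mean) * (occ 0 0 w - mean))"
    by (rule integrable_occ_product[OF t s0])
  have gi: "integrable M g"
    by (subst g_fun) (intro Bochner_Integration.integrable_add prod integrable_mult_right integrable_occ_centred s0)
  have "(LINT w|M. g w) = (LINT w|M. (occ t j w - mean) * (occ 0 0 w - mean)) + (LINT w|M. mean * (occ 0 0 w - mean))"
    unfolding g_fun by (rule Bochner_Integration.integral_add[OF prod integrable_mult_right[OF integrable_occ_centred[OF s0]]])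
  then have lhs: "(LINT w|M. (occ t j w - mean) * (occ 0 0 w - mean)) = (LINT w|M. g w)"
    by (simp only: mean_occ_centred[OF s0] integral_mult_right_zero mult_zero_right add_0_right)
  have gm: "g \<in> borel_measurable F"
    unfolding g_def
    by (intro borel_measurable_times measurable_site_fun[OF refl t] measurable_site_fun[OF refl s0, of "\<lambda>z. real_of_int z - mean"])
  have gP: "AE \<omega> in \<mu>. (LINT w|P (heights \<omega>). g w) = (real_of_int (\<omega> 0) - mean) * ?e \<omega>"
    using AE_tempered
  proof eventually_elim
    fix \<omega> assume \<omega>: "\<omega> \<in> T"
    then have E: "heights \<omega> \<in> {h. incr h \<in> T}" by (simp add: incr_heights)
    have "(LINT w|P (heights \<omega>). g w) = (LINT w|P (heights \<omega>). (real_of_int (\<omega> 0) - mean) * occ t j w)"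
    proof (rule integral_cong_AE)
      show "g \<in> borel_measurable (P (heights \<omega>))" using gm by (simp only: measurable_F_eq[OF sets_P])
      show "(\<lambda>w. (real_of_int (\<omega> 0) - mean) * occ t j w) \<in> borel_measurable (P (heights \<omega>))"
        by (intro borel_measurable_times borel_measurable_const measurable_site_fun[OF sets_P t])
      show "AE w in P (heights \<omega>). g w = (real_of_int (\<omega> 0) - mean) * occ t j w"
        using proc.initial[OF E] by eventually_elim (simp add: g_def incr_heights mult.commute)
    qed
    then show "(LINT w|P (heights \<omega>). g w) = (real_of_int (\<omega> 0) - mean) * ?e \<omega>" by (simp add: expected_occ_def)
  qed
  have ge_m: "(\<lambda>\<omega>. (real_of_int (\<omega> 0) - mean) * ?e \<omega>) \<in> borel_measurable config_space"
    by (intro borel_measurable_times measurable_expected_occ[OF t] measurable_compose[OF measurable_config_coordinate, of "\<lambda>z. real_of_int z - mean"]) simp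
  have gb: "integrable \<mu> (\<lambda>\<omega>. LINT w|P (heights \<omega>). g w)" "(LINT w|M. g w) = (LINT \<omega>|\<mu>. LINT w|P (heights \<omega>). g w)"
    using integrable_bind[OF measurable_started_kernel gm] integral_bind[OF measurable_started_kernel gm] gi
    unfolding M_eq by blast+
  have ge_int: "integrable \<mu> (\<lambda>\<omega>. (real_of_int (\<omega> 0) - mean) * ?e \<omega>)"
    by (rule integrable_cong_AE[THEN iffD1, OF borel_measurable_integrable[OF gb(1)] _ gP gb(1)]) (simp only: borel_\<mu> ge_m)
  have upd: "(\<lambda>(z, X). X(0 := z)) \<in> site \<Otimes>\<^sub>M rest \<rightarrow>\<^sub>M config_space"
    by (rule measurable_update_origin_pair) simp
  have i: "integrable (site \<Otimes>\<^sub>M rest) (\<lambda>x. (real_of_int (fst x) - mean) * ?e ((snd x)(0 := fst x)))"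
    using ge_int integrable_distr_eq[OF upd ge_m] unfolding product_measure_resample[symmetric] by (simp add: case_prod_unfold)
  have fub: "(LINT x|(site \<Otimes>\<^sub>M rest). (real_of_int (fst x) - mean) * ?e ((snd x)(0 := fst x))) =
      (LINT z|site. LINT X|rest. (real_of_int z - mean) * ?e (X(0 := z)))"
    using sr.integral_fst'[OF i] by simp
  have ps: "integrable site (\<lambda>z. LINT X|rest. (real_of_int z - mean) * ?e (X(0 := z)))"
    using sr.integrable_fst'[OF i] by simp
  have "(LINT w|M. g w) = (LINT \<omega>|\<mu>. (real_of_int (\<omega> 0) - mean) * ?e \<omega>)"
    unfolding gb(2) by (rule integral_cong_AE[OF borel_measurable_integrable[OF gb(1)] borel_measurable_integrable[OF ge_int] gP])
  also have "\<dots> = (LINT x|(site \<Otimes>\<^sub>M rest). (\<lambda>\<omega>. (real_of_int (\<omega> 0) - mean) * ?e \<omega>) ((\<lambda>(z, X). X(0 := z)) x))"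
    by (subst product_measure_resample) (rule integral_distr[OF upd ge_m])
  also have "\<dots> = (LINT x|(site \<Otimes>\<^sub>M rest). (real_of_int (fst x) - mean) * ?e ((snd x)(0 := fst x)))"
    by (rule Bochner_Integration.integral_cong) auto
  also have "\<dots> = (LINT z|site. (real_of_int z - mean) * (LINT X|rest. ?e (X(0 := z))))"
    unfolding fub by simp
  also have "\<dots> = (\<Sum>\<^sub>\<infinity>z. gmass z * (LINT X|rest. ?e (X(0 := z))))"
    using ps by (subst integral_site) (simp_all add: integrable_site_iff mult_ac)
  finally show ?thesis unfolding lhs .
qed

lemma position_prob_by_start:
  assumes t: "0 \<le> t"
  shows "(LINT w|M'. of_bool (Q t w = j)) = (LINT y|origin. LINT X|rest. landing_prob t j (X(0 := y)))"
proof -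
  interpret origin: prob_space origin by (rule prob_space_origin)
  interpret orr: pair_prob_space origin rest ..
  have upd: "(\<lambda>(z, X). X(0 := z)) \<in> origin \<Otimes>\<^sub>M rest \<rightarrow>\<^sub>M config_space"
    by (rule measurable_update_origin_pair) simp
  have m: "(\<lambda>w. of_bool (Q t w = j) :: real) \<in> borel_measurable F2"
    by (rule measurable_position[OF refl t])
  have "integrable M' (\<lambda>w. of_bool (Q t w = j) :: real)"
    by (rule M'.integrable_const_bound[of _ 1, OF _ measurable_position[OF sets_M' t]]) (rule AE_I2, simp)
  then have "(LINT w|M'. of_bool (Q t w = j)) = (LINT \<omega>|\<mu>'. landing_prob t j \<omega>)"
    unfolding landing_prob_def M'_eq using integral_bind[OF measurable_start_kernel m] by simp
  also have "\<dots> = (LINT x|(origin \<Otimes>\<^sub>M rest). landing_prob t j ((\<lambda>(z, X). X(0 := z)) x))"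
    unfolding modified_measure_resample by (rule integral_distr[OF upd measurable_landing_prob[OF t]])
  also have "\<dots> = (LINT y|origin. LINT X|rest. landing_prob t j ((\<lambda>(z, X). X(0 := z)) (y, X)))"
  proof (rule orr.integral_fst'[symmetric])
    show "integrable (origin \<Otimes>\<^sub>M rest) (\<lambda>x. landing_prob t j ((\<lambda>(z, X). X(0 := z)) x))"
      by (rule orr.P.integrable_const_bound[of _ 1, OF _ measurable_compose[OF upd measurable_landing_prob[OF t]]])
        (rule AE_I2, simp add: landing_prob_bounds[OF t])
  qed
  finally show ?thesis by simp
qed

text \<open>Summation by parts moves the increment to the conditional expectation, where the coupling
  identifies it with the law of the second class particle; what remains of the centred weights are
  their tails, that is, the modified law of the origin.\<close>

lemma two_point_at_origin:
  assumes t: "0 \<le> t"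
  shows "(LINT w|M. (occ t j w - mean) * (occ 0 0 w - mean)) = site_var I f \<theta> * (LINT w|M'. of_bool (Q t w = j))"
proof -
  define b where "b z = (LINT X|rest. expected_occ t j (X(0 := z)))" for z
  define \<Delta> where "\<Delta> y = (LINT X|rest. landing_prob t j (X(0 := y)))" for y
  have step: "b (y + 1) - b y = \<Delta> y" if "y \<in> I" "y + 1 \<in> I" for y
    unfolding b_def \<Delta>_def by (rule averaged_discrepancy[OF t that])
  have \<Delta>1: "\<bar>\<Delta> y\<bar> \<le> 1" for y
  proof -
    have "0 \<le> \<Delta> y" unfolding \<Delta>_def using landing_prob_bounds(1)[OF t] by simp
    moreover have "\<Delta> y \<le> (LINT X|rest. 1)"
      unfolding \<Delta>_def using integrable_landing_prob_rest[OF t] landing_prob_bounds(2)[OF t] by (intro integral_mono) auto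
    ultimately show ?thesis by (simp add: rest.prob_space[simplified])
  qed
  note parts = summation_by_parts[of b \<Delta>, OF step \<Delta>1]
  have "(LINT w|M. (occ t j w - mean) * (occ 0 0 w - mean)) = (\<Sum>\<^sub>\<infinity>z. gmass z * b z)"
    unfolding b_def by (rule covariance_conditioned_on_start[OF t])
  also have "\<dots> = (\<Sum>\<^sub>\<infinity>y. tail y * \<Delta> y)" by (rule parts(2))
  also have "\<dots> = site_var I f \<theta> * (LINT y|origin. \<Delta> y)" by (rule integral_origin[OF parts(1), symmetric])
  finally show ?thesis unfolding \<Delta>_def position_prob_by_start[OF t] .
qed

lemma two_point:
  assumes t: "0 \<le> t"
  shows "(LINT w|M. (occ t i w - mean) * (occ 0 k w - mean)) =
    site_var I f \<theta> * (LINT w|M'. of_bool (Q t w = i - k))"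
proof -
  define \<Phi> where "\<Phi> x = (real_of_int (incr (snd x) (i - k)) - mean) * (real_of_int (incr (fst x) 0) - mean)" for x :: "config \<times> config"
  have \<Phi>m: "\<Phi> \<in> borel_measurable config_pairs"
  proof -
    have 1: "(\<lambda>x. real_of_int (incr (snd x) (i - k)) - mean) \<in> borel_measurable config_pairs"
      by (rule measurable_compose[OF measurable_coordinate_compose[OF measurable_compose[OF measurable_snd measurable_incr]]]) simp
    have 2: "(\<lambda>x. real_of_int (incr (fst x) 0) - mean) \<in> borel_measurable config_pairs"
      by (rule measurable_compose[OF measurable_coordinate_compose[OF measurable_compose[OF measurable_fst measurable_incr]]]) simp
    show ?thesis unfolding \<Phi>_def by (rule borel_measurable_times[OF 1 2])
  qed
  have inv: "\<Phi> (\<lambda>i. g i + c, \<lambda>i. h i + c) = \<Phi> (g, h)" for g h c by (simp add: \<Phi>_def incr_def)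
  have m1: "(\<lambda>w. \<Phi> (H 0 w, H t w)) \<in> borel_measurable M"
    by (rule measurable_compose[OF _ \<Phi>m]) (use t in \<open>intro measurable_Pair measurable_H sets_M; simp\<close>)
  have m2: "(\<lambda>w. \<Phi> (\<lambda>i. H 0 w (i + k), \<lambda>i. H t w (i + k))) \<in> borel_measurable M"
  proof (rule measurable_compose[OF _ \<Phi>m])
    have s0: "0 \<le> (0::real)" by simp
    show "(\<lambda>w. (\<lambda>i. H 0 w (i + k), \<lambda>i. H t w (i + k))) \<in> M \<rightarrow>\<^sub>M config_pairs"
      by (intro measurable_Pair measurable_compose[OF measurable_H[OF sets_M t] measurable_shift0] measurable_compose[OF measurable_H[OF sets_M s0] measurable_shift0])
  qed
  have "(LINT w|M. (occ t i w - mean) * (occ 0 k w - mean)) =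
      (LINT w|M. \<Phi> (\<lambda>i. H 0 w (i + k), \<lambda>i. H t w (i + k)))"
    by (rule Bochner_Integration.integral_cong) (simp_all add: \<Phi>_def incr_def algebra_simps)
  also have "\<dots> = (LINT w|M. \<Phi> (H 0 w, H t w))"
    using integral_distr[OF m1, of "\<lambda>x. x"] integral_distr[OF m2, of "\<lambda>x. x"] distr_translate[OF \<Phi>m inv t, of k] by simp
  also have "\<dots> = site_var I f \<theta> * (LINT w|M'. of_bool (Q t w = i - k))"
    unfolding \<Phi>_def using two_point_at_origin[OF t, of "i - k"] by simp
  finally show ?thesis .
qed

end

section \<open>Fluctuations of the current\<close>

text \<open>The sign \<open>s\<close> and the set of sites \<open>B\<close> treat both signs of \<open>m\<close> at once.\<close>

lemma height_difference:
  obtains B :: "int set" and s :: real where "finite B" "\<bar>s\<bar> = 1"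
    "\<And>h n. real_of_int (h (m + n) - h n) = s * (\<Sum>k\<in>B. real_of_int (incr h (k + n)))"
proof -
  have *: "h (m + n) - h n = heights (\<lambda>i. incr h (i + n)) m" for h n
  proof -
    have "incr (\<lambda>i. h (i + n)) = (\<lambda>i. incr h (i + n))" by (auto simp: incr_def algebra_simps)
    then show ?thesis using heights_incr[of "\<lambda>i. h (i + n)" m] by simp
  qed
  show thesis
  proof (cases "0 \<le> m")
    case True
    show thesis
      by (rule that[of "{1..m}" "-1"]) (use True in \<open>simp_all add: * heights_def\<close>)
  next
    case False
    show thesis
      by (rule that[of "{m+1..0}" 1]) (use False in \<open>simp_all add: * heights_def\<close>)
  qed
qed

lemma increments_telescope: "h m - h (m + int n) = (\<Sum>i\<in>{1..n}. incr h (m + int i))"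
  by (induction n) (auto simp: incr_def algebra_simps)

lemma count_pairs_with_difference:
  "(\<Sum>i\<in>{1..n}. \<Sum>k\<in>{1..n}. of_bool (x = int i - int k)) = real n - min (real n) \<bar>real_of_int x\<bar>"
proof -
  have inner: "(\<Sum>i\<in>{1..n}. of_bool (x = int i - int k) :: real) = of_bool (1 \<le> int k + x \<and> int k + x \<le> int n)" for k
  proof -
    have "(\<Sum>i\<in>{1..n}. of_bool (x = int i - int k) :: real) = (\<Sum>i\<in>{1..n}. if i = nat (int k + x) then of_bool (1 \<le> int k + x) else 0)"
      by (rule sum.cong) auto
    then show ?thesis by (auto simp: nat_le_iff)
  qed
  have "(\<Sum>i\<in>{1..n}. \<Sum>k\<in>{1..n}. of_bool (x = int i - int k)) = (\<Sum>k\<in>{1..n}. of_bool (1 \<le> int k + x \<and> int k + x \<le> int n) :: real)"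
    by (subst sum.swap) (simp only: inner)
  also have "\<dots> = (\<Sum>k\<in>int ` {1..n}. of_bool (1 \<le> k + x \<and> k + x \<le> int n))"
    by (subst sum.reindex) (simp_all add: o_def)
  also have "int ` {1..n} = {1..int n}" by (simp add: image_int_atLeastAtMost)
  also have "(\<Sum>k\<in>{1..int n}. of_bool (1 \<le> k + x \<and> k + x \<le> int n) :: real) = (\<Sum>k\<in>{max 1 (1 - x)..min (int n) (int n - x)}. 1)"
    by (rule sum.mono_neutral_cong_right) auto
  also have "\<dots> = real n - min (real n) \<bar>real_of_int x\<bar>"
    by (cases "0 \<le> x") (auto simp: min_def max_def of_nat_diff)
  finally show ?thesis .
qed

text \<open>By monotonicity \<open>x N\<close> is at most the average of \<open>x\<close> below \<open>N\<close> and at least its average between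
  \<open>N\<close> and \<open>N\<^sup>2\<close>; the partial sums force both to vanish.\<close>

lemma antimono_partial_sums_tendsto_0:
  fixes x :: "nat \<Rightarrow> real"
  assumes anti: "\<And>n k. n \<le> k \<Longrightarrow> x k \<le> x n"
    and sums: "\<And>N. \<bar>\<Sum>n<N. x n\<bar> \<le> c * sqrt (real N)"
  shows "x \<longlonglongrightarrow> 0"
proof (rule tendsto_sandwich)
  have upper: "x N \<le> c / sqrt (real N)" if "0 < N" for N
  proof -
    have "real N * x N = (\<Sum>n<N. x N)" by simp
    also have "\<dots> \<le> (\<Sum>n<N. x n)" by (intro sum_mono anti) auto
    also have "\<dots> \<le> c * sqrt (real N)" using sums[of N] by simp
    finally have "real N * x N \<le> c * sqrt (real N)" .
    moreover have "real N * x N = sqrt (real N) * (sqrt (real N) * x N)"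
      unfolding mult.assoc[symmetric] by simp
    ultimately have "sqrt (real N) * (sqrt (real N) * x N) \<le> sqrt (real N) * c"
      by (simp only: mult.commute[of c])
    then have "sqrt (real N) * x N \<le> c"
      using that by (subst (asm) mult_le_cancel_left_pos) simp_all
    then show ?thesis using that by (simp add: pos_le_divide_eq mult.commute)
  qed
  have lower: "- (c + x 0) / (real N - 1) \<le> x N" if "1 < N" for N
  proof -
    have NN: "N \<le> N\<^sup>2" by (simp add: power2_eq_square)
    have "- c * real N \<le> (\<Sum>n<N\<^sup>2. x n)" using sums[of "N\<^sup>2"] by (simp add: real_sqrt_power)
    also have "\<dots> = (\<Sum>n<N. x n) + (\<Sum>n\<in>{N..<N\<^sup>2}. x n)"
    proof -
      have "{..<N\<^sup>2} = {..<N} \<union> {N..<N\<^sup>2}" using NN by auto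
      moreover have "sum x ({..<N} \<union> {N..<N\<^sup>2}) = sum x {..<N} + sum x {N..<N\<^sup>2}"
        by (rule sum.union_disjoint) auto
      ultimately show ?thesis by (simp only:)
    qed
    also have "\<dots> \<le> (\<Sum>n<N. x 0) + (\<Sum>n\<in>{N..<N\<^sup>2}. x N)"
      by (intro add_mono sum_mono anti) auto
    also have "\<dots> = real N * x 0 + (real N * (real N - 1)) * x N"
      using NN by (simp add: of_nat_diff power2_eq_square algebra_simps)
    finally have "real N * (- c) \<le> real N * (x 0 + (real N - 1) * x N)" by (simp add: algebra_simps)
    then have "- c \<le> x 0 + (real N - 1) * x N" using that by (subst (asm) mult_le_cancel_left_pos) auto
    then show ?thesis using that by (simp add: pos_divide_le_eq mult.commute)
  qed
  show "\<forall>\<^sub>F N in sequentially. x N \<le> c / sqrt (real N)"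
    using eventually_gt_at_top[of 0] by eventually_elim (rule upper)
  show "\<forall>\<^sub>F N in sequentially. - (c + x 0) / (real N - 1) \<le> x N"
    using eventually_gt_at_top[of 1] by eventually_elim (rule lower)
  show "(\<lambda>N. c / sqrt (real N)) \<longlonglongrightarrow> 0" by real_asymp
  show "(\<lambda>N. - (c + x 0) / (real N - 1)) \<longlonglongrightarrow> 0" by real_asymp
qed

context stationary_coupling begin

text \<open>The current across the space-time line from \<open>(n, 0)\<close> to \<open>(m + n, t)\<close>.\<close>

definition flux :: "real \<Rightarrow> int \<Rightarrow> int \<Rightarrow> 'a \<Rightarrow> real" where
  "flux t m n w = real_of_int (H t w (m + n) - H 0 w n)"

lemma measurable_flux:
  assumes "0 \<le> t" shows "flux t m n \<in> borel_measurable M"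
proof -
  have "(\<lambda>w. H t w (m + n) - H 0 w n) \<in> M \<rightarrow>\<^sub>M count_space UNIV"
    using assms by (intro measurable_countable_binop[where k="(-)"] measurable_coordinate_compose[OF measurable_H[OF sets_M]]) simp_all
  then show ?thesis unfolding flux_def[abs_def] by (rule measurable_compose) simp
qed

lemma flux_split: "flux t m n w = real_of_int (dsp {m + n} t w) + real_of_int (H 0 w (m + n) - H 0 w n)"
  by (simp add: flux_def disp_def)

lemma integrable_height_difference_sq:
  assumes "0 \<le> t"
  shows "integrable M (\<lambda>w. (real_of_int (H t w (m + n) - H t w n))\<^sup>2)"
proof -
  obtain B :: "int set" and s :: real where B: "finite B" "\<bar>s\<bar> = 1"
    "\<And>h n. real_of_int (h (m + n) - h n) = s * (\<Sum>k\<in>B. real_of_int (incr h (k + n)))"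
    using height_difference[of m] by blast
  have "integrable M (\<lambda>w. (\<Sum>k\<in>B. occ t (k + n) w)\<^sup>2)"
  proof (rule integrable_sum_square)
    fix k
    show "(\<lambda>w. occ t (k + n) w) \<in> borel_measurable M" by (rule measurable_site_fun[OF sets_M assms])
    have "integrable site (\<lambda>z. (real_of_int z)\<^sup>2)" by (rule integrable_site_quadratic[of _ 1]) simp
    then show "integrable M (\<lambda>w. (occ t (k + n) w)\<^sup>2)"
      using integrable_site_stationary(1)[OF assms, of "\<lambda>z. (real_of_int z)\<^sup>2"] by blast
  qed
  then show ?thesis unfolding B(3) power_mult_distrib by (rule integrable_mult_right)
qed

lemma integrable_flux_sq:
  assumes "0 \<le> t"
  shows "integrable M (\<lambda>w. (flux t m n w)\<^sup>2)"
proof -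
  have 1: "(\<lambda>w. real_of_int (dsp {m + n} t w)) \<in> borel_measurable M" by (rule measurable_dsp_real[OF assms])
  have "(\<lambda>w. H 0 w (m + n) - H 0 w n) \<in> M \<rightarrow>\<^sub>M count_space UNIV"
    by (intro measurable_countable_binop[where k="(-)"] measurable_coordinate_compose[OF measurable_H[OF sets_M]]) simp_all
  then have 2: "(\<lambda>w. real_of_int (H 0 w (m + n) - H 0 w n)) \<in> borel_measurable M" by (rule measurable_compose) simp
  have "integrable M (\<lambda>w. (real_of_int (dsp {m + n} t w))\<^sup>2 + (real_of_int (H 0 w (m + n) - H 0 w n))\<^sup>2 +
      2 * (real_of_int (dsp {m + n} t w) * real_of_int (H 0 w (m + n) - H 0 w n)))"
    by (intro Bochner_Integration.integrable_add integrable_mult_right integrable_product_of_squares 1 2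
        second_moment(1) assms integrable_height_difference_sq) simp_all
  then show ?thesis unfolding flux_split power2_sum by (simp only: mult.assoc)
qed

lemma integrable_flux:
  assumes "0 \<le> t"
  shows "integrable M (flux t m n)"
  by (rule integrable_of_square[OF M.prob_space_axioms measurable_flux[OF assms] integrable_flux_sq[OF assms]])

lemma distr_flux:
  assumes t: "0 \<le> t"
  shows "distr M borel (flux t m n) = distr M borel (flux t m 0)"
proof -
  define \<Phi> where "\<Phi> x = real_of_int (snd x m - fst x 0)" for x :: "config \<times> config"
  have \<Phi>m: "\<Phi> \<in> borel_measurable config_pairs"
  proof -
    have "(\<lambda>x. snd x m - fst x 0) \<in> config_pairs \<rightarrow>\<^sub>M count_space UNIV"
      by (intro measurable_countable_binop[where k="(-)"] measurable_coordinate_compose[OF measurable_fst] measurable_coordinate_compose[OF measurable_snd]) simp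
    then show ?thesis unfolding \<Phi>_def by (rule measurable_compose) simp
  qed
  have "\<Phi> (\<lambda>i. g i + c, \<lambda>i. h i + c) = \<Phi> (g, h)" for g h c by (simp add: \<Phi>_def)
  from distr_translate[OF \<Phi>m this t, of n] show ?thesis
    by (simp add: \<Phi>_def flux_def[abs_def])
qed

lemma stationary_two_point:
  assumes "0 \<le> t"
  shows "(LINT w|M. (occ t i w - mean) * (occ t k w - mean)) = site_var I f \<theta> * of_bool (i = k)"
proof -
  have m: "(\<lambda>\<omega>. real_of_int (\<omega> i) - mean) \<in> borel_measurable config_space" for i
    by (rule measurable_compose[OF measurable_config_coordinate]) simp
  have i: "integrable \<mu> (\<lambda>\<omega>. real_of_int (\<omega> i) - mean)" "(LINT \<omega>|\<mu>. real_of_int (\<omega> i) - mean) = 0" for i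
    using integrable_coordinate_iff[of "\<lambda>z. real_of_int z - mean" i] integral_coordinate[of "\<lambda>z. real_of_int z - mean" i] integrable_site_id
    by (simp_all add: site.prob_space[simplified])
  have "(LINT w|M. (occ t i w - mean) * (occ t k w - mean)) =
    (LINT \<omega>|\<mu>. (real_of_int (\<omega> i) - mean) * (real_of_int (\<omega> k) - mean))"
    by (rule integral_stationary[OF assms borel_measurable_times[OF m m]])
  also have "\<dots> = site_var I f \<theta> * of_bool (i = k)"
  proof (cases "i = k")
    case True
    then show ?thesis
      using integral_coordinate[of "\<lambda>z. (real_of_int z - mean)\<^sup>2" k] by (simp add: site_var_eq power2_eq_square)
  next
    case False
    have "(LINT \<omega>|\<mu>. (real_of_int (\<omega> i) - mean) * (real_of_int (\<omega> k) - mean)) =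
      (LINT \<omega>|\<mu>. real_of_int (\<omega> i) - mean) * (LINT \<omega>|\<mu>. real_of_int (\<omega> k) - mean)"
      by (rule disjoint_dependence_integral[where A="{i}" and B="{k}", OF m m _ _ _ i(1) i(1)]) (use False in auto)
    with False show ?thesis by (simp add: i)
  qed
  finally show ?thesis .
qed

lemma flux_mean:
  assumes "0 \<le> t"
  shows "(LINT w|M. flux t m n w) = (LINT w|M. flux t m 0 w)"
  using integral_distr[OF measurable_flux[OF assms], of "\<lambda>x. x" m n] integral_distr[OF measurable_flux[OF assms], of "\<lambda>x. x" m 0]
    distr_flux[OF assms, of m n] by simp

lemma flux_variance:
  assumes "0 \<le> t"
  shows "(LINT w|M. (flux t m n w - c)\<^sup>2) = (LINT w|M. (flux t m 0 w - c)\<^sup>2)"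
  using integral_distr[OF measurable_flux[OF assms], of "\<lambda>x. (x - c)\<^sup>2" m n] integral_distr[OF measurable_flux[OF assms], of "\<lambda>x. (x - c)\<^sup>2" m 0]
    distr_flux[OF assms, of m n] by simp

lemma integrable_flux_centred_sq:
  assumes "0 \<le> t"
  shows "integrable M (\<lambda>w. (flux t m n w - c)\<^sup>2)"
proof -
  have "integrable M (\<lambda>w. (flux t m n w)\<^sup>2 + c\<^sup>2 - 2 * c * flux t m n w)"
    by (intro Bochner_Integration.integrable_add Bochner_Integration.integrable_diff integrable_mult_right integrable_flux_sq integrable_flux assms) simp
  then show ?thesis by (simp add: power2_diff mult_ac)
qed

text \<open>Conservation of particles expresses the difference of two currents through the initial and
  final particle numbers of an interval; the mixed terms are two-point functions. Counting
  the pairs of sites with a given difference leaves a truncated displacement of the second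
  class particle.\<close>

lemma flux_difference_variance:
  assumes t: "0 \<le> t"
  shows "(LINT w|M. (flux t m 0 w - flux t m (int n) w)\<^sup>2) =
    2 * site_var I f \<theta> * (LINT w|M'. min (real n) \<bar>real_of_int (Q t w - m)\<bar>)"
proof -
  define \<alpha> where "\<alpha> i w = occ t (m + int i) w - mean" for i w
  define \<beta> where "\<beta> i w = occ 0 (int i) w - mean" for i w
  let ?\<sigma> = "site_var I f \<theta>"
  have d: "flux t m 0 w - flux t m (int n) w = (\<Sum>i\<in>{1..n}. \<alpha> i w - \<beta> i w)" for w
  proof -
    have "flux t m 0 w - flux t m (int n) w = real_of_int (H t w m - H t w (m + int n)) - real_of_int (H 0 w 0 - H 0 w (0 + int n))"
      by (simp add: flux_def)
    then show ?thesis unfolding increments_telescope by (simp add: \<alpha>_def \<beta>_def sum_subtractf)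
  qed
  have pi: "integrable M (\<lambda>w. \<alpha> i w * \<alpha> k w)" "integrable M (\<lambda>w. \<alpha> i w * \<beta> k w)" "integrable M (\<lambda>w. \<beta> i w * \<beta> k w)" for i k
    unfolding \<alpha>_def \<beta>_def by (intro integrable_occ_product t order_refl)+
  have \<alpha>\<alpha>: "(LINT w|M. \<alpha> i w * \<alpha> k w) = ?\<sigma> * of_bool (i = k)" for i k
    unfolding \<alpha>_def stationary_two_point[OF t] by simp
  have \<beta>\<beta>: "(LINT w|M. \<beta> i w * \<beta> k w) = ?\<sigma> * of_bool (i = k)" for i k
    unfolding \<beta>_def using stationary_two_point[of 0 "int i" "int k"] by simp
  have \<alpha>\<beta>: "(LINT w|M. \<alpha> i w * \<beta> k w) = ?\<sigma> * (LINT w|M'. (of_bool (Q t w - m = int i - int k) :: real))" for i k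
  proof -
    have "(Q t w = m + int i - int k) = (Q t w - m = int i - int k)" for w by auto
    then show ?thesis unfolding \<alpha>_def \<beta>_def two_point[OF t] by simp
  qed
  have expand: "(\<alpha> i w - \<beta> i w) * (\<alpha> k w - \<beta> k w) = \<alpha> i w * \<alpha> k w + \<beta> i w * \<beta> k w - \<alpha> i w * \<beta> k w - \<alpha> k w * \<beta> i w" for i k w
    by (simp add: algebra_simps)
  have Qi: "integrable M' (\<lambda>w. of_bool (Q t w - m = j) :: real)" for j
    by (rule M'.integrable_const_bound[of _ 1, OF _ measurable_position[OF sets_M' t, of "\<lambda>q. of_bool (q - m = j)"]]) (rule AE_I2, simp)
  have "(LINT w|M. (flux t m 0 w - flux t m (int n) w)\<^sup>2) = (LINT w|M. (\<Sum>i\<in>{1..n}. \<Sum>k\<in>{1..n}. (\<alpha> i w - \<beta> i w) * (\<alpha> k w - \<beta> k w)))"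
    unfolding d power2_eq_square sum_product ..
  also have "\<dots> = (\<Sum>i\<in>{1..n}. \<Sum>k\<in>{1..n}. LINT w|M. (\<alpha> i w - \<beta> i w) * (\<alpha> k w - \<beta> k w))"
    unfolding expand by (subst Bochner_Integration.integral_sum; (intro sum.cong refl)?; (subst Bochner_Integration.integral_sum)?;
      intro Bochner_Integration.integrable_sum Bochner_Integration.integrable_add Bochner_Integration.integrable_diff pi refl)
  also have "\<dots> = (\<Sum>i\<in>{1..n}. \<Sum>k\<in>{1..n}. 2 * ?\<sigma> * of_bool (i = k) - ?\<sigma> * (LINT w|M'. (of_bool (Q t w - m = int i - int k) :: real)) -
      ?\<sigma> * (LINT w|M'. (of_bool (Q t w - m = int k - int i) :: real)))"
    unfolding expand by (intro sum.cong refl) (simp add: pi \<alpha>\<alpha> \<beta>\<beta> \<alpha>\<beta>)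
  also have "\<dots> = 2 * ?\<sigma> * (\<Sum>i\<in>{1..n}. \<Sum>k\<in>{1..n}. of_bool (i = k)) - ?\<sigma> * (\<Sum>i\<in>{1..n}. \<Sum>k\<in>{1..n}. LINT w|M'. (of_bool (Q t w - m = int i - int k) :: real))
      - ?\<sigma> * (\<Sum>i\<in>{1..n}. \<Sum>k\<in>{1..n}. LINT w|M'. (of_bool (Q t w - m = int k - int i) :: real))"
    by (simp only: sum_subtractf sum_distrib_left)
  also have "(\<Sum>i\<in>{1..n}. \<Sum>k\<in>{1..n}. LINT w|M'. (of_bool (Q t w - m = int k - int i) :: real)) = (\<Sum>i\<in>{1..n}. \<Sum>k\<in>{1..n}. LINT w|M'. (of_bool (Q t w - m = int i - int k) :: real))"
    by (rule sum.swap)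
  also have "(\<Sum>i\<in>{1..n}. \<Sum>k\<in>{1..n}. LINT w|M'. (of_bool (Q t w - m = int i - int k) :: real)) =
     (LINT w|M'. (\<Sum>i\<in>{1..n}. \<Sum>k\<in>{1..n}. (of_bool (Q t w - m = int i - int k) :: real)))"
    by (simp only: Bochner_Integration.integral_sum Qi Bochner_Integration.integrable_sum)
  also have "\<dots> = (LINT w|M'. real n - min (real n) \<bar>real_of_int (Q t w - m)\<bar>)"
    unfolding count_pairs_with_difference ..
  also have "\<dots> = real n - (LINT w|M'. min (real n) \<bar>real_of_int (Q t w - m)\<bar>)"
  proof -
    have "integrable M' (\<lambda>w. min (real n) \<bar>real_of_int (Q t w - m)\<bar>)"
      by (rule M'.integrable_const_bound[of _ "real n", OF _ measurable_position[OF sets_M' t, of "\<lambda>q. min (real n) \<bar>real_of_int (q - m)\<bar>"]]) (rule AE_I2, simp)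
    then show ?thesis by (simp add: M'.prob_space[simplified])
  qed
  also have "(\<Sum>i\<in>{1..n}. \<Sum>k\<in>{1..n}. of_bool (i = k) :: real) = real n"
    by (simp add: of_bool_def sum.delta)
  finally show ?thesis by (simp add: algebra_simps)
qed

text \<open>The sum of the fluxes is the number of bricks added over a block of \<open>N\<close> sites, up to the initial
  particle numbers of a fixed number of translates of a block. The latter are sums of \<open>N\<close>
  independent variables.\<close>

lemma flux_sum_variance_linear:
  assumes t: "0 \<le> t"
  obtains D :: real where "0 \<le> D" "\<And>N. (LINT w|M. (\<Sum>n<N. flux t m (int n) w - (LINT w|M. flux t m 0 w))\<^sup>2) \<le> D * real N"
    "\<And>N. integrable M (\<lambda>w. (\<Sum>n<N. flux t m (int n) w - (LINT w|M. flux t m 0 w))\<^sup>2)"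
proof -
  obtain C where C: "0 \<le> C" "\<And>A. finite A \<Longrightarrow>
    (LINT w|M. (real_of_int (dsp A t w) - (LINT w|M. real_of_int (dsp A t w)))\<^sup>2) \<le> C * real (card A)"
    using displacement_variance_linear[OF t] by blast
  obtain B :: "int set" and s :: real where B: "finite B" "\<bar>s\<bar> = 1"
    "\<And>h n. real_of_int (h (m + n) - h n) = s * (\<Sum>k\<in>B. real_of_int (incr h (k + n)))"
    using height_difference[of m] by blast
  let ?\<sigma> = "site_var I f \<theta>" and ?c = "LINT w|M. flux t m 0 w"
  have s0: "(0::real) \<le> 0" by simp
  have "(LINT w|M. (\<Sum>n<N. flux t m (int n) w - ?c)\<^sup>2) \<le> (2 * C + 6 * (real (card B))\<^sup>2 * ?\<sigma>) * real N" for N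
  proof -
    define A where "A = (\<lambda>n. m + int n) ` {..<N}"
    define X where "X w = real_of_int (dsp A t w) - (LINT w|M. real_of_int (dsp A t w))" for w
    define Z where "Z i w = occ 0 i w - mean" for i w
    define W where "W k w = (\<Sum>i\<in>(\<lambda>n. k + int n) ` {..<N}. Z i w)" for k w
    have inj: "inj_on (\<lambda>n. k + int n) {..<N}" for k by (auto simp: inj_on_def)
    have A: "finite A" "card A = N" unfolding A_def by (simp_all add: card_image inj)
    have Zm: "Z i \<in> borel_measurable M" and Zsq: "integrable M (\<lambda>w. (Z i w)\<^sup>2)"
      and Zi: "integrable M (Z i)" "(LINT w|M. Z i w) = 0" for i
      unfolding Z_def
      by (rule measurable_occ_centred[OF s0] integrable_occ_centred_sq[OF s0] integrable_occ_centred[OF s0] mean_occ_centred[OF s0])+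
    have ZZ: "(LINT w|M. Z i w * Z k w) = ?\<sigma> * of_bool (i = k)" for i k
      unfolding Z_def by (rule stationary_two_point[OF s0])
    have Wm: "W k \<in> borel_measurable M" for k unfolding W_def by (intro borel_measurable_sum Zm)
    have Wsq: "integrable M (\<lambda>w. (W k w)\<^sup>2)" for k
      unfolding W_def by (rule integrable_sum_square[OF Zm Zsq])
    have Wvar: "(LINT w|M. (W k w)\<^sup>2) \<le> 3 * ?\<sigma> * real N" for k
    proof -
      have "(LINT w|M. (W k w)\<^sup>2) \<le> 3 * ?\<sigma> * real (card ((\<lambda>n. k + int n) ` {..<N}))"
        unfolding W_def
      proof (rule nearly_orthogonal_sum[OF _ Zm Zsq])
        show "(LINT w|M. (Z n w)\<^sup>2) \<le> ?\<sigma>" for n using ZZ[of n n] by (simp add: power2_eq_square)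
        show "(LINT w|M. Z n w * Z k w) = 0" if "1 < \<bar>n - k\<bar>" for n k using that by (subst ZZ) auto
      qed simp
      then show ?thesis by (simp add: card_image inj)
    qed
    have Wi: "integrable M (W k)" "(LINT w|M. W k w) = 0" for k
    proof -
      show "integrable M (W k)" unfolding W_def by (intro Bochner_Integration.integrable_sum Zi)
      show "(LINT w|M. W k w) = 0" unfolding W_def by (simp add: Bochner_Integration.integral_sum Zi)
    qed
    have total: "(\<Sum>n<N. flux t m (int n) w) = real_of_int (dsp A t w) + s * (\<Sum>k\<in>B. W k w) + s * real (card B) * real N * mean" for w
    proof -
      have "(\<Sum>n<N. flux t m (int n) w) = (\<Sum>n<N. real_of_int (H t w (m + int n) - H 0 w (m + int n))) + (\<Sum>n<N. real_of_int (H 0 w (m + int n) - H 0 w (int n)))"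
        unfolding flux_def sum.distrib[symmetric] by (rule sum.cong) auto
      also have "(\<Sum>n<N. real_of_int (H t w (m + int n) - H 0 w (m + int n))) = real_of_int (dsp A t w)"
        unfolding disp_def A_def by (subst sum.reindex[OF inj]) simp
      also have "(\<Sum>n<N. real_of_int (H 0 w (m + int n) - H 0 w (int n))) = (\<Sum>n<N. s * (\<Sum>k\<in>B. Z (k + int n) w + mean))"
        unfolding B(3) Z_def by simp
      also have "\<dots> = s * (\<Sum>k\<in>B. \<Sum>n<N. Z (k + int n) w + mean)"
        unfolding sum_distrib_left[symmetric] by (subst sum.swap) simp
      also have "\<dots> = s * (\<Sum>k\<in>B. W k w) + s * real (card B) * real N * mean"
        unfolding W_def sum.reindex[OF inj] by (simp add: sum.distrib distrib_left o_def)
      finally show ?thesis by simp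
    qed
    have Ai: "integrable M (\<lambda>w. real_of_int (dsp A t w))" by (rule integrable_displacement[OF A(1) t])
    have "real N * ?c = (\<Sum>n<N. ?c)" by simp
    also have "\<dots> = (\<Sum>n<N. LINT w|M. flux t m (int n) w)"
      by (intro sum.cong refl flux_mean[OF t, symmetric])
    also have "\<dots> = (LINT w|M. (\<Sum>n<N. flux t m (int n) w))"
      by (rule Bochner_Integration.integral_sum[symmetric]) (rule integrable_flux[OF t])
    also have "\<dots> = (LINT w|M. real_of_int (dsp A t w)) + s * real (card B) * real N * mean"
      unfolding total using Ai Wi by (simp add: Bochner_Integration.integral_sum Bochner_Integration.integrable_sum M.prob_space[simplified])
    finally have Nc: "real N * ?c = (LINT w|M. real_of_int (dsp A t w)) + s * real (card B) * real N * mean" .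
    have eq: "(\<Sum>n<N. flux t m (int n) w - ?c) = X w + s * (\<Sum>k\<in>B. W k w)" for w
      using total[of w] Nc by (simp add: sum_subtractf X_def)
    have s2: "s\<^sup>2 = 1" using B(2) by (metis power2_abs power_one)
    have le: "(X w + s * (\<Sum>k\<in>B. W k w))\<^sup>2 \<le> 2 * (X w)\<^sup>2 + 2 * (real (card B) * (\<Sum>k\<in>B. (W k w)\<^sup>2))" for w
    proof -
      have "(X w + s * (\<Sum>k\<in>B. W k w))\<^sup>2 \<le> 2 * (X w)\<^sup>2 + 2 * (s * (\<Sum>k\<in>B. W k w))\<^sup>2"
        using zero_le_power2[of "X w - s * (\<Sum>k\<in>B. W k w)"] unfolding power2_diff power2_sum by linarith
      also have "\<dots> = 2 * (X w)\<^sup>2 + 2 * (\<Sum>k\<in>B. W k w)\<^sup>2" by (simp add: power_mult_distrib s2)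
      also have "\<dots> \<le> 2 * (X w)\<^sup>2 + 2 * (real (card B) * (\<Sum>k\<in>B. (W k w)\<^sup>2))"
        using square_sum_le[of "\<lambda>k. W k w" B] by simp
      finally show ?thesis .
    qed
    have Xsq: "integrable M (\<lambda>w. (X w)\<^sup>2)" unfolding X_def by (rule integrable_centred_displacement_sq[OF A(1) t])
    have lhs_int: "integrable M (\<lambda>w. (\<Sum>n<N. flux t m (int n) w - ?c)\<^sup>2)"
      by (rule integrable_sum_square)
        (intro borel_measurable_diff borel_measurable_const measurable_flux[OF t] integrable_flux_centred_sq[OF t])+
    have rhs_int: "integrable M (\<lambda>w. 2 * (X w)\<^sup>2 + 2 * (real (card B) * (\<Sum>k\<in>B. (W k w)\<^sup>2)))"
      by (intro Bochner_Integration.integrable_add integrable_mult_right Bochner_Integration.integrable_sum Xsq Wsq)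
    have "(LINT w|M. (\<Sum>n<N. flux t m (int n) w - ?c)\<^sup>2) \<le> (LINT w|M. 2 * (X w)\<^sup>2 + 2 * (real (card B) * (\<Sum>k\<in>B. (W k w)\<^sup>2)))"
      by (rule integral_mono[OF lhs_int rhs_int]) (simp only: eq le)
    also have "\<dots> = 2 * (LINT w|M. (X w)\<^sup>2) + 2 * (real (card B) * (\<Sum>k\<in>B. LINT w|M. (W k w)\<^sup>2))"
      using Xsq Wsq by (simp add: Bochner_Integration.integral_sum Bochner_Integration.integrable_sum)
    also have "\<dots> \<le> 2 * (C * real N) + 2 * (real (card B) * (\<Sum>k\<in>B. 3 * ?\<sigma> * real N))"
      using C(2)[OF A(1)] unfolding A(2) X_def by (intro add_mono mult_left_mono sum_mono Wvar) auto
    also have "\<dots> = (2 * C + 6 * (real (card B))\<^sup>2 * ?\<sigma>) * real N"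
      by (simp add: algebra_simps power2_eq_square)
    finally show ?thesis .
  qed
  moreover have "0 \<le> 2 * C + 6 * (real (card B))\<^sup>2 * ?\<sigma>" using C site_var_pos by (simp add: less_imp_le)
  moreover have "integrable M (\<lambda>w. (\<Sum>n<N. flux t m (int n) w - ?c)\<^sup>2)" for N
    by (rule integrable_sum_square)
      (intro borel_measurable_diff borel_measurable_const measurable_flux[OF t] integrable_flux_centred_sq[OF t])+
  ultimately show thesis using that by blast
qed

text \<open>The variance of a difference of two fluxes is twice the variance minus twice the covariance \<open>x n\<close>.
  Hence \<open>x\<close> decreases, and its partial sums are covariances of one flux with a sum of \<open>N\<close> fluxes,
  which are of order \<open>sqrt N\<close>. So \<open>x\<close> tends to zero, and the truncation of the displacement of the
  second class particle disappears by monotone convergence.\<close>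

theorem flux_variance_second_class:
  assumes t: "0 \<le> t"
  shows "integrable M' (\<lambda>w. \<bar>real_of_int (Q t w - m)\<bar>)"
    and "(LINT w|M. (flux t m 0 w - (LINT w|M. flux t m 0 w))\<^sup>2) = site_var I f \<theta> * (LINT w|M'. \<bar>real_of_int (Q t w - m)\<bar>)"
proof -
  let ?c = "LINT w|M. flux t m 0 w" and ?\<sigma> = "site_var I f \<theta>"
  define Y where "Y n w = flux t m (int n) w - ?c" for n :: nat and w
  define v where "v = (LINT w|M. (Y 0 w)\<^sup>2)"
  define x where "x n = (LINT w|M. Y 0 w * Y n w)" for n
  define L where "L n = (LINT w|M'. min (real n) \<bar>real_of_int (Q t w - m)\<bar>)" for n
  have Ysq: "integrable M (\<lambda>w. (Y n w)\<^sup>2)" for n unfolding Y_def by (rule integrable_flux_centred_sq[OF t])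
  have Ym: "Y n \<in> borel_measurable M" for n
    unfolding Y_def by (intro borel_measurable_diff borel_measurable_const measurable_flux[OF t])
  have YY: "integrable M (\<lambda>w. Y i w * Y n w)" for i n by (rule integrable_product_of_squares[OF Ym Ym Ysq Ysq])
  have Yvar: "(LINT w|M. (Y n w)\<^sup>2) = v" for n
    unfolding v_def Y_def using flux_variance[OF t, of m "int n" ?c] by simp
  have Li: "integrable M' (\<lambda>w. min (real n) \<bar>real_of_int (Q t w - m)\<bar>)" for n
    by (rule M'.integrable_const_bound[of _ "real n", OF _ measurable_position[OF sets_M' t, of "\<lambda>q. min (real n) \<bar>real_of_int (q - m)\<bar>"]]) (rule AE_I2, simp)
  have key: "x n = v - ?\<sigma> * L n" for n
  proof -
    have "(LINT w|M. (flux t m 0 w - flux t m (int n) w)\<^sup>2) = (LINT w|M. (Y 0 w)\<^sup>2 + (Y n w)\<^sup>2 - 2 * (Y 0 w * Y n w))"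
      by (rule Bochner_Integration.integral_cong) (simp_all add: Y_def power2_eq_square algebra_simps)
    also have "\<dots> = 2 * v - 2 * x n" using Ysq YY Yvar by (simp add: x_def)
    finally show ?thesis using flux_difference_variance[OF t, of m n] by (simp add: L_def)
  qed
  have anti: "x k \<le> x n" if "n \<le> k" for n k
  proof -
    have "L n \<le> L k" unfolding L_def using that by (intro integral_mono Li) auto
    then show ?thesis unfolding key using site_var_pos by simp
  qed
  obtain D :: real where D: "0 \<le> D" "\<And>N. (LINT w|M. (\<Sum>n<N. Y n w)\<^sup>2) \<le> D * real N" "\<And>N. integrable M (\<lambda>w. (\<Sum>n<N. Y n w)\<^sup>2)"
    using flux_sum_variance_linear[OF t, of m] unfolding Y_def by blast
  have sums: "\<bar>\<Sum>n<N. x n\<bar> \<le> ((v + D) / 2) * sqrt (real N)" for N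
  proof (cases "N = 0")
    case False
    (* Weighting the two squares by r and 1/r balances a variance of order one against one of
       order N. *)
    define r where "r = sqrt (real N)"
    have r: "0 < r" "real N = r * r" using False by (auto simp: r_def)
    have "(\<Sum>n<N. x n) = (LINT w|M. Y 0 w * (\<Sum>n<N. Y n w))"
      unfolding x_def sum_distrib_left by (rule Bochner_Integration.integral_sum[OF YY, symmetric])
    also have "\<bar>\<dots>\<bar> \<le> (LINT w|M. \<bar>Y 0 w * (\<Sum>n<N. Y n w)\<bar>)" by (rule integral_abs_bound)
    also have "\<dots> \<le> (LINT w|M. (r / 2) * (Y 0 w)\<^sup>2 + (1 / (2 * r)) * (\<Sum>n<N. Y n w)\<^sup>2)"
    proof (rule integral_mono)
      show "integrable M (\<lambda>w. \<bar>Y 0 w * (\<Sum>n<N. Y n w)\<bar>)"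
        unfolding sum_distrib_left by (intro integrable_abs Bochner_Integration.integrable_sum YY)
      show "integrable M (\<lambda>w. (r / 2) * (Y 0 w)\<^sup>2 + (1 / (2 * r)) * (\<Sum>n<N. Y n w)\<^sup>2)"
        by (intro Bochner_Integration.integrable_add integrable_mult_right Ysq D)
      fix w
      let ?a = "Y 0 w" and ?b = "\<Sum>n<N. Y n w"
      have "\<bar>(r * ?a) * ?b\<bar> \<le> ((r * ?a)\<^sup>2 + ?b\<^sup>2) / 2" by (rule abs_mult_le_squares)
      then have "r * \<bar>?a * ?b\<bar> \<le> r * ((r / 2) * ?a\<^sup>2 + (1 / (2 * r)) * ?b\<^sup>2)"
        using r by (simp add: abs_mult power_mult_distrib distrib_left mult.assoc[symmetric] power2_eq_square[of r] add_divide_distrib)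
      then show "\<bar>?a * ?b\<bar> \<le> (r / 2) * ?a\<^sup>2 + (1 / (2 * r)) * ?b\<^sup>2"
        using r(1) by (subst (asm) mult_le_cancel_left_pos)
    qed
    also have "\<dots> = (r / 2) * v + (1 / (2 * r)) * (LINT w|M. (\<Sum>n<N. Y n w)\<^sup>2)"
      using Ysq D(3) by (simp add: v_def)
    also have "\<dots> \<le> (r / 2) * v + (1 / (2 * r)) * (D * real N)"
      using D(2)[of N] r by (intro add_left_mono mult_left_mono) auto
    also have "\<dots> = ((v + D) / 2) * r"
      unfolding r(2) using r(1) by (simp add: field_simps)
    finally show ?thesis unfolding r_def .
  qed simp
  have "x \<longlonglongrightarrow> 0" by (rule antimono_partial_sums_tendsto_0[OF anti sums])
  then have "(\<lambda>n. (v - x n) / ?\<sigma>) \<longlonglongrightarrow> (v - 0) / ?\<sigma>"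
    using site_var_pos by (intro tendsto_intros) auto
  then have lim: "L \<longlonglongrightarrow> v / ?\<sigma>" unfolding key using site_var_pos by simp
  have mono: "AE w in M'. mono (\<lambda>n. min (real n) \<bar>real_of_int (Q t w - m)\<bar>)"
    by (intro AE_I2 monoI) auto
  have ptw: "AE w in M'. (\<lambda>n. min (real n) \<bar>real_of_int (Q t w - m)\<bar>) \<longlonglongrightarrow> \<bar>real_of_int (Q t w - m)\<bar>"
  proof (intro AE_I2 tendsto_eventually)
    fix w
    show "\<forall>\<^sub>F n in sequentially. min (real n) \<bar>real_of_int (Q t w - m)\<bar> = \<bar>real_of_int (Q t w - m)\<bar>"
      using eventually_ge_at_top[of "nat \<bar>Q t w - m\<bar>"] by eventually_elim (rule min_absorb2, linarith)
  qed
  have qm: "(\<lambda>w. \<bar>real_of_int (Q t w - m)\<bar>) \<in> borel_measurable M'"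
    by (rule measurable_position[OF sets_M' t, of "\<lambda>q. \<bar>real_of_int (q - m)\<bar>"])
  show "integrable M' (\<lambda>w. \<bar>real_of_int (Q t w - m)\<bar>)"
    by (rule integrable_monotone_convergence[OF Li mono ptw lim[unfolded L_def] qm])
  have "(LINT w|M'. \<bar>real_of_int (Q t w - m)\<bar>) = v / ?\<sigma>"
    by (rule integral_monotone_convergence[OF Li mono ptw lim[unfolded L_def] qm])
  then show "(LINT w|M. (flux t m 0 w - ?c)\<^sup>2) = ?\<sigma> * (LINT w|M'. \<bar>real_of_int (Q t w - m)\<bar>)"
    using site_var_pos by (simp add: v_def Y_def)
qed

end

theorem corollary2p4:
  fixes wmin wmax :: ereal and p q :: "int \<Rightarrow> int \<Rightarrow> real" and f :: "int \<Rightarrow> real"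
    and T :: "config set"
    and F :: "'a measure" and P :: "config \<Rightarrow> 'a measure" and H :: "real \<Rightarrow> 'a \<Rightarrow> config"
    and F2 :: "'b measure" and P2 :: "config \<times> config \<Rightarrow> 'b measure"
    and G K :: "real \<Rightarrow> 'b \<Rightarrow> config"
    and \<theta> V t :: real
  assumes "basic_coupling wmin wmax p q f T F P H F2 P2 G K"
    and "theta_lower wmin f < ereal \<theta>" and "ereal \<theta> < theta_upper wmax f"
    and "0 < t"
  shows "let I = state_set wmin wmax;
             M = started P (product_measure I f \<theta>);
             M' = started_pair P2 (modified_product_measure I f \<theta>);
             J = (\<lambda>w. real_of_int (current H V t w));
             R = (\<lambda>w. \<bar>real_of_int (second_class G K t w - towards_zero (V * t))\<bar>)
         in integrable M (\<lambda>w. (J w)\<^sup>2) \<and> integrable M' R \<and>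
            prob_space.variance M J = site_var I f \<theta> * prob_space.expectation M' R"
proof -
  interpret basic_coupling wmin wmax p q f "state_set wmin wmax" T F P H F2 P2 G K by fact simp
  interpret stationary_coupling wmin wmax p q f "state_set wmin wmax" T F P H F2 P2 G K \<theta>
    by unfold_locales (use assms in auto)
  have t: "0 \<le> t" using assms(4) by simp
  have J: "(\<lambda>w. real_of_int (current H V t w)) = flux t (towards_zero (V * t)) 0"
    by (simp add: fun_eq_iff current_def flux_def)
  show ?thesis
    unfolding Let_def J
    using integrable_flux_sq[OF t] flux_variance_second_class[OF t] by blast
qed

end
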